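(* Let $L$ be a prime link with a reduced, special alternating diagram $D$. Suppose $\theta(D)$ consists of a single $\theta$-graph with $n+1$ edges and total weight $m$. Then $\mathcal K(D)$ is (isomorphic, as a simplicial complex, to) the edgewise subdivision $\mathrm{Esd}_m([v_0,\dots,v_n])$ of an $n$-simplex.
   Context: Links are oriented, non-split links in $\mathbb{S}^3$; diagrams lie in $\mathbb{S}^2$. A diagram is special if every Seifert circle is innermost in $\mathbb{S}^2$; the regions of $D$ contained in the disjoint discs bounded by the Seifert circles are black, all others white. A diagram is reduced if it has no nugatory crossings. The graph $G^{\mathcal F}(D)$. Let $\mathcal G$ be the planar graph with a vertex in each black region and an edge through each crossing. While two distinct edges bound a bigon region of $\mathbb{S}^2\setminus\mathcal G$, delete one of them. Then, as long as possible, whenever there is an edge $e$ of $\mathcal G$ and an arc $\rho'$ meeting $\mathcal G$ only in its endpoints, with $e\cup\rho'$ a simple closed curve and $\mathbb{S}^2\setminus(\mathcal G\cup\rho')$ having no bigon regions, add $\rho'$ as a new edge. The result is $G^{\mathcal F}(D)$. Each edge $e$ has weight $w(e)\ge 0$, the number of crossings of $D$ corresponding to it (parallel edges deleted in the first step are counted with the retained edge; added edges have weight $0$). $\theta$-graphs. If two vertices are joined by at least two edges of $G^{\mathcal F}(D)$, those vertices and all edges joining them form a $\theta$-graph; its total weight is the sum of the weights of its edges. $\theta(D)$ is the union of all $\theta$-graphs. For an edge $e$ of $\theta(D)$, $e^\theta$ is the $\theta$-graph containing it and $w^\theta(e^\theta)$ its total weight. "A region of $\theta(D)$" means a region of $\mathbb{S}^2\setminus\tilde\theta(D)$,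 where $\tilde\theta(D)$ is obtained from $\theta(D)$ by cutting apart vertices so that the $\theta$-graphs become disjoint (so $\tilde\theta(D)=\theta(D)$ when there is a single $\theta$-graph). Each vertex inherits a rotation direction from the orientation of the Seifert circle around it; this induces a transverse orientation on each edge (the directions at its two ends agree), whose normal points from the negative side to the positive side of the edge. The complex $\mathcal K(D)$. Let $e_1,\dots,e_N$ be the edges of $\theta(D)$. The vertices of $\mathcal K(D)$ are the $(w_1,\dots,w_N)\in\mathbb Z^N$ with $w_i\ge 0$ and $\sum_{\{j: e_j\in e_i^\theta\}}w_j=w^\theta(e_i^\theta)$ for all $i$. For a region $r$, $\partial^+r$ is the set of edges that $r$ meets exactly on their negative side and $\partial^-r$ the set it meets exactly on their positive side. The partial map $r^\theta$ increases $w_i$ by $1$ for $e_i\in\partial^+r$, decreases $w_i$ by $1$ for $e_i\in\partial^-r$, fixes the other coordinates, and is defined when $w_i>0$ for all $e_i\in\partial^-r$. Distinct vertices $u_0,\dots,u_k$ span a $k$-simplex if the regions of $\theta(D)$ can be labelled $r_1,\dots,r_M$ (all regions, each once) such that $r_j^\theta(\cdots r_1^\theta(u_0)\cdots)$ is defined for $1\le j\le M$ and each $u_i$ occurs as $r_j^\theta(\cdots r_1^\theta(u_0)\cdots)$ for some $j$. Edgewise subdivision. Let $[v_0,\dots,v_n]$ be an $n$-simplex with ordered vertices. A colour scheme is an $m\times(l+1)$ matrix $\mathbf X=(x_{ij})$, $1\le i\le m$, $0\le j\le l$, for some $l\le n$, with entries in $\{0,\dots,n\}$, with pairwise distinct columns,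 and with $x_{10}\le x_{11}\le\cdots\le x_{1l}\le x_{20}\le\cdots\le x_{ml}$. Column $k$ defines the point $v'_k=(v_{x_{1k}}+\cdots+v_{x_{mk}})/m$ of $[v_0,\dots,v_n]$, so $\mathbf X$ defines an $l$-simplex $[v'_0,\dots,v'_l]$. $\mathrm{Esd}_m([v_0,\dots,v_n])$ consists of all simplices given by colour schemes; it is a subdivision of $[v_0,\dots,v_n]$. *)

theory Defs
  imports "HOL-Analysis.Analysis" "HOL-Combinatorics.Combinatorics"
begin

section \<open>Links in the 3-sphere\<close>

text \<open>The 3-sphere is the unit sphere of $R^3 \times R$. Its equator is the 2-sphere on which
  diagrams are drawn; the last coordinate is the height above it.\<close>

type_synonym space4 = "(real^3) \<times> real"

abbreviation S3 :: "space4 set" where "S3 \<equiv> sphere 0 1"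

definition equator :: "space4 set" where "equator = {p \<in> S3. snd p = 0}"
definition upper_ball :: "space4 set" where "upper_ball = {p \<in> S3. snd p \<ge> 0}"
definition lower_ball :: "space4 set" where "lower_ball = {p \<in> S3. snd p \<le> 0}"

definition S3_homeo :: "(space4 \<Rightarrow> space4) \<Rightarrow> bool" where
  "S3_homeo h \<longleftrightarrow> (\<exists>g. homeomorphism S3 S3 h g)"

text \<open>An oriented link is a list of loops, one for each component, parametrised by the unit circle
  of the complex plane (counterclockwise). The underlying set is locally flat, i.e.\ the link is
  tame.\<close>

type_synonym link = "(complex \<Rightarrow> space4) list"

definition link_set :: "link \<Rightarrow> space4 set" where
  "link_set L = (\<Union>i<length L. (L ! i) ` sphere 0 1)"

definition locally_flat_curve :: "space4 set \<Rightarrow> bool" where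
  "locally_flat_curve X \<longleftrightarrow>
     (\<forall>p\<in>X. \<exists>U f g. openin (top_of_set S3) U \<and> p \<in> U
        \<and> homeomorphism U (UNIV :: (complex \<times> real) set) f g
        \<and> f ` (U \<inter> X) = {y. fst y = 0})"

definition oriented_link :: "link \<Rightarrow> bool" where
  "oriented_link L \<longleftrightarrow>
     L \<noteq> []
     \<and> (\<forall>i<length L. continuous_on (sphere 0 1) (L ! i) \<and> (L ! i) ` sphere 0 1 \<subseteq> S3)
     \<and> (\<forall>i<length L. \<forall>j<length L. \<forall>z\<in>sphere 0 1. \<forall>w\<in>sphere 0 1.
          (L ! i) z = (L ! j) w \<longrightarrow> i = j \<and> z = w)
     \<and> locally_flat_curve (link_set L)"

definition ambient_isotopic :: "link \<Rightarrow> link \<Rightarrow> bool" where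
  "ambient_isotopic L L' \<longleftrightarrow>
     length L' = length L
     \<and> (\<exists>H :: real \<Rightarrow> space4 \<Rightarrow> space4.
          continuous_on {(t, p). t \<in> {0..1} \<and> p \<in> S3} (\<lambda>(t, p). H t p)
          \<and> (\<forall>t\<in>{0..1}. S3_homeo (H t)) \<and> (\<forall>p\<in>S3. H 0 p = p)
          \<and> (\<forall>i<length L. \<forall>z\<in>sphere 0 1. (L' ! i) z = H 1 ((L ! i) z)))"

text \<open>A tame 2-sphere in the 3-sphere is the image of the equator under a self-homeomorphism.
  Below the sphere is kept at the equator and the link is moved instead.\<close>

definition non_split :: "link \<Rightarrow> bool" where
  "non_split L \<longleftrightarrow>
     (\<forall>h. S3_homeo h \<longrightarrow> h ` link_set L \<inter> equator = {} \<longrightarrow>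
        h ` link_set L \<subseteq> upper_ball \<or> h ` link_set L \<subseteq> lower_ball)"

definition unknot :: "link \<Rightarrow> bool" where
  "unknot L \<longleftrightarrow>
     (\<exists>h. S3_homeo h \<and> h ` link_set L = {p \<in> S3. snd p = 0 \<and> fst p $ 3 = 0})"

definition transverse_to_equator :: "space4 set \<Rightarrow> bool" where
  "transverse_to_equator X \<longleftrightarrow>
     (\<forall>p \<in> X \<inter> equator. \<exists>U f g. openin (top_of_set S3) U \<and> p \<in> U
        \<and> homeomorphism U (UNIV :: (complex \<times> real) set) f g
        \<and> f ` (U \<inter> equator) = {y. snd y = 0}
        \<and> f ` (U \<inter> X) = {y. fst y = 0})"

definition trivial_arc_in :: "space4 set \<Rightarrow> space4 set \<Rightarrow> bool" where
  "trivial_arc_in X B \<longleftrightarrow>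
     (\<exists>f g. homeomorphism B (cball (0 :: complex \<times> real) 1) f g
        \<and> f ` (B \<inter> X) = {y \<in> cball 0 1. fst y = 0})"

definition prime_link :: "link \<Rightarrow> bool" where
  "prime_link L \<longleftrightarrow>
     \<not> unknot L
     \<and> (\<forall>h. S3_homeo h \<longrightarrow> transverse_to_equator (h ` link_set L) \<longrightarrow>
          card (h ` link_set L \<inter> equator) = 2 \<longrightarrow>
          trivial_arc_in (h ` link_set L) upper_ball \<or> trivial_arc_in (h ` link_set L) lower_ball)"


section \<open>Connected plane maps\<close>

text \<open>A connected graph drawn in the oriented 2-sphere is recorded, up to isotopy, by its darts
  (half-edges): \<open>opp\<close> exchanges the two darts of an edge and \<open>rot\<close> is the counterclockwise rotation
  of the darts at each vertex. Vertices are the \<open>rot\<close>-orbits. A dart \<open>d\<close>, pointing away from its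
  vertex, also stands for the corner between \<open>d\<close> and \<open>rot d\<close>, that is, for the corner on its left.
  The orbits of \<open>face_perm\<close> collect the corners of a region, which is traversed with the region
  on the left.\<close>

record plane_map =
  darts :: "nat set"
  opp :: "nat \<Rightarrow> nat"
  rot :: "nat \<Rightarrow> nat"

definition dart_edge :: "'a plane_map_scheme \<Rightarrow> nat \<Rightarrow> nat set" where
  "dart_edge M d = {d, opp M d}"

definition dart_vertex :: "'a plane_map_scheme \<Rightarrow> nat \<Rightarrow> nat set" where
  "dart_vertex M d = orbit (rot M) d"

definition face_perm :: "'a plane_map_scheme \<Rightarrow> nat \<Rightarrow> nat" where
  "face_perm M d = inv (rot M) (opp M d)"

definition dart_face :: "'a plane_map_scheme \<Rightarrow> nat \<Rightarrow> nat set" where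
  "dart_face M d = orbit (face_perm M) d"

definition connected_sphere_map :: "'a plane_map_scheme \<Rightarrow> bool" where
  "connected_sphere_map M \<longleftrightarrow>
     finite (darts M) \<and> darts M \<noteq> {}
     \<and> opp M permutes darts M \<and> (\<forall>d\<in>darts M. opp M d \<noteq> d \<and> opp M (opp M d) = d)
     \<and> rot M permutes darts M
     \<and> (\<forall>d\<in>darts M. \<forall>d'\<in>darts M. (\<lambda>x y. y = opp M x \<or> y = rot M x)\<^sup>*\<^sup>* d d')
     \<and> card (dart_vertex M ` darts M) + card (dart_face M ` darts M)
         = card (dart_edge M ` darts M) + 2"


section \<open>Link diagrams\<close>

text \<open>The vertices are the crossings, the edges are the arcs between consecutive crossings. A dart
  is outgoing if the orientation of the link leaves the crossing along it, and it is in
  \<open>over\<close> if it belongs to the overpassing strand. A diagram of a non-split link is connected, so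
  connectedness is no restriction here; the crossingless diagram is not represented.\<close>

record link_diagram = plane_map +
  outgoing :: "nat set"
  over :: "nat set"

definition link_diagram :: "link_diagram \<Rightarrow> bool" where
  "link_diagram D \<longleftrightarrow>
     connected_sphere_map D
     \<and> (\<forall>d\<in>darts D. card (dart_vertex D d) = 4)
     \<and> outgoing D \<subseteq> darts D \<and> over D \<subseteq> darts D
     \<and> (\<forall>d\<in>darts D.
          (opp D d \<in> outgoing D \<longleftrightarrow> d \<notin> outgoing D)
          \<and> (rot D (rot D d) \<in> outgoing D \<longleftrightarrow> d \<notin> outgoing D)
          \<and> (rot D d \<in> over D \<longleftrightarrow> d \<notin> over D))"

text \<open>\<open>diagram_of D L\<close>: some link isotopic to \<open>L\<close> projects regularly onto the equatorial sphere with
  diagram \<open>D\<close>. The projection is the radial one, defined away from the two poles.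
  The outgoing dart \<open>d\<close> names the edge traced by component \<open>c d\<close> over the parameter
  interval from \<open>a d\<close> to \<open>b d\<close>, and \<open>\<tau> d\<close> is the unit tangent vector of the diagram at the crossing
  in the direction of the dart \<open>d\<close>. The strands cross transversally and the rotation is
  counterclockwise with respect to the outward normal of the sphere, which points to the side
  of larger height.\<close>

definition proj_curve :: "link \<Rightarrow> nat \<Rightarrow> real \<Rightarrow> real^3" where
  "proj_curve L i s = sgn (fst ((L ! i) (cis s)))"

definition height_curve :: "link \<Rightarrow> nat \<Rightarrow> real \<Rightarrow> real" where
  "height_curve L i s = snd ((L ! i) (cis s))"

definition projects_to :: "link \<Rightarrow> link_diagram \<Rightarrow> bool" where
  "projects_to L D \<longleftrightarrow>
     (\<forall>p\<in>link_set L. fst p \<noteq> 0)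
     \<and> (\<exists>(c :: nat \<Rightarrow> nat) (a :: nat \<Rightarrow> real) (b :: nat \<Rightarrow> real) (\<tau> :: nat \<Rightarrow> real^3).
          (\<forall>d\<in>outgoing D. c d < length L \<and> a d < b d \<and> b d \<le> a d + 2 * pi)
          \<and> (\<forall>i<length L. \<forall>z\<in>sphere 0 1.
               \<exists>!d. d \<in> outgoing D \<and> c d = i \<and> z \<in> cis ` {a d..<b d})
          \<and> (\<forall>d\<in>outgoing D. let d' = rot D (rot D (opp D d)) in
               c d' = c d \<and> cis (a d') = cis (b d))
          \<and> (\<forall>d\<in>outgoing D. \<forall>d'\<in>outgoing D. dart_vertex D d = dart_vertex D d' \<longrightarrow>
               proj_curve L (c d) (a d) = proj_curve L (c d') (a d'))
          \<and> (\<forall>i<length L. \<forall>j<length L. \<forall>s t.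
               proj_curve L i s = proj_curve L j t \<longrightarrow> (i, cis s) \<noteq> (j, cis t) \<longrightarrow>
               (\<exists>d\<in>outgoing D. \<exists>d'\<in>outgoing D. dart_vertex D d = dart_vertex D d'
                  \<and> i = c d \<and> cis s = cis (a d) \<and> j = c d' \<and> cis t = cis (a d')))
          \<and> (\<forall>d\<in>outgoing D. \<forall>d'\<in>outgoing D.
               dart_vertex D d = dart_vertex D d' \<longrightarrow> d \<in> over D \<longrightarrow> d' \<notin> over D \<longrightarrow>
               height_curve L (c d) (a d) > height_curve L (c d') (a d'))
          \<and> (\<forall>d\<in>outgoing D.
               ((\<lambda>s. sgn (proj_curve L (c d) s - proj_curve L (c d) (a d))) \<longlongrightarrow> \<tau> d)
                  (at_right (a d))
               \<and> ((\<lambda>s. sgn (proj_curve L (c d) s - proj_curve L (c d) (b d))) \<longlongrightarrow> \<tau> (opp D d))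
                  (at_left (b d)))
          \<and> (\<forall>d\<in>darts D. \<tau> (rot D (rot D d)) = - \<tau> d)
          \<and> (\<forall>d\<in>outgoing D. \<forall>d'\<in>dart_vertex D d.
               inner (cross3 (proj_curve L (c d) (a d)) (\<tau> d')) (\<tau> (rot D d')) > 0))"

definition diagram_of :: "link_diagram \<Rightarrow> link \<Rightarrow> bool" where
  "diagram_of D L \<longleftrightarrow>
     link_diagram D \<and> (\<exists>L'. oriented_link L' \<and> ambient_isotopic L L' \<and> projects_to L' D)"

definition alternating :: "link_diagram \<Rightarrow> bool" where
  "alternating D \<longleftrightarrow> (\<forall>d\<in>darts D. opp D d \<in> over D \<longleftrightarrow> d \<notin> over D)"

text \<open>A crossing is nugatory if some simple closed curve in the sphere meets the diagram only in that
  crossing, passing through two opposite corners; these then lie in the same region.\<close>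

definition nugatory :: "link_diagram \<Rightarrow> nat \<Rightarrow> bool" where
  "nugatory D d \<longleftrightarrow> rot D (rot D d) \<in> dart_face D d"

definition reduced_diagram :: "link_diagram \<Rightarrow> bool" where
  "reduced_diagram D \<longleftrightarrow> (\<forall>d\<in>darts D. \<not> nugatory D d)"

text \<open>Smoothing a crossing joins an incoming dart to the outgoing dart next to it. A Seifert
  circle is represented by the set of outgoing darts of its edges.\<close>

definition seifert_next :: "link_diagram \<Rightarrow> nat \<Rightarrow> nat" where
  "seifert_next D d =
     (let x = opp D d in if rot D x \<in> outgoing D then rot D x else inv (rot D) x)"

definition seifert_circles :: "link_diagram \<Rightarrow> nat set set" where
  "seifert_circles D = orbit (seifert_next D) ` outgoing D"

text \<open>Regions of the complement of the Seifert circles, as sets of corners of the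
  diagram: smoothing a crossing joins the corner between its two outgoing darts to the
  corner between its two incoming darts.\<close>

definition smoothed_adjacent :: "link_diagram \<Rightarrow> nat \<Rightarrow> nat \<Rightarrow> bool" where
  "smoothed_adjacent D d d' \<longleftrightarrow>
     d \<in> darts D
     \<and> (d' = face_perm D d
        \<or> (d \<in> outgoing D \<longleftrightarrow> rot D d \<in> outgoing D) \<and> d' = rot D (rot D d))"

definition smoothed_region :: "link_diagram \<Rightarrow> nat \<Rightarrow> nat set" where
  "smoothed_region D d = {d' \<in> darts D. equivclp (smoothed_adjacent D) d d'}"

text \<open>The two sides of an edge with outgoing dart \<open>d\<close> are the corners \<open>d\<close> (left) and \<open>opp D d\<close> (right).\<close>

definition meets_circle :: "link_diagram \<Rightarrow> nat set \<Rightarrow> nat set \<Rightarrow> bool" where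
  "meets_circle D R C \<longleftrightarrow> (\<exists>d\<in>C. d \<in> R \<or> opp D d \<in> R)"

text \<open>A disc bounded by a Seifert circle and containing no other Seifert circle is the same thing as
  a region of the complement of the Seifert circles whose boundary is that circle alone.\<close>

definition seifert_disc :: "link_diagram \<Rightarrow> nat set \<Rightarrow> nat set \<Rightarrow> bool" where
  "seifert_disc D R C \<longleftrightarrow>
     R \<in> smoothed_region D ` darts D \<and> C \<in> seifert_circles D \<and> meets_circle D R C
     \<and> (\<forall>C'\<in>seifert_circles D. meets_circle D R C' \<longrightarrow> C' = C)"

definition special :: "link_diagram \<Rightarrow> bool" where
  "special D \<longleftrightarrow> (\<forall>C\<in>seifert_circles D. \<exists>R. seifert_disc D R C)"

definition black_corners :: "link_diagram \<Rightarrow> nat set" where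
  "black_corners D = {d \<in> darts D. \<exists>C. seifert_disc D (smoothed_region D d) C}"


section \<open>The weighted graph of a special diagram\<close>

text \<open>The darts in \<open>ccw\<close> are those at vertices whose inherited rotation direction is
  counterclockwise.\<close>

record weighted_map = plane_map +
  ccw :: "nat set"
  weight :: "nat set \<Rightarrow> nat"

text \<open>The graph with a vertex in each black region and an edge through each crossing. Its darts are
  the black corners: an edge joins the opposite black corners of a crossing, and the darts at a
  vertex are in the cyclic order of the corners around the black region. The Seifert circle
  around a black region runs counterclockwise iff it has the region on its left, i.e.\ iff the
  darts along the region are outgoing.\<close>

definition black_graph :: "link_diagram \<Rightarrow> weighted_map" where
  "black_graph D =
     \<lparr> darts = black_corners D,
       opp = perm_restrict (\<lambda>d. rot D (rot D d)) (black_corners D),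
       rot = perm_restrict (face_perm D) (black_corners D),
       ccw = outgoing D \<inter> black_corners D,
       weight = (\<lambda>_. 1) \<rparr>"

text \<open>The first point of \<open>A\<close> that is met when \<open>f\<close> is iterated (at least once) on \<open>d\<close>.\<close>

definition first_return :: "(nat \<Rightarrow> nat) \<Rightarrow> nat set \<Rightarrow> nat \<Rightarrow> nat" where
  "first_return f A d = (f ^^ (LEAST k. 0 < k \<and> (f ^^ k) d \<in> A)) d"

definition delete_edge :: "weighted_map \<Rightarrow> nat set \<Rightarrow> weighted_map" where
  "delete_edge G e =
     G\<lparr> darts := darts G - e,
        opp := perm_restrict (opp G) (darts G - e),
        rot := perm_restrict (first_return (rot G) (darts G - e)) (darts G - e),
        ccw := ccw G - e \<rparr>"

text \<open>\<open>bigon G d\<close>: the region to the left of \<open>d\<close> is a bigon, with the edges of \<open>d\<close> and \<open>face_perm G d\<close>.\<close>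

definition bigon :: "weighted_map \<Rightarrow> nat \<Rightarrow> bool" where
  "bigon G d \<longleftrightarrow>
     face_perm G (face_perm G d) = d \<and> dart_edge G (face_perm G d) \<noteq> dart_edge G d"

definition bigon_deletion :: "weighted_map \<Rightarrow> weighted_map \<Rightarrow> bool" where
  "bigon_deletion G G' \<longleftrightarrow>
     (\<exists>d\<in>darts G. bigon G d \<and>
        (let e = dart_edge G d; e' = dart_edge G (face_perm G d) in
         G' = (delete_edge G e)\<lparr> weight := (weight G)(e' := weight G e' + weight G e) \<rparr>))"

text \<open>A new edge with darts \<open>p\<close>, \<open>q\<close> and weight 0, from the corner \<open>a\<close> to the corner \<open>b\<close>.\<close>

definition insert_edge :: "weighted_map \<Rightarrow> nat \<Rightarrow> nat \<Rightarrow> nat \<Rightarrow> nat \<Rightarrow> weighted_map" where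
  "insert_edge G p q a b =
     \<lparr> darts = darts G \<union> {p, q},
       opp = (opp G)(p := q, q := p),
       rot = (rot G)(a := p, p := rot G a, b := q, q := rot G b),
       ccw = ccw G \<union> {x. x = p \<and> a \<in> ccw G \<or> x = q \<and> b \<in> ccw G},
       weight = (weight G)({p, q} := 0) \<rparr>"

text \<open>The arc lies in one region, so it joins two corners \<open>a\<close>, \<open>b\<close> of that region; it forms a simple
  closed curve with the edge of \<open>d\<close> iff the two edges have the same two distinct endpoints.\<close>

definition arc_addition :: "weighted_map \<Rightarrow> weighted_map \<Rightarrow> bool" where
  "arc_addition G G' \<longleftrightarrow>
     (\<exists>d\<in>darts G. \<exists>a\<in>darts G. \<exists>b\<in>darts G. \<exists>p q.
        p \<notin> darts G \<and> q \<notin> darts G \<and> p \<noteq> q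
        \<and> dart_vertex G d \<noteq> dart_vertex G (opp G d)
        \<and> a \<in> dart_vertex G d \<and> b \<in> dart_vertex G (opp G d) \<and> dart_face G a = dart_face G b
        \<and> G' = insert_edge G p q a b
        \<and> (\<forall>x\<in>darts G'. \<not> bigon G' x))"

text \<open>\<open>GF D G\<close>: the construction of the graph $G^F(D)$ from \<open>D\<close> can end with \<open>G\<close>.\<close>

definition GF :: "link_diagram \<Rightarrow> weighted_map \<Rightarrow> bool" where
  "GF D G \<longleftrightarrow>
     (\<exists>G1. bigon_deletion\<^sup>*\<^sup>* (black_graph D) G1 \<and> (\<nexists>G'. bigon_deletion G1 G')
         \<and> arc_addition\<^sup>*\<^sup>* G1 G \<and> (\<nexists>G'. arc_addition G G'))"


section \<open>Theta-graphs\<close>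

definition joining_edges :: "weighted_map \<Rightarrow> nat set \<Rightarrow> nat set \<Rightarrow> nat set set" where
  "joining_edges G u v =
     dart_edge G ` {d \<in> darts G. dart_vertex G d = u \<and> dart_vertex G (opp G d) = v}"

text \<open>A theta-graph is identified with its set of edges.\<close>

definition theta_graphs :: "weighted_map \<Rightarrow> nat set set set" where
  "theta_graphs G =
     {joining_edges G u v | u v. u \<in> dart_vertex G ` darts G \<and> v \<in> dart_vertex G ` darts G
        \<and> u \<noteq> v \<and> card (joining_edges G u v) \<ge> 2}"

definition theta_edges :: "weighted_map \<Rightarrow> nat set set" where
  "theta_edges G = \<Union>(theta_graphs G)"

definition theta_weight :: "weighted_map \<Rightarrow> nat set set \<Rightarrow> nat" where
  "theta_weight G T = (\<Sum>e\<in>T. weight G e)"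

text \<open>A region of the complement of the theta-graphs, cut apart at common vertices, is represented
  by the set of corners of \<open>G\<close> it contains. Corners are joined within a region of \<open>G\<close>, across edges
  outside the theta-graphs, and through cut vertices: two corners at a vertex are joined there
  if every theta-graph at the vertex has them in the same sector, that is, if the next dart of
  the theta-graph in counterclockwise order is the same.\<close>

definition theta_adjacent :: "weighted_map \<Rightarrow> nat \<Rightarrow> nat \<Rightarrow> bool" where
  "theta_adjacent G d d' \<longleftrightarrow>
     d \<in> darts G
     \<and> (d' = face_perm G d
        \<or> dart_edge G d \<notin> theta_edges G \<and> d' = opp G d
        \<or> d' \<in> dart_vertex G d
          \<and> (\<forall>T\<in>theta_graphs G. \<Union>T \<inter> dart_vertex G d \<noteq> {} \<longrightarrow>
               first_return (rot G) (\<Union>T) d = first_return (rot G) (\<Union>T) d'))"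

definition theta_regions :: "weighted_map \<Rightarrow> nat set set" where
  "theta_regions G = (\<lambda>d. {d' \<in> darts G. equivclp (theta_adjacent G) d d'}) ` darts G"

text \<open>The transverse orientation of an edge points in the direction of the rotation at its ends. So
  it crosses the dart \<open>d\<close> from right to left if the rotation at the vertex of \<open>d\<close> is
  counterclockwise, and from left to right otherwise; the left of \<open>d\<close> is the side of the corner \<open>d\<close>.\<close>

definition on_positive_side :: "weighted_map \<Rightarrow> nat set \<Rightarrow> nat set \<Rightarrow> bool" where
  "on_positive_side G r e \<longleftrightarrow> (\<exists>d\<in>e. d \<in> r \<and> d \<in> ccw G)"

definition on_negative_side :: "weighted_map \<Rightarrow> nat set \<Rightarrow> nat set \<Rightarrow> bool" where
  "on_negative_side G r e \<longleftrightarrow> (\<exists>d\<in>e. d \<in> r \<and> d \<notin> ccw G)"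

definition bd_plus :: "weighted_map \<Rightarrow> nat set \<Rightarrow> nat set set" where
  "bd_plus G r = {e \<in> theta_edges G. on_negative_side G r e \<and> \<not> on_positive_side G r e}"

definition bd_minus :: "weighted_map \<Rightarrow> nat set \<Rightarrow> nat set set" where
  "bd_minus G r = {e \<in> theta_edges G. on_positive_side G r e \<and> \<not> on_negative_side G r e}"


section \<open>The complex K(D)\<close>

text \<open>A (finite) simplicial complex is given by the vertex sets of its nonempty simplices.\<close>

definition simplicial_iso :: "'a set set \<Rightarrow> 'b set set \<Rightarrow> bool" where
  "simplicial_iso K K' \<longleftrightarrow> (\<exists>f. bij_betw f (\<Union>K) (\<Union>K') \<and> (\<lambda>\<sigma>. f ` \<sigma>) ` K = K')"

definition K_vertices :: "weighted_map \<Rightarrow> (nat set \<Rightarrow> int) set" where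
  "K_vertices G =
     {w \<in> theta_edges G \<rightarrow>\<^sub>E {0..}. \<forall>T\<in>theta_graphs G. (\<Sum>e\<in>T. w e) = int (theta_weight G T)}"

definition region_move ::
    "weighted_map \<Rightarrow> nat set \<Rightarrow> (nat set \<Rightarrow> int) \<Rightarrow> (nat set \<Rightarrow> int) option" where
  "region_move G r w =
     (if \<forall>e\<in>bd_minus G r. w e > 0
      then Some (\<lambda>e. if e \<in> bd_plus G r then w e + 1
                     else if e \<in> bd_minus G r then w e - 1 else w e)
      else None)"

fun region_moves ::
    "weighted_map \<Rightarrow> nat set list \<Rightarrow> (nat set \<Rightarrow> int) \<Rightarrow> (nat set \<Rightarrow> int) option" where
  "region_moves G [] w = Some w"
| "region_moves G (r # rs) w = Option.bind (region_move G r w) (region_moves G rs)"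

definition K_span :: "weighted_map \<Rightarrow> (nat set \<Rightarrow> int) set \<Rightarrow> bool" where
  "K_span G U \<longleftrightarrow>
     (\<exists>u0\<in>U. \<exists>rs. distinct rs \<and> set rs = theta_regions G
        \<and> (\<forall>j\<in>{1..length rs}. region_moves G (take j rs) u0 \<noteq> None)
        \<and> (\<forall>u\<in>U. \<exists>j\<in>{1..length rs}. region_moves G (take j rs) u0 = Some u))"

definition K_complex :: "weighted_map \<Rightarrow> (nat set \<Rightarrow> int) set set" where
  "K_complex G =
     {{u} | u. u \<in> K_vertices G} \<union> {U. U \<noteq> {} \<and> U \<subseteq> K_vertices G \<and> K_span G U}"


section \<open>Edgewise subdivision\<close>

definition colour_scheme :: "nat \<Rightarrow> nat \<Rightarrow> nat \<Rightarrow> (nat \<Rightarrow> nat \<Rightarrow> nat) \<Rightarrow> bool" where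
  "colour_scheme m n l x \<longleftrightarrow>
     l \<le> n
     \<and> (\<forall>i\<in>{1..m}. \<forall>j\<in>{0..l}. x i j \<in> {0..n})
     \<and> (\<forall>j\<in>{0..l}. \<forall>j'\<in>{0..l}. j \<noteq> j' \<longrightarrow> (\<exists>i\<in>{1..m}. x i j \<noteq> x i j'))
     \<and> (\<forall>i\<in>{1..m}. \<forall>i'\<in>{1..m}. \<forall>j\<in>{0..l}. \<forall>j'\<in>{0..l}.
          i < i' \<or> i = i' \<and> j \<le> j' \<longrightarrow> x i j \<le> x i' j')"

definition column_point ::
    "nat \<Rightarrow> (nat \<Rightarrow> 'v::real_vector) \<Rightarrow> (nat \<Rightarrow> nat \<Rightarrow> nat) \<Rightarrow> nat \<Rightarrow> 'v" where
  "column_point m v x k = (1 / real m) *\<^sub>R (\<Sum>i=1..m. v (x i k))"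

definition Esd :: "nat \<Rightarrow> nat \<Rightarrow> (nat \<Rightarrow> 'v::real_vector) \<Rightarrow> 'v set set" where
  "Esd m n v = {column_point m v x ` {0..l} | l x. colour_scheme m n l x}"

definition simplex_vertices :: "nat \<Rightarrow> (nat \<Rightarrow> 'v::real_vector) \<Rightarrow> bool" where
  "simplex_vertices n v \<longleftrightarrow> inj_on v {0..n} \<and> \<not> affine_dependent (v ` {0..n})"

end

theory Submission
  imports Defs
begin

text \<open>Planarity enters only in the form that every cycle modulo 2 in the 1-skeleton separates the
  regions into two colours. Euler's formula gives this for the diagram by counting chains modulo 2;
  it passes to the black graph and survives deletion and insertion of edges. For a Seifert circle it
  shows that the black graph is bipartite with respect to the rotation directions. For
  two edges of the theta-graph it shows that the regions are exactly the sectors between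
  cyclically consecutive edges, so with the edges numbered cyclically each partial map moves one
  unit of weight from an edge to the next one.

  In terms of the tail sums \<open>s\<^sub>k = w\<^sub>k + \<dots> + w\<^sub>n\<close>, \<open>1 \<le> k \<le> n\<close>, all moves but one increase a single
  \<open>s\<^sub>k\<close> by 1 and the last one decreases all of them. Hence simplices are the sets of tail sums in which
  any two differ by a vector with entries in \<open>{0, 1}\<close>, up to sign. Reading \<open>s\<^sub>k\<close> as the number of
  entries \<open>\<ge> k\<close> of a column turns this condition into that of a colour scheme.\<close>

section \<open>Permutations and parity\<close>

text \<open>Carrying Euler's formula itself through the construction would mean recounting vertices,
  edges and regions after every change of the graph. Statements about cycles travel more easily:
  after a deletion, a cycle of the smaller map is a cycle of the larger one and the colouring
  restricts; after an insertion, a cycle can be rerouted off the new edge. Colourings are also what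
  the regions call for. Regions are classes of an equivalence closure, so a chain of adjacencies
  shows that two corners lie together, but only an invariant shows that they do not. Connectedness
  is used in the same style, through invariant functions, and shows that there are no regions
  besides the sectors. Bipartiteness makes the positive sides of all edges at one end of the
  theta-graph point the same way around it; this is why a region takes weight from one of its two
  edges and gives it to the other. For the complex, the difficulty is that a simplex needs an
  ordering of all regions: a chain of tail sums has to be completed to a closed walk that uses every
  region exactly once and never makes a weight negative.\<close>

lemma orbit_self:
  assumes "f permutes X" "finite X"
  shows "x \<in> orbit f x"
  by (rule permutation_self_in_orbit) (use assms in \<open>auto simp: permutation_permutes\<close>)

lemma orbit_eq:
  assumes "f permutes X" "finite X" "y \<in> orbit f x"
  shows "orbit f y = orbit f x"
  using orbit_cyclic_eq3[OF cyclic_on_orbit[OF assms(1,2)] assms(3)] .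

lemma orbit_step_iff:
  assumes "f permutes X" "finite X"
  shows "f y \<in> orbit f x \<longleftrightarrow> y \<in> orbit f x"
  using cyclic_on_f_in[OF assms(1) cyclic_on_orbit[OF assms]] by (auto intro: orbit.step)

lemma bij_betw_orbit:
  assumes "f permutes X" "finite X"
  shows "bij_betw f (orbit f x) (orbit f x)"
proof -
  have inj: "inj_on f (orbit f x)"
    using assms(1) permutes_inj inj_on_subset by blast
  have "f ` orbit f x \<subseteq> orbit f x"
    by (auto intro: orbit.step)
  moreover have "y \<in> f ` orbit f x" if "y \<in> orbit f x" for y
    using that assms orbit_step_iff[OF assms, of "inv f y" x] permutes_inverses(1)[OF assms(1)]
    by (metis image_eqI)
  ultimately show ?thesis using inj by (auto simp: bij_betw_def)
qed

lemma card_orbit_shift: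
  assumes "f permutes X" "finite X"
  shows "card {y \<in> orbit f x. P (f y)} = card {y \<in> orbit f x. P y}"
proof (rule bij_betw_same_card[of f])
  show "bij_betw f {y \<in> orbit f x. P (f y)} {y \<in> orbit f x. P y}"
    using bij_betw_orbit[OF assms, of x] orbit_step_iff[OF assms]
    unfolding bij_betw_def by (auto simp: inj_on_def image_iff)
qed

lemma even_card_xor:
  assumes "finite A"
  shows "even (card {x \<in> A. P x \<noteq> Q x}) \<longleftrightarrow> (even (card {x \<in> A. P x}) \<longleftrightarrow> even (card {x \<in> A. Q x}))"
  using assms
proof (induction A)
  case (insert a A)
  have *: "{x \<in> insert a A. R x} = (if R a then insert a {x \<in> A. R x} else {x \<in> A. R x})" for R
    by auto
  have "card {x \<in> insert a A. R x} = (if R a then Suc (card {x \<in> A. R x}) else card {x \<in> A. R x})" for R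
    unfolding * using insert.hyps by simp
  then show ?case using insert.IH by auto
qed simp

text \<open>Sets serve as vectors over the field with two elements, with \<open>sym_diff\<close> as
  addition. For \<open>opp\<close> the invariant sets are the 1-chains of a map, for
  \<open>face_perm\<close> its 2-chains.\<close>

definition invariant_sets :: "('a \<Rightarrow> 'a) \<Rightarrow> 'a set \<Rightarrow> 'a set set" where
  "invariant_sets f X = {A. A \<subseteq> X \<and> (\<forall>x\<in>X. f x \<in> A \<longleftrightarrow> x \<in> A)}"

lemma invariant_setsD: "A \<in> invariant_sets f X \<Longrightarrow> x \<in> X \<Longrightarrow> f x \<in> A \<longleftrightarrow> x \<in> A"
  by (auto simp: invariant_sets_def)

text \<open>An invariant set is the disjoint union of the orbits that it meets, and the choice of
  these orbits is free.\<close>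

lemma card_invariant_sets:
  assumes f: "f permutes X" "finite X"
  shows "card (invariant_sets f X) = 2 ^ card (orbit f ` X)"
proof -
  have sub: "orbit f x \<subseteq> A" if "A \<in> invariant_sets f X" "x \<in> A" for A x
  proof
    fix y assume "y \<in> orbit f x"
    then show "y \<in> A"
      by induction (use that in \<open>auto simp: invariant_sets_def\<close>)
  qed
  have "bij_betw Union (Pow (orbit f ` X)) (invariant_sets f X)"
  proof (rule bij_betw_byWitness[where f' = "\<lambda>A. orbit f ` A"])
    show "\<forall>B\<in>Pow (orbit f ` X). orbit f ` \<Union>B = B"
    proof (intro ballI set_eqI iffI)
      fix B y assume B: "B \<in> Pow (orbit f ` X)" and "y \<in> orbit f ` \<Union>B"
      then obtain b x where bx: "b \<in> B" "x \<in> b" "y = orbit f x" by auto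
      then obtain z where "b = orbit f z" using B by auto
      then show "y \<in> B" using bx orbit_eq[OF f, of x z] by simp
    next
      fix B y assume "B \<in> Pow (orbit f ` X)" "y \<in> B"
      then show "y \<in> orbit f ` \<Union>B" using orbit_self[OF f] by blast
    qed
    show "\<forall>A\<in>invariant_sets f X. \<Union>(orbit f ` A) = A"
      using sub orbit_self[OF f] by blast
    show "Union ` Pow (orbit f ` X) \<subseteq> invariant_sets f X"
    proof
      fix A assume "A \<in> Union ` Pow (orbit f ` X)"
      then obtain B where B: "B \<subseteq> X" "A = (\<Union>b\<in>B. orbit f b)"
        by (auto simp: subset_image_iff)
      then show "A \<in> invariant_sets f X"
        using permutes_orbit_subset[OF f(1)] orbit_step_iff[OF f]
        unfolding invariant_sets_def by blast
    qed
    show "(\<lambda>A. orbit f ` A) ` invariant_sets f X \<subseteq> Pow (orbit f ` X)"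
      by (auto simp: invariant_sets_def)
  qed
  then show ?thesis
    using f by (metis bij_betw_same_card card_Pow finite_imageI)
qed

text \<open>Rank and nullity over the field with two elements, in terms of cardinalities: adding a
  fixed element of a fibre maps that fibre bijectively onto the kernel.\<close>

lemma card_eq_kernel_times_image:
  fixes h :: "'a set \<Rightarrow> 'b set"
  assumes fin: "finite \<A>"
    and closed: "\<And>A B. A \<in> \<A> \<Longrightarrow> B \<in> \<A> \<Longrightarrow> sym_diff A B \<in> \<A>"
    and hom: "\<And>A B. A \<in> \<A> \<Longrightarrow> B \<in> \<A> \<Longrightarrow> h (sym_diff A B) = sym_diff (h A) (h B)"
  shows "card \<A> = card {A \<in> \<A>. h A = {}} * card (h ` \<A>)"
proof -
  have fibre: "card {A \<in> \<A>. h A = y} = card {A \<in> \<A>. h A = {}}" if y: "y \<in> h ` \<A>" for y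
  proof -
    from y obtain C where C: "y = h C" "C \<in> \<A>" by (rule imageE)
    have "bij_betw (sym_diff C) {A \<in> \<A>. h A = y} {A \<in> \<A>. h A = {}}"
    proof (rule bij_betw_byWitness[where f' = "sym_diff C"])
      show "sym_diff C ` {A \<in> \<A>. h A = y} \<subseteq> {A \<in> \<A>. h A = {}}"
        using C closed[OF C(2)] hom[OF C(2)] by (intro image_subsetI CollectI) simp
      show "sym_diff C ` {A \<in> \<A>. h A = {}} \<subseteq> {A \<in> \<A>. h A = y}"
        using C closed[OF C(2)] hom[OF C(2)] by (intro image_subsetI CollectI) simp
    qed blast+
    then show ?thesis by (rule bij_betw_same_card)
  qed
  have "card \<A> = (\<Sum>y\<in>h ` \<A>. card {A \<in> \<A>. h A = y})"
    using sum.image_gen[OF fin, of "\<lambda>_. 1::nat" h] by simp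
  also have "\<dots> = card {A \<in> \<A>. h A = {}} * card (h ` \<A>)"
    using fibre by simp
  finally show ?thesis .
qed

section \<open>Planarity as vanishing of the first homology modulo 2\<close>

text \<open>Connectedness and planarity are left out on purpose. They are carried along separately
  as \<open>linked\<close> and \<open>planar\<close>, because each survives a change of the map for
  its own reason.\<close>

locale dart_map =
  fixes M :: "'a plane_map_scheme"
  assumes finite_darts [simp]: "finite (darts M)"
    and opp_permutes: "opp M permutes darts M"
    and opp_neq: "d \<in> darts M \<Longrightarrow> opp M d \<noteq> d"
    and opp_opp_dart: "d \<in> darts M \<Longrightarrow> opp M (opp M d) = d"
    and rot_permutes: "rot M permutes darts M"
begin

lemma opp_opp [simp]: "opp M (opp M d) = d"
  by (metis opp_opp_dart opp_permutes permutes_not_in)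

lemma opp_in_darts [simp]: "opp M d \<in> darts M \<longleftrightarrow> d \<in> darts M"
  using opp_permutes by (simp add: permutes_in_image)

lemma rot_in_darts [simp]: "rot M d \<in> darts M \<longleftrightarrow> d \<in> darts M"
  using rot_permutes by (simp add: permutes_in_image)

lemma face_permutes: "face_perm M permutes darts M"
proof -
  have "face_perm M = inv (rot M) \<circ> opp M" by (auto simp: face_perm_def)
  then show ?thesis
    using permutes_compose[OF opp_permutes permutes_inv[OF rot_permutes]] by simp
qed

lemma face_in_darts [simp]: "face_perm M d \<in> darts M \<longleftrightarrow> d \<in> darts M"
  by (rule permutes_in_image[OF face_permutes])

lemma rot_face [simp]: "rot M (face_perm M d) = opp M d"
  using permutes_inverses(1)[OF rot_permutes] by (simp add: face_perm_def)

lemma face_opp_rot [simp]: "face_perm M (opp M (rot M d)) = d"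
  using permutes_inverses(2)[OF rot_permutes] by (simp add: face_perm_def)

lemma rot_inj [simp]: "rot M d = rot M d' \<longleftrightarrow> d = d'"
  using permutes_inj[OF rot_permutes] by (auto dest: injD)

lemma opp_inj [simp]: "opp M d = opp M d' \<longleftrightarrow> d = d'"
  by (metis opp_opp)

lemmas rot_orbit_self [simp] = orbit_self[OF rot_permutes finite_darts]
lemmas rot_orbit_eq = orbit_eq[OF rot_permutes finite_darts]
lemmas rot_orbit_step [simp] = orbit_step_iff[OF rot_permutes finite_darts]

lemma mem_rot_orbit_iff: "d \<in> orbit (rot M) e \<longleftrightarrow> orbit (rot M) e = orbit (rot M) d"
proof
  show "orbit (rot M) e = orbit (rot M) d" if "d \<in> orbit (rot M) e"
    using rot_orbit_eq[OF that] by simp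
  show "d \<in> orbit (rot M) e" if "orbit (rot M) e = orbit (rot M) d"
    using that by simp
qed

lemma rot_orbit_subset: "d \<in> darts M \<Longrightarrow> orbit (rot M) d \<subseteq> darts M"
  by (rule permutes_orbit_subset[OF rot_permutes])

lemma finite_rot_orbit [simp]: "finite (orbit (rot M) d)"
  by (rule finite_orbit) simp

lemma orbit_rot_step [simp]: "orbit (rot M) (rot M d) = orbit (rot M) d"
  by (rule rot_orbit_eq) simp

lemma orbit_opp: "orbit (opp M) d = {d, opp M d}"
proof
  show "orbit (opp M) d \<subseteq> {d, opp M d}"
  proof
    fix x assume "x \<in> orbit (opp M) d"
    then show "x \<in> {d, opp M d}" by induction auto
  qed
  show "{d, opp M d} \<subseteq> orbit (opp M) d"
    using orbit.base[of "opp M" d] orbit.step[OF orbit.base, of "opp M" d] by auto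
qed

end

text \<open>These are the 1-cycles modulo 2. An edge is recorded by both of its darts, so a loop
  counts twice at its vertex.\<close>

definition even_cycle :: "'a plane_map_scheme \<Rightarrow> nat set \<Rightarrow> bool" where
  "even_cycle M S \<longleftrightarrow>
     S \<subseteq> darts M \<and> (\<forall>d\<in>darts M. opp M d \<in> S \<longleftrightarrow> d \<in> S)
     \<and> (\<forall>d\<in>darts M. even (card (S \<inter> orbit (rot M) d)))"

definition separates :: "'a plane_map_scheme \<Rightarrow> nat set \<Rightarrow> (nat \<Rightarrow> bool) \<Rightarrow> bool" where
  "separates M S \<phi> \<longleftrightarrow>
     (\<forall>d\<in>darts M. (\<phi> (opp M d) \<noteq> \<phi> d \<longleftrightarrow> d \<in> S) \<and> (\<phi> (rot M d) \<noteq> \<phi> d \<longleftrightarrow> rot M d \<in> S))"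

text \<open>The corner \<open>d\<close> lies between the darts \<open>d\<close> and \<open>rot M d\<close>, so a function constant on regions
  may change between \<open>d\<close> and \<open>rot M d\<close> only by crossing the dart \<open>rot M d\<close>.\<close>

definition planar :: "'a plane_map_scheme \<Rightarrow> bool" where
  "planar M \<longleftrightarrow> (\<forall>S. even_cycle M S \<longrightarrow> (\<exists>\<phi>. separates M S \<phi>))"

text \<open>Connectedness in dual form. An invariant function is easy to extend or restrict when the
  darts change, whereas paths would have to be rerouted.\<close>

definition linked :: "'a plane_map_scheme \<Rightarrow> bool" where
  "linked M \<longleftrightarrow>
     (\<forall>f :: nat \<Rightarrow> bool. (\<forall>d\<in>darts M. f (opp M d) = f d \<and> f (rot M d) = f d) \<longrightarrow>
        (\<forall>d\<in>darts M. \<forall>d'\<in>darts M. f d = f d'))"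

lemma linkedD:
  assumes "linked M" "\<And>d. d \<in> darts M \<Longrightarrow> f (opp M d) = f d \<and> f (rot M d) = f d"
    "d \<in> darts M" "d' \<in> darts M"
  shows "f d = (f d' :: bool)"
  using assms unfolding linked_def by blast

text \<open>The corners \<open>d\<close> and \<open>face_perm M d\<close> are both compared with
  \<open>opp M d\<close>: one comparison crosses the edge, the other turns past the dart
  \<open>opp M d\<close>, and both change the colour under the same condition.\<close>

lemma (in dart_map) separates_face:
  assumes "separates M S \<phi>" "d \<in> darts M"
  shows "\<phi> (face_perm M d) = \<phi> d"
proof -
  have "face_perm M d \<in> darts M" using assms by simp
  then have "\<phi> (opp M d) \<noteq> \<phi> (face_perm M d) \<longleftrightarrow> opp M d \<in> S"
    using assms(1) unfolding separates_def by (metis rot_face)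
  moreover have "\<phi> (opp M d) \<noteq> \<phi> d \<longleftrightarrow> opp M d \<in> S"
    using assms opp_in_darts[of d] unfolding separates_def by (metis opp_opp)
  ultimately show ?thesis by blast
qed

text \<open>Turning by \<open>rot\<close> only permutes the darts of a vertex, so
  \<open>X (opp M x)\<close> and \<open>X (opp M (rot M x))\<close> hold equally often. The
  right-hand side compares consecutive corners of a region, since \<open>face_perm\<close> takes
  \<open>opp M (rot M x)\<close> to \<open>x\<close>; it vanishes when \<open>X\<close> is constant
  on regions.\<close>

lemma (in dart_map) face_boundary_parity:
  assumes "d \<in> darts M"
  shows "even (card {x \<in> orbit (rot M) d. X (opp M x) \<noteq> (X x :: bool)})
     \<longleftrightarrow> even (card {x \<in> orbit (rot M) d. X (opp M (rot M x)) \<noteq> X x})"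
  using card_orbit_shift[OF rot_permutes finite_darts, of d "\<lambda>x. X (opp M x)"]
    even_card_xor[OF finite_rot_orbit, of d "\<lambda>x. X (opp M x)" X]
    even_card_xor[OF finite_rot_orbit, of d "\<lambda>x. X (opp M (rot M x))" X] by simp

lemma (in dart_map) invariant_opp_rot:
  assumes "X \<in> invariant_sets (face_perm M) (darts M)" "d \<in> darts M"
  shows "opp M (rot M d) \<in> X \<longleftrightarrow> d \<in> X"
  using invariant_setsD[OF assms(1), of "opp M (rot M d)"] assms(2) by simp

lemma (in dart_map) even_cycle_face_boundary:
  assumes "X \<in> invariant_sets (face_perm M) (darts M)"
  shows "even_cycle M {d \<in> darts M. (opp M d \<in> X) \<noteq> (d \<in> X)}"
proof -
  have "even (card ({d \<in> darts M. (opp M d \<in> X) \<noteq> (d \<in> X)} \<inter> orbit (rot M) d))"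
    if d: "d \<in> darts M" for d
  proof -
    have "{d \<in> darts M. (opp M d \<in> X) \<noteq> (d \<in> X)} \<inter> orbit (rot M) d
        = {x \<in> orbit (rot M) d. (opp M x \<in> X) \<noteq> (x \<in> X)}"
      using rot_orbit_subset[OF d] by auto
    moreover have "(opp M (rot M x) \<in> X) = (x \<in> X)" if "x \<in> orbit (rot M) d" for x
      using that rot_orbit_subset[OF d] by (intro invariant_opp_rot[OF assms]) auto
    then have "{x \<in> orbit (rot M) d. (opp M (rot M x) \<in> X) \<noteq> (x \<in> X)} = {}" by auto
    ultimately show ?thesis
      using face_boundary_parity[OF d, of "\<lambda>x. x \<in> X"] by (simp only: card.empty) simp
  qed
  then show ?thesis unfolding even_cycle_def by auto
qed

lemma (in dart_map) separates_face_boundary: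
  assumes "X \<in> invariant_sets (face_perm M) (darts M)"
  shows "separates M {d \<in> darts M. (opp M d \<in> X) \<noteq> (d \<in> X)} (\<lambda>d. d \<in> X)"
proof -
  have "(opp M (rot M x) \<in> X) = (x \<in> X)" if "x \<in> darts M" for x
    using that by (rule invariant_opp_rot[OF assms])
  then show ?thesis unfolding separates_def by auto
qed

lemma finite_invariant_sets [simp]: "finite X \<Longrightarrow> finite (invariant_sets f X)"
  by (rule finite_subset[of _ "Pow X"]) (auto simp: invariant_sets_def)

text \<open>A set of regions with empty boundary is invariant under \<open>opp\<close> and
  \<open>rot\<close>, hence empty or everything by connectedness. This kernel of at most two
  elements accounts for the factor 2.\<close>

lemma (in dart_map) card_face_boundaries:
  assumes "linked M"
  shows "2 ^ card (dart_face M ` darts M)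
    \<le> 2 * card ((\<lambda>X. {d \<in> darts M. (opp M d \<in> X) \<noteq> (d \<in> X)}) ` invariant_sets (face_perm M) (darts M))"
    (is "_ \<le> 2 * card (?h ` ?F)")
proof -
  have ker: "{X \<in> ?F. ?h X = {}} \<subseteq> {{}, darts M}"
  proof
    fix X assume X: "X \<in> {X \<in> ?F. ?h X = {}}"
    have "(opp M d \<in> X) = (d \<in> X) \<and> (rot M d \<in> X) = (d \<in> X)" if d: "d \<in> darts M" for d
    proof -
      have "?h X = {}" using X by simp
      then have opp: "(opp M x \<in> X) = (x \<in> X)" if "x \<in> darts M" for x
        using that by blast
      moreover have "opp M (rot M d) \<in> X \<longleftrightarrow> d \<in> X"
        using X d by (intro invariant_opp_rot) auto
      ultimately show ?thesis using d by simp
    qed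
    from linkedD[OF assms this] have "\<forall>d\<in>darts M. \<forall>d'\<in>darts M. (d \<in> X) = (d' \<in> X)"
      by blast
    moreover have "X \<subseteq> darts M" using X by (auto simp: invariant_sets_def)
    ultimately show "X \<in> {{}, darts M}" by blast
  qed
  have "2 ^ card (dart_face M ` darts M) = card ?F"
    using card_invariant_sets[OF face_permutes finite_darts] by (simp add: dart_face_def)
  also have "\<dots> = card {X \<in> ?F. ?h X = {}} * card (?h ` ?F)"
    by (rule card_eq_kernel_times_image) (auto simp: invariant_sets_def)
  also have "\<dots> \<le> 2 * card (?h ` ?F)"
    using card_mono[OF _ ker] by (intro mult_right_mono) (auto simp: card_insert_if split: if_splits)
  finally show ?thesis .
qed

lemma odd_card_sym_diff:
  assumes "finite C"
  shows "odd (card (sym_diff A B \<inter> C)) \<longleftrightarrow> odd (card (A \<inter> C)) \<noteq> odd (card (B \<inter> C))"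
proof -
  have "sym_diff A B \<inter> C = {x \<in> C. (x \<in> A) \<noteq> (x \<in> B)}" "A \<inter> C = {x \<in> C. x \<in> A}"
    "B \<inter> C = {x \<in> C. x \<in> B}" by auto
  then show ?thesis using even_card_xor[OF assms, of "\<lambda>x. x \<in> A" "\<lambda>x. x \<in> B"] by simp
qed

text \<open>Let \<open>V\<close>, \<open>E\<close>, \<open>F\<close> count vertices, edges and
  regions. Connectedness gives at least \<open>2^(V-1)\<close> boundaries of edge sets and at least
  \<open>2^(F-1)\<close> boundaries of region sets. Hence there are at most \<open>2^(E-V+1)\<close>
  cycles, which is \<open>2^(F-1)\<close> by Euler's formula. As boundaries of region sets are
  cycles, all cycles arise in this way.\<close>

theorem planar_connected_sphere_map:
  assumes "connected_sphere_map M"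
  shows "dart_map M" "linked M" "planar M"
proof -
  show dm: "dart_map M"
    using assms unfolding connected_sphere_map_def by unfold_locales auto
  interpret dart_map M by fact
  have path: "(\<lambda>x y. y = opp M x \<or> y = rot M x)\<^sup>*\<^sup>* d d'" if "d \<in> darts M" "d' \<in> darts M" for d d'
    using assms that unfolding connected_sphere_map_def by blast
  show lk: "linked M"
    unfolding linked_def
  proof (intro allI impI ballI)
    fix f :: "nat \<Rightarrow> bool" and d d'
    assume f: "\<forall>d\<in>darts M. f (opp M d) = f d \<and> f (rot M d) = f d"
      and d: "d \<in> darts M" "d' \<in> darts M"
    have "f d' = f d \<and> d' \<in> darts M"
      using path[OF d]
    proof (induction rule: rtranclp_induct)
      case base
      show ?case using d(1) by simp
    next
      case (step y z)
      have "y \<in> darts M" "f y = f d" using step.IH by auto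
      moreover from this have "f (opp M y) = f y" "f (rot M y) = f y" using f by blast+
      ultimately show ?case using step.hyps(2) by auto
    qed
    then show "f d = f d'" by simp
  qed
  let ?V = "dart_vertex M ` darts M"
  let ?E = "invariant_sets (opp M) (darts M)"
  let ?F = "invariant_sets (face_perm M) (darts M)"
  let ?h = "\<lambda>X. {d \<in> darts M. (opp M d \<in> X) \<noteq> (d \<in> X)}"
  define bd where "bd S = {x \<in> ?V. odd (card (S \<inter> x))}" for S
  have fin_V: "finite x" if "x \<in> ?V" for x using that by (auto simp: dart_vertex_def)
  have E_closed: "sym_diff A B \<in> ?E" if "A \<in> ?E" "B \<in> ?E" for A B
    using that by (auto simp: invariant_sets_def)
  have bd_hom: "bd (sym_diff A B) = sym_diff (bd A) (bd B)" for A B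
    using odd_card_sym_diff fin_V unfolding bd_def by blast
  have I_closed: "sym_diff A B \<in> bd ` ?E" if "A \<in> bd ` ?E" "B \<in> bd ` ?E" for A B
  proof -
    from that obtain A' B' where "A' \<in> ?E" "B' \<in> ?E" "A = bd A'" "B = bd B'"
      by (elim imageE) (rule that)
    then show ?thesis using imageI[OF E_closed, of A' B' bd] by (simp only: bd_hom)
  qed
  have "darts M \<noteq> {}"
    using assms unfolding connected_sphere_map_def by (elim conjE)
  then obtain d0 where d0: "d0 \<in> darts M" by auto
  let ?v0 = "dart_vertex M d0"
  \<comment> \<open>The edges of a path telescope, so any vertex together with the base vertex is a
    boundary. It follows that the image of \<open>bd\<close> has index at most 2 among all sets of
    vertices.\<close>
  have pair: "sym_diff {dart_vertex M d} {?v0} \<in> bd ` ?E" if "d \<in> darts M" for d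
  proof -
    have "d \<in> darts M \<and> sym_diff {dart_vertex M d} {?v0} \<in> bd ` ?E"
      using path[OF d0 that]
    proof induction
      case base
      have "{} \<in> ?E" "bd {} = {}" by (auto simp: invariant_sets_def bd_def)
      then show ?case using d0 imageI[of "{}" ?E bd] by simp
    next
      case (step y z)
      have y: "y \<in> darts M" using step.IH by (rule conjunct1)
      then have z: "z \<in> darts M" using step.hyps(2) by auto
      show ?case
      proof (cases "z = rot M y")
        case True
        then have "dart_vertex M z = dart_vertex M y" by (simp add: dart_vertex_def)
        then show ?thesis using step.IH z by simp
      next
        case False
        then have zy: "z = opp M y" using step.hyps(2) by simp
        have yz: "z \<noteq> y" using opp_neq y zy by auto
        have mem: "d \<in> x \<longleftrightarrow> x = dart_vertex M d" if "x \<in> ?V" for x d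
        proof -
          from that obtain e where x: "x = orbit (rot M) e" by (auto simp: dart_vertex_def)
          show ?thesis unfolding dart_vertex_def x by (rule mem_rot_orbit_iff)
        qed
        have "{y, z} \<in> ?E" using y z zy by (auto simp: invariant_sets_def)
        moreover have "bd {y, z} = sym_diff {dart_vertex M y} {dart_vertex M z}"
        proof (intro set_eqI)
          fix x
          have "card ({y, z} \<inter> x) = (if y \<in> x then 1 else 0) + (if z \<in> x then 1 else 0)"
            using yz by (simp add: Int_insert_left)
          then have "x \<in> bd {y, z} \<longleftrightarrow> x \<in> ?V \<and> (y \<in> x) \<noteq> (z \<in> x)"
            unfolding bd_def by simp
          also have "\<dots> \<longleftrightarrow> x \<in> ?V \<and> (x = dart_vertex M y) \<noteq> (x = dart_vertex M z)"
            by (rule conj_cong[OF refl]) (simp only: mem)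
          also have "\<dots> \<longleftrightarrow> x \<in> sym_diff {dart_vertex M y} {dart_vertex M z}"
            using imageI[OF y, of "dart_vertex M"] imageI[OF z, of "dart_vertex M"] by auto
          finally show "x \<in> bd {y, z} \<longleftrightarrow> x \<in> sym_diff {dart_vertex M y} {dart_vertex M z}" .
        qed
        ultimately have yz_bd: "sym_diff {dart_vertex M y} {dart_vertex M z} \<in> bd ` ?E"
          using imageI[of "{y, z}" ?E bd] by simp
        have eq: "sym_diff (sym_diff {dart_vertex M y} {dart_vertex M z})
           (sym_diff {dart_vertex M y} {?v0}) = sym_diff {dart_vertex M z} {?v0}" by auto
        from I_closed[OF yz_bd conjunct2[OF step.IH]] show ?thesis
          unfolding eq by (rule conjI[OF z])
      qed
    qed
    then show ?thesis by (rule conjunct2)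
  qed
  have all: "Y \<in> bd ` ?E \<or> sym_diff Y {?v0} \<in> bd ` ?E" if "Y \<subseteq> ?V" for Y
  proof -
    have "finite Y" using that finite_subset by fastforce
    then show ?thesis using that
    proof (induction Y)
      case empty
      have "{} \<in> ?E" "bd {} = {}" by (auto simp: invariant_sets_def bd_def)
      then show ?case using imageI[of "{}" ?E bd] by simp
    next
      case (insert x Y)
      have x: "sym_diff {x} {?v0} \<in> bd ` ?E" using insert.prems pair by auto
      have eq: "sym_diff Y (sym_diff {x} {?v0}) = sym_diff (insert x Y) {?v0}"
        "sym_diff (sym_diff Y {?v0}) (sym_diff {x} {?v0}) = insert x Y"
        using insert.hyps by auto
      have "Y \<in> bd ` ?E \<or> sym_diff Y {?v0} \<in> bd ` ?E"
        using insert.IH insert.prems by simp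
      then show ?case
      proof
        assume "Y \<in> bd ` ?E"
        from I_closed[OF this x] show ?thesis unfolding eq by (rule disjI2)
      next
        assume "sym_diff Y {?v0} \<in> bd ` ?E"
        from I_closed[OF this x] show ?thesis unfolding eq by (rule disjI1)
      qed
    qed
  qed
  have "Pow ?V \<subseteq> bd ` ?E \<union> (\<lambda>Y. sym_diff Y {?v0}) ` (bd ` ?E)"
  proof
    fix Y assume "Y \<in> Pow ?V"
    then have "Y \<in> bd ` ?E \<or> sym_diff Y {?v0} \<in> bd ` ?E" using all by auto
    moreover have "Y = sym_diff (sym_diff Y {?v0}) {?v0}" by auto
    ultimately show "Y \<in> bd ` ?E \<union> (\<lambda>Y. sym_diff Y {?v0}) ` (bd ` ?E)" by blast
  qed
  then have "card (Pow ?V) \<le> card (bd ` ?E \<union> (\<lambda>Y. sym_diff Y {?v0}) ` (bd ` ?E))"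
    by (intro card_mono) auto
  also have "\<dots> \<le> card (bd ` ?E) + card (bd ` ?E)"
    by (rule order_trans[OF card_Un_le]) (simp add: card_image_le)
  finally have V: "2 ^ card ?V \<le> 2 * card (bd ` ?E)" by (simp add: card_Pow)
  define Z where "Z = {S. even_cycle M S}"
  have Z: "Z = {S \<in> ?E. bd S = {}}"
    unfolding Z_def even_cycle_def bd_def invariant_sets_def by (auto simp: dart_vertex_def)
  have "dart_edge M ` darts M = orbit (opp M) ` darts M"
    by (auto simp: dart_edge_def orbit_opp)
  then have "2 ^ card (dart_edge M ` darts M) = card ?E"
    using card_invariant_sets[OF opp_permutes finite_darts] by simp
  also have "\<dots> = card Z * card (bd ` ?E)"
    unfolding Z by (rule card_eq_kernel_times_image) (use E_closed bd_hom in auto)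
  finally have E: "2 ^ card (dart_edge M ` darts M) = card Z * card (bd ` ?E)" .
  \<comment> \<open>The 4 collects the two factors of 2 due to connectedness, one for vertices and
    one for regions; it is matched by the 2 in Euler's formula.\<close>
  have "4 * (card Z * card (bd ` ?E)) = 2 ^ (card (dart_edge M ` darts M) + 2)"
    by (simp add: E power_add)
  also have "\<dots> = 2 ^ card ?V * 2 ^ card (dart_face M ` darts M)"
    using assms unfolding connected_sphere_map_def by (simp flip: power_add)
  also have "\<dots> \<le> (2 * card (bd ` ?E)) * (2 * card (?h ` ?F))"
    using V card_face_boundaries[OF lk] by (intro mult_mono) auto
  finally have "card (bd ` ?E) * card Z \<le> card (bd ` ?E) * card (?h ` ?F)" by simp
  moreover have "card (bd ` ?E) > 0" using V by (cases "card (bd ` ?E)") auto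
  ultimately have le: "card Z \<le> card (?h ` ?F)" by simp
  have "?h ` ?F \<subseteq> Z" using even_cycle_face_boundary unfolding Z_def by (intro image_subsetI CollectI)
  moreover have "finite Z" unfolding Z by simp
  ultimately have "?h ` ?F = Z" using le by (intro card_seteq)
  then have "\<exists>X\<in>?F. S = ?h X" if "even_cycle M S" for S
    using that unfolding Z_def by (metis (mono_tags, lifting) imageE mem_Collect_eq)
  then show "planar M"
    unfolding planar_def using separates_face_boundary by metis
qed

section \<open>Deleting and inserting edges\<close>

lemma first_returnE:
  assumes f: "f permutes X" "finite X" and y: "y \<in> A" "y \<in> orbit f x"
  obtains k where "0 < k" "first_return f A x = (f ^^ k) x" "(f ^^ k) x \<in> A"
    "\<forall>j. 0 < j \<longrightarrow> j < k \<longrightarrow> (f ^^ j) x \<notin> A"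
proof -
  let ?P = "\<lambda>k. 0 < k \<and> (f ^^ k) x \<in> A"
  obtain n where "0 < n" "y = (f ^^ n) x" using y(2) unfolding orbit_altdef by blast
  then have "?P n" using y(1) by simp
  then have "?P (LEAST k. ?P k)" by (rule LeastI)
  moreover have "(f ^^ j) x \<notin> A" if "0 < j" "j < (LEAST k. ?P k)" for j
    using not_less_Least[OF that(2)] that(1) by simp
  ultimately show ?thesis
    by (intro that[of "LEAST k. ?P k"]) (auto simp: first_return_def)
qed

lemma first_return_1: "f x \<in> A \<Longrightarrow> first_return f A x = f x"
proof -
  assume "f x \<in> A"
  then have "(LEAST k. 0 < k \<and> (f ^^ k) x \<in> A) = 1"
    by (intro Least_equality) auto
  then show ?thesis by (simp add: first_return_def)
qed

lemma first_return_2: "f x \<notin> A \<Longrightarrow> f (f x) \<in> A \<Longrightarrow> first_return f A x = f (f x)"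
proof -
  assume *: "f x \<notin> A" "f (f x) \<in> A"
  have "(LEAST k. 0 < k \<and> (f ^^ k) x \<in> A) = 2"
  proof (rule Least_equality)
    show "0 < (2::nat) \<and> (f ^^ 2) x \<in> A" using * by (simp add: numeral_2_eq_2)
    show "2 \<le> k" if "0 < k \<and> (f ^^ k) x \<in> A" for k
    proof (rule ccontr)
      assume "\<not> 2 \<le> k"
      then have "k = 1" using that by simp
      then show False using that * by simp
    qed
  qed
  then show ?thesis by (simp add: first_return_def numeral_2_eq_2)
qed

context
  fixes f :: "nat \<Rightarrow> nat" and X A :: "nat set"
  assumes f: "f permutes X" "finite X"
begin

lemma first_return_self:
  assumes "x \<in> A"
  obtains k where "0 < k" "first_return f A x = (f ^^ k) x" "(f ^^ k) x \<in> A"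
    "\<forall>j. 0 < j \<longrightarrow> j < k \<longrightarrow> (f ^^ j) x \<notin> A"
  by (rule first_returnE[OF f assms orbit_self[OF f]]) (rule that)

lemma inj_on_first_return: "inj_on (first_return f A) A"
proof -
  \<comment> \<open>Cancelling \<open>k\<close> applications of \<open>f\<close> leaves
    \<open>x\<close> as the iterate number \<open>l - k\<close> of \<open>y\<close>. Since
    \<open>x\<close> lies in \<open>A\<close> and \<open>l\<close> is the first return time of
    \<open>y\<close>, that number can only be 0.\<close>
  have "x = y" if "(f ^^ k) x = (f ^^ l) y" "k \<le> l" "x \<in> A" "0 < k"
    "\<forall>j. 0 < j \<longrightarrow> j < l \<longrightarrow> (f ^^ j) y \<notin> A" for x y k l
  proof -
    have "(f ^^ k) x = (f ^^ k) ((f ^^ (l - k)) y)"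
      using that(1,2) by (metis comp_apply funpow_add le_add_diff_inverse)
    then have "x = (f ^^ (l - k)) y"
      using permutes_inj[OF f(1)] by (metis inj_fn injD)
    moreover have "l - k = 0"
      using that(3,4) that(5)[rule_format, of "l - k"] \<open>x = _\<close> by fastforce
    ultimately show ?thesis by simp
  qed note * = this
  show ?thesis
  proof (rule inj_onI)
    fix x y assume "x \<in> A" "y \<in> A" and eq: "first_return f A x = first_return f A y"
    obtain k where k: "0 < k" "first_return f A x = (f ^^ k) x" "(f ^^ k) x \<in> A"
      "\<forall>j. 0 < j \<longrightarrow> j < k \<longrightarrow> (f ^^ j) x \<notin> A"
      by (rule first_return_self[OF \<open>x \<in> A\<close>])
    obtain l where l: "0 < l" "first_return f A y = (f ^^ l) y" "(f ^^ l) y \<in> A"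
      "\<forall>j. 0 < j \<longrightarrow> j < l \<longrightarrow> (f ^^ j) y \<notin> A"
      by (rule first_return_self[OF \<open>y \<in> A\<close>])
    have kl: "(f ^^ k) x = (f ^^ l) y" using eq k(2) l(2) by simp
    show "x = y"
    proof (cases "k \<le> l")
      case True
      show ?thesis by (rule *[OF kl True \<open>x \<in> A\<close> k(1) l(4)])
    next
      case False
      then have "l \<le> k" by simp
      from *[OF kl[symmetric] this \<open>y \<in> A\<close> l(1) k(4)] show ?thesis by simp
    qed
  qed
qed

lemma first_return_permutes:
  assumes "A \<subseteq> X"
  shows "perm_restrict (first_return f A) A permutes A"
proof (rule bij_imp_permutes)
  have "first_return f A x \<in> A" if "x \<in> A" for x
    by (rule first_return_self[OF that]) simp
  then have "first_return f A ` A \<subseteq> A" by blast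
  then have "first_return f A ` A = A"
    using inj_on_first_return finite_subset[OF assms f(2)] by (intro endo_inj_surj)
  then have "bij_betw (first_return f A) A A" using inj_on_first_return by (simp add: bij_betw_def)
  then show "bij_betw (perm_restrict (first_return f A) A) A A"
    by (rule bij_betw_cong[THEN iffD1, rotated]) (simp add: perm_restrict_def)
qed (simp add: perm_restrict_def)

text \<open>Skipping the points outside \<open>A\<close> neither splits nor merges cycles. For maps
  this means that removing darts leaves each vertex as it was, minus the removed darts.\<close>

lemma orbit_first_return:
  assumes "A \<subseteq> X" "x \<in> A"
  shows "orbit (perm_restrict (first_return f A) A) x = orbit f x \<inter> A"
    (is "orbit ?g x = _")
proof
  show "orbit ?g x \<subseteq> orbit f x \<inter> A"
  proof
    fix y assume "y \<in> orbit ?g x"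
    then show "y \<in> orbit f x \<inter> A"
    proof induction
      case base
      obtain k where "0 < k" "first_return f A x = (f ^^ k) x" "(f ^^ k) x \<in> A"
        "\<forall>j. 0 < j \<longrightarrow> j < k \<longrightarrow> (f ^^ j) x \<notin> A"
        by (rule first_return_self[OF assms(2)])
      then show ?case using assms(2) by (auto simp: perm_restrict_simps orbit_altdef)
    next
      case (step y)
      then have y: "y \<in> orbit f x" "y \<in> A" by auto
      obtain k where "0 < k" "first_return f A y = (f ^^ k) y" "(f ^^ k) y \<in> A"
        "\<forall>j. 0 < j \<longrightarrow> j < k \<longrightarrow> (f ^^ j) y \<notin> A"
        by (rule first_return_self[OF y(2)])
      then show ?case using y funpow_in_orbit[OF y(1)] by (simp add: perm_restrict_simps)
    qed
  qed
next
  have "(f ^^ n) x \<in> orbit ?g x" if "x \<in> A" "0 < n" "(f ^^ n) x \<in> A" for x n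
    using that
  proof (induction n arbitrary: x rule: less_induct)
    case (less n)
    obtain k where k: "0 < k" "first_return f A x = (f ^^ k) x" "(f ^^ k) x \<in> A"
      "\<forall>j. 0 < j \<longrightarrow> j < k \<longrightarrow> (f ^^ j) x \<notin> A"
      by (rule first_return_self[OF less.prems(1)])
    have g: "?g x = (f ^^ k) x" using less.prems(1) k(2) by (simp add: perm_restrict_simps)
    have "k \<le> n" using k(4)[rule_format, OF less.prems(2)] less.prems(3) by force
    show ?case
    proof (cases "k = n")
      case True
      then show ?thesis using g by (metis orbit.base)
    next
      case False
      have eq: "(f ^^ (n - k)) ((f ^^ k) x) = (f ^^ n) x"
        using \<open>k \<le> n\<close> by (metis comp_apply funpow_add le_add_diff_inverse2)
      have "(f ^^ (n - k)) ((f ^^ k) x) \<in> orbit ?g ((f ^^ k) x)"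
      proof (rule less.IH)
        show "n - k < n" "0 < n - k" using k(1) \<open>k \<le> n\<close> False by auto
      qed (use k(3) less.prems(3) eq in auto)
      then show ?thesis unfolding eq using orbit_subset[of _ ?g x] g by simp
    qed
  qed
  then show "orbit f x \<inter> A \<subseteq> orbit ?g x"
    using assms(2) unfolding orbit_altdef[of f x] by blast
qed

end

text \<open>\<open>I\<close> is the arc of the cycle from \<open>a\<close> up to, but not including,
  \<open>b\<close>; it is entered at \<open>a\<close> and left at \<open>b\<close> and nowhere else.
  It gives a two-valued function with two prescribed jumps, whether the cycle is a vertex or the
  boundary of a region.\<close>

lemma orbit_segment:
  assumes f: "f permutes X" and b: "b \<in> orbit f a" and ab: "a \<noteq> b"
  obtains I where "a \<in> I" "b \<notin> I" "\<forall>y. (f y \<in> I) \<noteq> (y \<in> I) \<longleftrightarrow> f y = a \<or> f y = b"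
proof -
  have inj: "f x = f y \<longleftrightarrow> x = y" for x y
    using permutes_inj[OF f] by (auto dest: injD)
  obtain n where "(f ^^ n) a = b" using b unfolding orbit_altdef by blast
  define k where "k = (LEAST n. (f ^^ n) a = b)"
  have k: "(f ^^ k) a = b" unfolding k_def by (rule LeastI) fact
  have min: "(f ^^ j) a \<noteq> b" if "j < k" for j
    using not_less_Least[of j "\<lambda>n. (f ^^ n) a = b"] that unfolding k_def by simp
  have "k \<noteq> 0" using k ab by (metis funpow_0)
  define I where "I = (\<lambda>i. (f ^^ i) a) ` {..<k}"
  have I_iff: "x \<in> I \<longleftrightarrow> (\<exists>i<k. x = (f ^^ i) a)" for x unfolding I_def by blast
  have aI: "a \<in> I" unfolding I_iff using \<open>k \<noteq> 0\<close> by (intro exI[of _ 0]) simp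
  have bI: "b \<notin> I" unfolding I_iff using min by metis
  have "(f y \<in> I) \<noteq> (y \<in> I) \<longleftrightarrow> f y = a \<or> f y = b" for y
  proof (cases "f y = a"; cases "f y = b")
    assume a: "f y = a" and "f y \<noteq> b"
    have "y \<notin> I"
    proof
      assume "y \<in> I"
      then obtain i where i: "i < k" "y = (f ^^ i) a" unfolding I_iff by blast
      have cyc: "(f ^^ Suc i) a = a" using a by (simp add: i(2))
      have "(f ^^ (k - Suc i)) a = (f ^^ (k - Suc i)) ((f ^^ Suc i) a)" unfolding cyc ..
      also have "\<dots> = (f ^^ k) a"
        using i(1) by (metis Suc_leI comp_apply funpow_add le_add_diff_inverse2)
      finally have "(f ^^ (k - Suc i)) a = b" using k by simp
      then show False using min[of "k - Suc i"] \<open>k \<noteq> 0\<close> by simp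
    qed
    then show ?thesis using a aI by simp
  next
    assume b: "f y = b" and "f y \<noteq> a"
    have "f y = f ((f ^^ (k - 1)) a)" using k \<open>k \<noteq> 0\<close> b by (cases k) simp_all
    then have "y = (f ^^ (k - 1)) a" by (simp add: inj)
    then have "y \<in> I" unfolding I_iff using \<open>k \<noteq> 0\<close> by (intro exI[of _ "k - 1"]) simp
    then show ?thesis using b bI by simp
  next
    assume ne: "f y \<noteq> a" "f y \<noteq> b"
    have "f y \<in> I" if mem: "y \<in> I"
    proof -
      obtain i where i: "i < k" "y = (f ^^ i) a" using mem unfolding I_iff by blast
      then have x: "f y = (f ^^ Suc i) a" by simp
      then have "Suc i \<noteq> k" using k ne(2) by metis
      then show ?thesis unfolding I_iff using x i(1) by (intro exI[of _ "Suc i"]) simp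
    qed
    moreover have "y \<in> I" if mem: "f y \<in> I"
    proof -
      obtain i where i: "i < k" "f y = (f ^^ i) a" using mem unfolding I_iff by blast
      have "i \<noteq> 0" using i(2) ne(1) by (metis funpow_0)
      then have "f y = f ((f ^^ (i - 1)) a)" using i(2) by (cases i) simp_all
      then have "y = (f ^^ (i - 1)) a" by (simp add: inj)
      then show ?thesis unfolding I_iff using i(1) by (intro exI[of _ "i - 1"]) simp
    qed
    ultimately show ?thesis using ne by blast
  qed (use ab in simp)
  then show ?thesis using aI bI by (intro that[of I]) simp_all
qed

text \<open>The invariant of the whole construction of the graph. Its last clause says that the
  rotation directions are constant at each vertex and opposite at the two ends of each edge, so that
  they form a bipartition.\<close>

definition spherical :: "weighted_map \<Rightarrow> bool" where
  "spherical G \<longleftrightarrow>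
     dart_map G \<and> linked G \<and> planar G \<and> ccw G \<subseteq> darts G
     \<and> (\<forall>d\<in>darts G. (opp G d \<in> ccw G \<longleftrightarrow> d \<notin> ccw G) \<and> (rot G d \<in> ccw G \<longleftrightarrow> d \<in> ccw G))"

section \<open>Deletion of an edge\<close>

locale edge_deletion = dart_map G for G :: weighted_map +
  fixes H :: weighted_map and e
  assumes e_sub: "e \<subseteq> darts G" and e_opp: "d \<in> darts G \<Longrightarrow> opp G d \<in> e \<longleftrightarrow> d \<in> e"
    and darts_H: "darts H = darts G - e"
    and opp_H: "opp H = perm_restrict (opp G) (darts G - e)"
    and rot_H: "rot H = perm_restrict (first_return (rot G) (darts G - e)) (darts G - e)"
begin

abbreviation "A \<equiv> darts G - e"

lemma opp_H_eq: "d \<in> A \<Longrightarrow> opp H d = opp G d"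
  by (simp add: opp_H perm_restrict_simps)

lemma rot_H_eq: "d \<in> A \<Longrightarrow> rot H d = first_return (rot G) A d"
  by (simp add: rot_H perm_restrict_simps)

lemma rot_H_steps:
  assumes "d \<in> A"
  obtains k where "rot H d = (rot G ^^ Suc k) d" "(rot G ^^ Suc k) d \<in> A"
    "\<forall>j. 0 < j \<longrightarrow> j \<le> k \<longrightarrow> (rot G ^^ j) d \<notin> A"
proof -
  obtain k where k: "0 < k" "first_return (rot G) A d = (rot G ^^ k) d" "(rot G ^^ k) d \<in> A"
    "\<forall>j. 0 < j \<longrightarrow> j < k \<longrightarrow> (rot G ^^ j) d \<notin> A"
    by (rule first_return_self[OF rot_permutes finite_darts assms])
  show ?thesis
  proof (rule that[of "k - 1"])
    show "rot H d = (rot G ^^ Suc (k - 1)) d" "(rot G ^^ Suc (k - 1)) d \<in> A"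
      using rot_H_eq[OF assms] k(1-3) by (simp_all del: funpow.simps)
    show "\<forall>j. 0 < j \<longrightarrow> j \<le> k - 1 \<longrightarrow> (rot G ^^ j) d \<notin> A"
    proof (intro allI impI)
      fix j assume "0 < j" "j \<le> k - 1"
      then show "(rot G ^^ j) d \<notin> A" using k(4)[rule_format, of j] k(1) by linarith
    qed
  qed
qed

lemma dart_map_H: "dart_map H"
proof
  show "finite (darts H)" by (simp add: darts_H)
  show "opp H permutes darts H"
    unfolding darts_H opp_H
  proof (rule bij_imp_permutes)
    show "bij_betw (perm_restrict (opp G) A) A A"
      by (rule bij_betw_byWitness[where f' = "perm_restrict (opp G) A"])
        (use e_opp in \<open>auto simp: perm_restrict_def\<close>)
  qed (auto simp: perm_restrict_def)
  show "rot H permutes darts H"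
    unfolding darts_H rot_H by (rule first_return_permutes[OF rot_permutes finite_darts]) auto
  fix d assume "d \<in> darts H"
  then have d: "d \<in> A" "opp G d \<in> A" using e_opp by (auto simp: darts_H)
  show "opp H d \<noteq> d" using opp_neq d by (simp add: opp_H_eq)
  show "opp H (opp H d) = d" using d by (simp add: opp_H_eq)
qed

lemma funpow_rot_in_darts: "(rot G ^^ j) d \<in> darts G \<longleftrightarrow> d \<in> darts G"
  by (induction j) auto

text \<open>A cycle of \<open>H\<close> is a cycle of \<open>G\<close> that avoids \<open>e\<close>.
  Its colouring in \<open>G\<close> does not change at the darts skipped by the first return, so it
  also serves for \<open>H\<close>.\<close>

lemma planar_H:
  assumes "planar G"
  shows "planar H"
  unfolding planar_def
proof (intro allI impI)
  fix S assume S: "even_cycle H S"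
  have SA: "S \<subseteq> A" using S by (auto simp: even_cycle_def darts_H)
  have S_opp: "opp G d \<in> S \<longleftrightarrow> d \<in> S" if "d \<in> darts G" for d
  proof (cases "d \<in> e")
    case True
    then show ?thesis using SA e_opp[OF that] by blast
  next
    case False
    then have "d \<in> A" using that by simp
    then have "opp H d \<in> S \<longleftrightarrow> d \<in> S" using S by (simp add: even_cycle_def darts_H)
    then show ?thesis using opp_H_eq[OF \<open>d \<in> A\<close>] by simp
  qed
  have S_even: "even (card (S \<inter> orbit (rot G) d))" for d
  proof (cases "orbit (rot G) d \<inter> A = {}")
    case True
    then have "S \<inter> orbit (rot G) d = {}" using SA by blast
    then show ?thesis by simp
  next
    case False
    then obtain x where x: "x \<in> A" "x \<in> orbit (rot G) d" by blast
    have "orbit (rot H) x = orbit (rot G) x \<inter> A"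
      unfolding rot_H by (rule orbit_first_return[OF rot_permutes finite_darts]) (use x in auto)
    then have "S \<inter> orbit (rot G) d = S \<inter> orbit (rot H) x"
      using rot_orbit_eq[OF x(2)] SA by blast
    moreover have "even (card (S \<inter> orbit (rot H) x))"
      using S x(1) by (simp add: even_cycle_def darts_H)
    ultimately show ?thesis by simp
  qed
  have "S \<subseteq> darts G" using SA by blast
  then have "even_cycle G S" using S_opp S_even by (simp add: even_cycle_def)
  then obtain \<phi> where \<phi>: "separates G S \<phi>" using assms by (auto simp: planar_def)
  have "separates H S \<phi>"
    unfolding separates_def
  proof (intro ballI conjI)
    fix d assume "d \<in> darts H"
    then have d: "d \<in> A" by (simp add: darts_H)
    show "\<phi> (opp H d) \<noteq> \<phi> d \<longleftrightarrow> d \<in> S"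
      using \<phi> d opp_H_eq[OF d] by (simp add: separates_def)
    obtain k where k: "rot H d = (rot G ^^ Suc k) d" "(rot G ^^ Suc k) d \<in> A"
      "\<forall>j. 0 < j \<longrightarrow> j \<le> k \<longrightarrow> (rot G ^^ j) d \<notin> A"
      by (rule rot_H_steps[OF d])
    have step: "\<phi> ((rot G ^^ Suc j) d) \<noteq> \<phi> ((rot G ^^ j) d) \<longleftrightarrow> (rot G ^^ Suc j) d \<in> S" for j
    proof -
      have "(rot G ^^ j) d \<in> darts G" using d by (simp add: funpow_rot_in_darts)
      then show ?thesis using \<phi> by (simp add: separates_def)
    qed
    have "\<phi> ((rot G ^^ j) d) = \<phi> d" if "j \<le> k" for j
      using that
    proof (induction j)
      case (Suc j)
      then have "(rot G ^^ Suc j) d \<notin> S" using k(3)[rule_format, of "Suc j"] SA by blast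
      then show ?case using step[of j] Suc by simp
    qed simp
    from this[of k] show "\<phi> (rot H d) \<noteq> \<phi> d \<longleftrightarrow> rot H d \<in> S"
      using step[of k] unfolding k(1) by simp
  qed
  then show "\<exists>\<phi>. separates H S \<phi>" by (rule exI[of _ \<phi>])
qed

text \<open>The other edge of the bigon survives and has the same ends as the deleted one. An
  invariant function on \<open>H\<close> therefore extends to the deleted darts by its value on that
  edge.\<close>

lemma linked_H:
  assumes "linked G" and e: "e = {d, opp G d}" and d: "d \<in> darts G" and bigon: "bigon G d"
  shows "linked H"
  unfolding linked_def
proof (intro allI impI ballI)
  fix f :: "nat \<Rightarrow> bool" and x y
  assume f: "\<forall>d\<in>darts H. f (opp H d) = f d \<and> f (rot H d) = f d"
    and x: "x \<in> darts H" and y: "y \<in> darts H"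
  define d' where "d' = face_perm G d"
  have face: "face_perm G d' = d" and "dart_edge G d' \<noteq> dart_edge G d"
    using bigon by (auto simp: bigon_def d'_def)
  have "d' \<notin> e"
  proof
    assume "d' \<in> e"
    then have "d' = d \<or> d' = opp G d" by (simp add: e)
    then have "dart_edge G d' = dart_edge G d" by (auto simp: dart_edge_def)
    with \<open>dart_edge G d' \<noteq> dart_edge G d\<close> show False ..
  qed
  have "d' \<in> darts G" using d by (simp add: d'_def)
  then have d': "d' \<in> A" "opp G d' \<in> A" using \<open>d' \<notin> e\<close> e_opp by auto
  have rot: "rot G d = opp G d'" "rot G d' = opp G d"
    using face by (metis rot_face) (simp add: d'_def)
  have f_opp: "f (opp G z) = f z" if "z \<in> A" for z
    using conjunct1[OF f[rule_format, of z]] that unfolding darts_H opp_H_eq[OF that] by simp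
  have f_rot: "f (first_return (rot G) A z) = f z" if "z \<in> A" for z
    using conjunct2[OF f[rule_format, of z]] that unfolding darts_H rot_H_eq[OF that] by simp
  define g where "g z = (if z \<in> e then f d' else f z)" for z
  have "g (opp G z) = g z \<and> g (rot G z) = g z" if z: "z \<in> darts G" for z
  proof
    show "g (opp G z) = g z" using f_opp[of z] z e_opp[OF z] by (simp add: g_def)
    show "g (rot G z) = g z"
    proof (cases "z \<in> e"; cases "rot G z \<in> e")
      assume "z \<in> e" "rot G z \<in> e"
      then show ?thesis by (simp add: g_def)
    next
      assume ze: "z \<in> e" and ne: "rot G z \<notin> e"
      then have rA: "rot G z \<in> A" using z by simp
      show ?thesis
      proof (cases "z = d")
        case True
        then show ?thesis using rot(1) f_opp[OF d'(1)] ne ze by (simp add: g_def)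
      next
        case False
        then have "z = rot G d'" using ze rot(2) by (auto simp: e)
        then have "first_return (rot G) A d' = rot G z"
          using ze rA by (intro first_return_2[of "rot G" d' A, folded \<open>z = rot G d'\<close>]) auto
        then show ?thesis using f_rot[OF d'(1)] ne by (simp add: g_def ze)
      qed
    next
      assume ze: "z \<notin> e" and re: "rot G z \<in> e"
      show ?thesis
      proof (cases "rot G z = d")
        case True
        then have "first_return (rot G) A z = opp G d'"
          using first_return_2[of "rot G" z A] re rot(1) d'(2) by simp
        then show ?thesis using f_rot[of z] f_opp[OF d'(1)] ze re z by (simp add: g_def)
      next
        case False
        then have "rot G z = opp G d" using re e by simp
        then have "z = d'" using rot(2) rot_inj by metis
        then show ?thesis using ze re by (simp add: g_def)
      qed
    next
      assume ze: "z \<notin> e" and re: "rot G z \<notin> e"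
      then have "first_return (rot G) A z = rot G z" using z by (intro first_return_1) simp
      then show ?thesis using f_rot[of z] ze re z by (simp add: g_def)
    qed
  qed
  from linkedD[OF assms(1) this] have "g x = g y" using x y by (auto simp: darts_H)
  then show "f x = f y" using x y by (auto simp: g_def darts_H)
qed

end

lemma spherical_bigon_deletion:
  assumes "spherical G" "bigon_deletion G G'"
  shows "spherical G'"
proof -
  obtain d where d: "d \<in> darts G" "bigon G d"
    and G': "\<exists>w. G' = (delete_edge G (dart_edge G d))\<lparr>weight := w\<rparr>"
    using assms(2) by (auto simp: bigon_deletion_def Let_def)
  interpret dart_map G using assms(1) by (simp add: spherical_def)
  have e: "dart_edge G d = {d, opp G d}" by (simp add: dart_edge_def)
  interpret edge_deletion G G' "dart_edge G d"
  proof unfold_locales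
    show "opp G x \<in> dart_edge G d \<longleftrightarrow> x \<in> dart_edge G d" for x
      unfolding e by (metis insert_iff opp_opp singletonD)
  qed (use G' d in \<open>auto simp: delete_edge_def e\<close>)
  have ccw_G': "ccw G' = ccw G - dart_edge G d" using G' by (auto simp: delete_edge_def)
  have ccw: "opp G x \<in> ccw G \<longleftrightarrow> x \<notin> ccw G" "rot G x \<in> ccw G \<longleftrightarrow> x \<in> ccw G"
    if "x \<in> darts G" for x using assms(1) that by (auto simp: spherical_def)
  have "(opp G' x \<in> ccw G' \<longleftrightarrow> x \<notin> ccw G') \<and> (rot G' x \<in> ccw G' \<longleftrightarrow> x \<in> ccw G')"
    if "x \<in> darts G'" for x
  proof
    have x: "x \<in> A" "opp G x \<in> A" using that e_opp by (auto simp: darts_H)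
    show "opp G' x \<in> ccw G' \<longleftrightarrow> x \<notin> ccw G'"
      using x ccw(1)[of x] by (simp add: ccw_G' opp_H_eq)
    obtain k where k: "rot G' x = (rot G ^^ Suc k) x" "(rot G ^^ Suc k) x \<in> A"
      "\<forall>j. 0 < j \<longrightarrow> j \<le> k \<longrightarrow> (rot G ^^ j) x \<notin> A"
      by (rule rot_H_steps[OF x(1)])
    have "(rot G ^^ j) x \<in> ccw G \<longleftrightarrow> x \<in> ccw G" for j
    proof (induction j)
      case (Suc j)
      then show ?case using ccw(2)[of "(rot G ^^ j) x"] x by (simp add: funpow_rot_in_darts)
    qed simp
    from this[of "Suc k"] show "rot G' x \<in> ccw G' \<longleftrightarrow> x \<in> ccw G'"
      using k x by (simp add: ccw_G' del: funpow.simps)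
  qed
  moreover have "linked G'"
    by (rule linked_H[OF _ e d]) (use assms(1) in \<open>simp add: spherical_def\<close>)
  moreover have "planar G'" using assms(1) by (intro planar_H) (simp add: spherical_def)
  moreover have "ccw G' \<subseteq> darts G'"
    using assms(1) by (auto simp: ccw_G' darts_H spherical_def)
  ultimately show ?thesis using dart_map_H by (simp add: spherical_def)
qed

section \<open>Insertion of an edge inside a region\<close>

locale edge_insertion = dart_map G for G :: weighted_map +
  fixes H :: weighted_map and p q a b
  assumes new: "p \<notin> darts G" "q \<notin> darts G" "p \<noteq> q"
    and corners: "a \<in> darts G" "b \<in> darts G" "a \<noteq> b"
    and same_face: "b \<in> orbit (face_perm G) a"
    and H: "H = insert_edge G p q a b"
begin

lemma darts_H: "darts H = darts G \<union> {p, q}"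
  by (simp add: H insert_edge_def)

lemma distinct_pqab: "a \<noteq> p" "a \<noteq> q" "b \<noteq> p" "b \<noteq> q" "p \<noteq> a" "q \<noteq> a" "p \<noteq> b" "q \<noteq> b"
  using new corners by auto

lemma opp_H: "opp H = (opp G)(p := q, q := p)"
  by (simp add: H insert_edge_def)

lemma opp_H_new [simp]: "opp H p = q" "opp H q = p"
  using new by (auto simp: opp_H)

lemma opp_H_old [simp]: "d \<in> darts G \<Longrightarrow> opp H d = opp G d"
  using new by (auto simp: opp_H)

lemma rot_H: "rot H = (rot G)(a := p, p := rot G a, b := q, q := rot G b)"
  by (simp add: H insert_edge_def)

lemma rot_H_new [simp]: "rot H a = p" "rot H p = rot G a" "rot H b = q" "rot H q = rot G b"
  using new corners distinct_pqab by (auto simp: rot_H)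

lemma rot_H_old [simp]: "d \<in> darts G \<Longrightarrow> d \<noteq> a \<Longrightarrow> d \<noteq> b \<Longrightarrow> rot H d = rot G d"
  using new by (auto simp: rot_H)

lemma dart_map_H: "dart_map H"
proof
  show "finite (darts H)" by (simp add: darts_H)
  have fix_new: "opp G p = p" "opp G q = q" "rot G p = p" "rot G q = q"
    using new opp_permutes rot_permutes by (auto simp: permutes_def)
  have "opp G permutes darts H" "rot G permutes darts H"
    using opp_permutes rot_permutes by (auto simp: darts_H intro: permutes_subset)
  moreover have "opp H = opp G \<circ> Transposition.transpose p q"
    using fix_new by (auto simp: opp_H Transposition.transpose_def)
  moreover have "rot H = rot G \<circ> (Transposition.transpose a p \<circ> Transposition.transpose b q)"
    using fix_new new(3) corners(3) distinct_pqab by (auto simp: rot_H Transposition.transpose_def fun_eq_iff)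
  ultimately show "opp H permutes darts H" "rot H permutes darts H"
    using corners by (auto intro!: permutes_compose permutes_swap_id simp: darts_H)
  fix d assume "d \<in> darts H"
  then consider "d \<in> darts G" | "d = p" | "d = q" by (auto simp: darts_H)
  then have "opp H d \<noteq> d \<and> opp H (opp H d) = d"
    by cases (use new opp_neq in \<open>simp_all\<close>)
  then show "opp H d \<noteq> d" "opp H (opp H d) = d" by auto
qed

text \<open>Insertion is undone by deletion, so the vertices of the two maps are related by the same
  first-return argument.\<close>

lemma rot_G_restrict: "rot G = perm_restrict (first_return (rot H) (darts G)) (darts G)"
proof
  fix x
  show "rot G x = perm_restrict (first_return (rot H) (darts G)) (darts G) x"
  proof (cases "x \<in> darts G")
    case False
    then show ?thesis using rot_permutes by (simp add: perm_restrict_def permutes_not_in)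
  next
    case True
    have "first_return (rot H) (darts G) x = rot G x"
    proof (cases "x = a \<or> x = b")
      case False
      then show ?thesis using True first_return_1[of "rot H" x "darts G"] by simp
    next
      case ab: True
      then show ?thesis using True new first_return_2[of "rot H" x "darts G"] by auto
    qed
    then show ?thesis using True by (simp add: perm_restrict_def)
  qed
qed

lemma orbit_rot_G:
  assumes "x \<in> darts G"
  shows "orbit (rot G) x = orbit (rot H) x \<inter> darts G"
proof -
  interpret H: dart_map H by (rule dart_map_H)
  show ?thesis
    by (subst rot_G_restrict, rule orbit_first_return[OF H.rot_permutes H.finite_darts])
      (use assms in \<open>auto simp: darts_H\<close>)
qed

text \<open>The new darts \<open>p\<close> and \<open>q\<close> are counted at the corners
  \<open>a\<close> and \<open>b\<close> into which they are inserted. This expresses the degree of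
  \<open>S\<close> at a vertex by data of \<open>G\<close>.\<close>

lemma card_orbit_rot_H:
  assumes "d \<in> darts G" "S \<subseteq> darts H" "p \<in> S \<longleftrightarrow> q \<in> S"
  shows "card (S \<inter> orbit (rot H) d)
    = card {x \<in> orbit (rot G) d. x \<in> S} + card {x \<in> orbit (rot G) d. p \<in> S \<and> (x = a \<or> x = b)}"
proof -
  interpret H: dart_map H by (rule dart_map_H)
  have mem: "x \<in> orbit (rot G) d \<longleftrightarrow> x \<in> orbit (rot H) d" if "x \<in> darts G" for x
    using that orbit_rot_G[OF assms(1)] by simp
  have pa: "p \<in> orbit (rot H) d \<longleftrightarrow> a \<in> orbit (rot G) d"
    using H.rot_orbit_step[of a d] mem[OF corners(1)] by simp
  have qb: "q \<in> orbit (rot H) d \<longleftrightarrow> b \<in> orbit (rot G) d"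
    using H.rot_orbit_step[of b d] mem[OF corners(2)] by simp
  have "S \<inter> orbit (rot H) d = {x \<in> orbit (rot G) d. x \<in> S} \<union> (S \<inter> orbit (rot H) d \<inter> {p, q})"
    using assms(2) orbit_rot_G[OF assms(1)] unfolding darts_H by blast
  also have "card \<dots> = card {x \<in> orbit (rot G) d. x \<in> S} + card (S \<inter> orbit (rot H) d \<inter> {p, q})"
  proof (rule card_Un_disjoint)
    show "{x \<in> orbit (rot G) d. x \<in> S} \<inter> (S \<inter> orbit (rot H) d \<inter> {p, q}) = {}"
      using orbit_rot_G[OF assms(1)] new(1,2) by blast
  qed auto
  also have "card (S \<inter> orbit (rot H) d \<inter> {p, q})
      = card {x \<in> orbit (rot G) d. p \<in> S \<and> (x = a \<or> x = b)}"
  proof (rule bij_betw_same_card)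
    show "bij_betw (\<lambda>x. if x = p then a else b) (S \<inter> orbit (rot H) d \<inter> {p, q})
        {x \<in> orbit (rot G) d. p \<in> S \<and> (x = a \<or> x = b)}"
      by (rule bij_betw_byWitness[where f' = "\<lambda>x. if x = a then p else q"])
        (use assms(3) pa qb new(3) corners(3) in \<open>auto split: if_splits\<close>)
  qed
  finally show ?thesis .
qed

lemma planar_H:
  assumes "planar G"
  shows "planar H"
  unfolding planar_def
proof (intro allI impI)
  fix S assume S: "even_cycle H S"
  have S_opp: "opp H d \<in> S \<longleftrightarrow> d \<in> S" if "d \<in> darts H" for d
    using S that by (simp add: even_cycle_def)
  have pq: "q \<in> S \<longleftrightarrow> p \<in> S" using S_opp[of p] by (simp add: darts_H)
  have S_opp_G: "opp G d \<in> S \<longleftrightarrow> d \<in> S" if "d \<in> darts G" for d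
    using S_opp[of d] that by (simp add: darts_H)
  obtain I where I: "a \<in> I" "b \<notin> I" "opp G (rot G a) \<notin> I" "opp G (rot G b) \<in> I"
    "\<forall>x. x \<noteq> a \<longrightarrow> x \<noteq> b \<longrightarrow> (opp G (rot G x) \<in> I \<longleftrightarrow> x \<in> I)"
  proof -
    obtain I where I: "a \<in> I" "b \<notin> I"
      "\<forall>y. (face_perm G y \<in> I) \<noteq> (y \<in> I) \<longleftrightarrow> face_perm G y = a \<or> face_perm G y = b"
      by (rule orbit_segment[OF face_permutes same_face corners(3)])
    have "(x \<in> I) \<noteq> (opp G (rot G x) \<in> I) \<longleftrightarrow> x = a \<or> x = b" for x
      using I(3)[rule_format, of "opp G (rot G x)"] by simp
    then show ?thesis using I(1,2) by (intro that[of I]) blast+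
  qed
  \<comment> \<open>If \<open>S\<close> uses the new edge, reroute it along the boundary of the old region; the two curves
    differ by the boundary of one of the two new regions, whose corners in \<open>G\<close> satisfy \<open>J\<close>.\<close>
  define J where "J x \<longleftrightarrow> p \<in> S \<and> x \<in> I" for x
  have J: "J a \<longleftrightarrow> p \<in> S" "\<not> J b" "\<not> J (opp G (rot G a))" "J (opp G (rot G b)) \<longleftrightarrow> p \<in> S"
    using I(1-4) by (simp_all add: J_def)
  have J_step: "J (opp G (rot G x)) = J x" if "x \<noteq> a" "x \<noteq> b" for x
    using I(5) that by (simp add: J_def)
  define S' where "S' = {x \<in> darts G. (x \<in> S) \<noteq> (J (opp G x) \<noteq> J x)}"
  have "even_cycle G S'"
    unfolding even_cycle_def
  proof (intro conjI ballI)
    show "S' \<subseteq> darts G" by (auto simp: S'_def)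
    fix d assume d: "d \<in> darts G"
    show "opp G d \<in> S' \<longleftrightarrow> d \<in> S'" using d S_opp_G[OF d] by (auto simp: S'_def)
    have "S' \<inter> orbit (rot G) d = {x \<in> orbit (rot G) d. (x \<in> S) \<noteq> (J (opp G x) \<noteq> J x)}"
      using rot_orbit_subset[OF d] by (auto simp: S'_def)
    \<comment> \<open>Along the boundary of the old region \<open>J\<close> changes only at
      \<open>a\<close> and \<open>b\<close>. Adding its boundary to \<open>S\<close> thus corrects
      exactly the parities that are lost by dropping \<open>p\<close> and \<open>q\<close>.\<close>
    moreover have "(J (opp G (rot G x)) \<noteq> J x) \<longleftrightarrow> p \<in> S \<and> (x = a \<or> x = b)" for x
      using J J_step[of x] by (cases "x = a"; cases "x = b") auto
    then have "even (card {x \<in> orbit (rot G) d. J (opp G x) \<noteq> J x})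
        \<longleftrightarrow> even (card {x \<in> orbit (rot G) d. p \<in> S \<and> (x = a \<or> x = b)})"
      using face_boundary_parity[OF d, of J] by simp
    moreover have "even (card (S \<inter> orbit (rot H) d))"
      using S d by (simp add: even_cycle_def darts_H)
    then have "even (card {x \<in> orbit (rot G) d. x \<in> S}
        + card {x \<in> orbit (rot G) d. p \<in> S \<and> (x = a \<or> x = b)})"
      using card_orbit_rot_H[OF d _ pq[symmetric]] S by (simp add: even_cycle_def)
    ultimately show "even (card (S' \<inter> orbit (rot G) d))"
      by (simp only: even_card_xor[OF finite_rot_orbit] even_add)
  qed
  then obtain \<phi> where \<phi>: "separates G S' \<phi>" using assms by (auto simp: planar_def)
  have \<phi>_opp: "\<phi> (opp G d) \<noteq> \<phi> d \<longleftrightarrow> (d \<in> S) \<noteq> (J (opp G d) \<noteq> J d)" if "d \<in> darts G" for d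
    using \<phi> that by (simp add: separates_def S'_def)
  have \<phi>_rot: "\<phi> (rot G d) \<noteq> \<phi> d \<longleftrightarrow> (rot G d \<in> S) \<noteq> (J (opp G (rot G d)) \<noteq> J (rot G d))"
    if "d \<in> darts G" for d
    using \<phi> that by (simp add: separates_def S'_def)
  have ab: "\<phi> b = \<phi> a"
  proof -
    have "\<phi> b = \<phi> a \<and> b \<in> darts G" using same_face
    proof induction
      case base
      show ?case using separates_face[OF \<phi> corners(1)] corners(1) by simp
    next
      case (step y)
      then have y: "y \<in> darts G" "\<phi> y = \<phi> a" by auto
      show ?case using separates_face[OF \<phi> y(1)] y by simp
    qed
    then show ?thesis ..
  qed
  \<comment> \<open>The rerouting is undone by flipping the colour where \<open>J\<close> holds. The
    new corner \<open>q\<close> lies in the new region of \<open>a\<close>, where \<open>J\<close>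
    holds if \<open>p\<close> is in \<open>S\<close>; the new corner \<open>p\<close> lies in that
    of \<open>b\<close>, where \<open>J\<close> fails.\<close>
  define \<psi> where "\<psi> x \<longleftrightarrow> (if x = p then \<phi> a else if x = q then \<phi> a \<noteq> (p \<in> S) else \<phi> x \<noteq> J x)" for x
  have \<psi>_p: "\<psi> p = \<phi> a" and \<psi>_q: "\<psi> q \<longleftrightarrow> \<phi> a \<noteq> (p \<in> S)"
    using new(3) by (auto simp: \<psi>_def)
  have \<psi>_G: "\<psi> d \<longleftrightarrow> \<phi> d \<noteq> J d" if "d \<in> darts G" for d
    using that new by (auto simp: \<psi>_def)
  have "separates H S \<psi>"
    unfolding separates_def
  proof (intro ballI)
    fix d assume "d \<in> darts H"
    then consider "d \<in> darts G" "d \<noteq> a" "d \<noteq> b" | "d = a" | "d = b" | "d = p" | "d = q"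
      by (auto simp: darts_H)
    then show "(\<psi> (opp H d) \<noteq> \<psi> d \<longleftrightarrow> d \<in> S) \<and> (\<psi> (rot H d) \<noteq> \<psi> d \<longleftrightarrow> rot H d \<in> S)"
    proof cases
      case 1
      then have "\<psi> (opp H d) \<noteq> \<psi> d \<longleftrightarrow> d \<in> S" using \<phi>_opp[of d] \<psi>_G[of d] \<psi>_G[of "opp G d"] by auto
      moreover have "\<psi> (rot H d) \<noteq> \<psi> d \<longleftrightarrow> rot H d \<in> S"
        using 1 \<phi>_rot[of d] \<psi>_G[of d] \<psi>_G[of "rot G d"] J_step[of d] by auto
      ultimately show ?thesis ..
    next
      case 2
      then show ?thesis
        using \<phi>_opp[of a] \<psi>_G[of a] \<psi>_G[of "opp G a"] \<psi>_p J corners(1) by auto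
    next
      case 3
      then show ?thesis
        using \<phi>_opp[of b] \<psi>_G[of b] \<psi>_G[of "opp G b"] \<psi>_q J corners(2) pq ab by auto
    next
      case 4
      then show ?thesis
        using \<phi>_rot[of a] \<psi>_G[of "rot G a"] \<psi>_p \<psi>_q J corners(1) by auto
    next
      case 5
      then show ?thesis
        using \<phi>_rot[of b] \<psi>_G[of "rot G b"] \<psi>_p \<psi>_q J corners(2) ab pq by auto
    qed
  qed
  then show "\<exists>\<phi>. separates H S \<phi>" by (rule exI[of _ \<psi>])
qed

lemma linked_H:
  assumes "linked G"
  shows "linked H"
  unfolding linked_def
proof (intro allI impI ballI)
  fix f :: "nat \<Rightarrow> bool" and x y
  assume f: "\<forall>d\<in>darts H. f (opp H d) = f d \<and> f (rot H d) = f d"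
    and x: "x \<in> darts H" and y: "y \<in> darts H"
  have f_rot: "f (rot H d) = f d" if "d \<in> darts H" for d using f that by simp
  have "f (opp G d) = f d \<and> f (rot G d) = f d" if d: "d \<in> darts G" for d
  proof
    show "f (opp G d) = f d" using f[rule_format, of d] d by (simp add: darts_H)
    show "f (rot G d) = f d"
    proof (cases "d = a \<or> d = b")
      case False
      then show ?thesis using f_rot[of d] d by (simp add: darts_H)
    next
      case True
      then show ?thesis
        using f_rot[of a] f_rot[of p] f_rot[of b] f_rot[of q] corners by (auto simp: darts_H)
    qed
  qed
  note inv = this
  have const: "f d = f a" if "d \<in> darts G" for d
    by (rule linkedD[OF assms inv that corners(1)])
  have "f p = f a" "f q = f a"
    using f_rot[of a] f_rot[of b] const[OF corners(2)] corners by (auto simp: darts_H)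
  then have "f d = f a" if "d \<in> darts H" for d
    using that const by (auto simp: darts_H)
  then show "f x = f y" using x y by simp
qed

end

lemma spherical_arc_addition:
  assumes "spherical G" "arc_addition G G'"
  shows "spherical G'"
proof -
  obtain d a b p q where d: "d \<in> darts G" "dart_vertex G d \<noteq> dart_vertex G (opp G d)"
    and ab: "a \<in> darts G" "b \<in> darts G" "a \<in> dart_vertex G d" "b \<in> dart_vertex G (opp G d)"
    and face: "dart_face G a = dart_face G b"
    and pq: "p \<notin> darts G" "q \<notin> darts G" "p \<noteq> q" and G': "G' = insert_edge G p q a b"
    using assms(2) unfolding arc_addition_def by blast
  interpret dart_map G using assms(1) by (simp add: spherical_def)
  interpret edge_insertion G G' p q a b
  proof
    show "a \<noteq> b"
    proof
      assume "a = b"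
      then have "orbit (rot G) d = orbit (rot G) (opp G d)"
        using ab(3,4) rot_orbit_eq unfolding dart_vertex_def by metis
      then show False using d(2) by (simp add: dart_vertex_def)
    qed
    show "b \<in> orbit (face_perm G) a"
      using face orbit_self[OF face_permutes finite_darts, of b] by (simp add: dart_face_def)
  qed (use ab pq G' in auto)
  have ccw_G': "ccw G' = ccw G \<union> {x. x = p \<and> a \<in> ccw G \<or> x = q \<and> b \<in> ccw G}"
    by (simp add: G' insert_edge_def)
  have sub: "ccw G \<subseteq> darts G" using assms(1) by (simp add: spherical_def)
  have ccw: "opp G x \<in> ccw G \<longleftrightarrow> x \<notin> ccw G" "rot G x \<in> ccw G \<longleftrightarrow> x \<in> ccw G"
    if "x \<in> darts G" for x using assms(1) that by (auto simp: spherical_def)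
  have ccw_orbit: "y \<in> ccw G \<longleftrightarrow> x \<in> ccw G" if "y \<in> orbit (rot G) x" "x \<in> darts G" for x y
  proof -
    have "(y \<in> ccw G \<longleftrightarrow> x \<in> ccw G) \<and> y \<in> darts G" using that(1)
      by induction (use that(2) ccw(2) in \<open>simp_all\<close>)
    then show ?thesis ..
  qed
  \<comment> \<open>The arc joins the two ends of an existing edge, and these have opposite rotation
    directions; so the new edge respects the bipartition.\<close>
  have "b \<in> ccw G \<longleftrightarrow> a \<notin> ccw G"
    using ccw_orbit[of a d] ccw_orbit[of b "opp G d"] ab(3,4) d(1) ccw(1)[of d]
    by (simp add: dart_vertex_def)
  then have new_ccw: "p \<in> ccw G' \<longleftrightarrow> a \<in> ccw G" "q \<in> ccw G' \<longleftrightarrow> a \<notin> ccw G"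
    using pq sub by (auto simp: ccw_G')
  have old_ccw: "x \<in> ccw G' \<longleftrightarrow> x \<in> ccw G" if "x \<in> darts G" for x
    using that pq by (auto simp: ccw_G')
  have "(opp G' x \<in> ccw G' \<longleftrightarrow> x \<notin> ccw G') \<and> (rot G' x \<in> ccw G' \<longleftrightarrow> x \<in> ccw G')"
    if x: "x \<in> darts G'" for x
  proof -
    consider "x \<in> darts G" "x \<noteq> a" "x \<noteq> b" | "x = a" | "x = b" | "x = p" | "x = q"
      using x by (auto simp: darts_H)
    then show ?thesis
      by cases (use ab new_ccw old_ccw ccw \<open>b \<in> ccw G \<longleftrightarrow> a \<notin> ccw G\<close> in \<open>simp_all\<close>)
  qed
  moreover have "linked G'" using assms(1) by (intro linked_H) (simp add: spherical_def)
  moreover have "planar G'" using assms(1) by (intro planar_H) (simp add: spherical_def)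
  moreover have "ccw G' \<subseteq> darts G'"
    using sub by (auto simp: ccw_G' darts_H)
  ultimately show ?thesis using dart_map_H by (simp add: spherical_def)
qed

lemma spherical_GF:
  assumes "spherical (black_graph D)" "GF D G"
  shows "spherical G"
proof -
  obtain G1 where "bigon_deletion\<^sup>*\<^sup>* (black_graph D) G1" and G: "arc_addition\<^sup>*\<^sup>* G1 G"
    using assms(2) by (auto simp: GF_def)
  from this(1) have "spherical G1"
    by (induction rule: rtranclp_induct) (use assms(1) spherical_bigon_deletion in blast)+
  from G this show ?thesis
    by (induction rule: rtranclp_induct) (use spherical_arc_addition in blast)+
qed

section \<open>The black graph of a special diagram\<close>

text \<open>The analogue of \<open>planar\<close> for a disjoint union of cycles: evenly many jumps
  on each cycle can be realised by a two-valued function. Jumps are removed in pairs lying on one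
  cycle, and each pair contributes an arc from \<open>orbit_segment\<close>.\<close>

lemma orbit_parity_function:
  assumes f: "f permutes X" "finite X" and S: "finite S" "\<And>x. even (card (S \<inter> orbit f x))"
  shows "\<exists>\<kappa>. \<forall>y. \<kappa> (f y) \<noteq> (\<kappa> y :: bool) \<longleftrightarrow> f y \<in> S"
  using S
proof (induction "card S" arbitrary: S rule: less_induct)
  case less
  show ?case
  proof (cases "S = {}")
    case True
    then show ?thesis by (intro exI[of _ "\<lambda>_. False"]) simp
  next
    case False
    then obtain s where s: "s \<in> S" by blast
    have s_orb: "s \<in> orbit f s" by (rule orbit_self[OF f])
    have "S \<inter> orbit f s \<noteq> {s}" using less.prems(2)[of s] by auto
    then obtain t where t: "t \<in> S" "t \<in> orbit f s" "s \<noteq> t" using s s_orb by blast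
    obtain I where I: "\<forall>y. (f y \<in> I) \<noteq> (y \<in> I) \<longleftrightarrow> f y = s \<or> f y = t"
      by (rule orbit_segment[OF f(1) t(2,3)])
    let ?S = "S - {s, t}"
    have "even (card (?S \<inter> orbit f x))" for x
    proof (cases "s \<in> orbit f x")
      case True
      then have eq: "orbit f s = orbit f x" by (rule orbit_eq[OF f])
      have "S \<inter> orbit f x = insert s (insert t (?S \<inter> orbit f x))"
        using s t(1,2) s_orb unfolding eq by blast
      then have "card (S \<inter> orbit f x) = Suc (Suc (card (?S \<inter> orbit f x)))"
        using t(3) less.prems(1) by simp
      then show ?thesis using less.prems(2)[of x] by simp
    next
      case False
      have "t \<notin> orbit f x"
      proof
        assume "t \<in> orbit f x"
        then have "orbit f x = orbit f s" using orbit_eq[OF f] t(2) by metis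
        then show False using False s_orb by simp
      qed
      then have "?S \<inter> orbit f x = S \<inter> orbit f x" using False by blast
      then show ?thesis using less.prems(2)[of x] by simp
    qed
    moreover have "card ?S < card S"
      using s less.prems(1) by (intro psubset_card_mono) auto
    ultimately obtain \<kappa> where \<kappa>: "\<forall>y. \<kappa> (f y) \<noteq> (\<kappa> y :: bool) \<longleftrightarrow> f y \<in> ?S"
      using less.hyps[of ?S] less.prems(1) by auto
    have "\<forall>y. (\<kappa> (f y) \<noteq> (f y \<in> I)) \<noteq> (\<kappa> y \<noteq> (y \<in> I)) \<longleftrightarrow> f y \<in> S"
    proof
      fix y
      have "f y \<in> S \<longleftrightarrow> f y \<in> ?S \<or> f y = s \<or> f y = t" using s t(1) by blast
      then show "(\<kappa> (f y) \<noteq> (f y \<in> I)) \<noteq> (\<kappa> y \<noteq> (y \<in> I)) \<longleftrightarrow> f y \<in> S"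
        using \<kappa>[rule_format, of y] I[rule_format, of y] by blast
    qed
    then show ?thesis by (intro exI[of _ "\<lambda>y. \<kappa> y \<noteq> (y \<in> I)"])
  qed
qed

section \<open>Seifert circles and black corners of a special diagram\<close>

locale special_diagram = dart_map D for D :: link_diagram +
  assumes D: "link_diagram D" and special: "special D"
begin

abbreviation "Out \<equiv> outgoing D"
abbreviation r where "r \<equiv> rot D"

lemma planar_D: "planar D" and linked_D: "linked D"
  using planar_connected_sphere_map D by (auto simp: link_diagram_def)

lemma Out_sub: "Out \<subseteq> darts D"
  using D by (simp add: link_diagram_def)

lemma finite_Out: "finite Out"
  using Out_sub finite_subset finite_darts by blast

lemma Out_opp [simp]: "d \<in> darts D \<Longrightarrow> opp D d \<in> Out \<longleftrightarrow> d \<notin> Out"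
  and Out_rr [simp]: "d \<in> darts D \<Longrightarrow> r (r d) \<in> Out \<longleftrightarrow> d \<notin> Out"
  and over_r: "d \<in> darts D \<Longrightarrow> r d \<in> over D \<longleftrightarrow> d \<notin> over D"
  using D by (auto simp: link_diagram_def)

lemma rr_neq: "d \<in> darts D \<Longrightarrow> r (r d) \<noteq> d"
  by (metis Out_rr)

lemma r_neq: "d \<in> darts D \<Longrightarrow> r d \<noteq> d"
  by (metis over_r)

lemma rrr_neq: "d \<in> darts D \<Longrightarrow> r (r (r d)) \<noteq> d"
  by (metis over_r rot_in_darts)

lemma orbit_r:
  assumes d: "d \<in> darts D"
  shows "orbit r d = {d, r d, r (r d), r (r (r d))}"
proof -
  let ?O = "{d, r d, r (r d), r (r (r d))}"
  have "card ?O = 4"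
    using r_neq[OF d] rr_neq[OF d] rrr_neq[OF d] by auto
  moreover have "card (orbit r d) = 4"
    using D d by (simp add: link_diagram_def dart_vertex_def)
  moreover have "?O \<subseteq> orbit r d" by simp
  ultimately show ?thesis using card_subset_eq[of "orbit r d" ?O] by simp
qed

lemma r4 [simp]:
  assumes d: "d \<in> darts D"
  shows "r (r (r (r d))) = d"
proof -
  have "r (r (r (r d))) \<in> orbit r d" by simp
  then show ?thesis
    unfolding orbit_r[OF d] using r_neq[OF d] rr_neq[OF d] rrr_neq[OF d] by auto
qed

lemma face_eq: "d \<in> darts D \<Longrightarrow> face_perm D d = r (r (r (opp D d)))"
  by (metis opp_in_darts r4 rot_face rot_inj)

abbreviation "next_dart \<equiv> seifert_next D"

lemma next_dart_left:
  assumes "d \<in> Out" "r (opp D d) \<in> Out"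
  shows "next_dart d = r (opp D d)"
  using assms by (simp add: seifert_next_def Let_def)

lemma next_dart_right:
  assumes "d \<in> Out" "r (opp D d) \<notin> Out"
  shows "next_dart d = face_perm D d"
  using assms by (simp add: seifert_next_def Let_def face_perm_def)

lemma next_dart_Out:
  assumes "d \<in> Out"
  shows "next_dart d \<in> Out"
proof (cases "r (opp D d) \<in> Out")
  case True
  then show ?thesis using next_dart_left[OF assms] by simp
next
  case False
  have d: "d \<in> darts D" using assms Out_sub by blast
  have "r (r (face_perm D d)) \<notin> Out" using False by simp
  then show ?thesis using next_dart_right[OF assms False] d Out_rr[of "face_perm D d"] by simp
qed

text \<open>The incoming dart that the smoothing joins to the outgoing dart \<open>d\<close>.\<close>

definition partner :: "nat \<Rightarrow> nat" where
  "partner d = (if r d \<in> Out then r (r (r d)) else r d)"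

lemma partner_in:
  assumes "d \<in> Out"
  shows "partner d \<in> darts D" "partner d \<notin> Out" "opp D (partner d) \<in> Out"
proof -
  have d: "d \<in> darts D" using assms Out_sub by blast
  then show 1: "partner d \<in> darts D" by (simp add: partner_def)
  show "partner d \<notin> Out" using d by (auto simp: partner_def)
  then show "opp D (partner d) \<in> Out" using 1 by simp
qed

lemma next_dart_partner:
  assumes "d \<in> Out"
  shows "next_dart (opp D (partner d)) = d"
proof -
  have d: "d \<in> darts D" using assms Out_sub by blast
  note p = partner_in[OF assms]
  show ?thesis
  proof (cases "r d \<in> Out")
    case True
    then have "r (opp D (opp D (partner d))) = d" using d by (simp add: partner_def)
    then show ?thesis using next_dart_left[OF p(3)] assms by simp
  next
    case False
    then have pd: "partner d = r d" by (simp add: partner_def)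
    then have "r (opp D (opp D (partner d))) \<notin> Out" using d assms by simp
    then show ?thesis using next_dart_right[OF p(3)] by (simp add: pd)
  qed
qed

lemma next_dart_permutes: "perm_restrict next_dart Out permutes Out"
proof (rule bij_imp_permutes)
  have "Out \<subseteq> next_dart ` Out"
  proof
    fix d assume "d \<in> Out"
    then show "d \<in> next_dart ` Out"
      using imageI[OF partner_in(3), of d next_dart] next_dart_partner by simp
  qed
  moreover have "next_dart ` Out \<subseteq> Out" using next_dart_Out by blast
  ultimately have im: "next_dart ` Out = Out" by blast
  then have "inj_on next_dart Out" using finite_Out by (intro eq_card_imp_inj_on) simp_all
  then have "bij_betw next_dart Out Out" using im by (simp add: bij_betw_def)
  then show "bij_betw (perm_restrict next_dart Out) Out Out"
    by (rule bij_betw_cong[THEN iffD1, rotated]) (simp add: perm_restrict_def)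
qed (simp add: perm_restrict_def)

lemma orbit_next_dart:
  assumes "d \<in> Out"
  shows "orbit next_dart d = orbit (perm_restrict next_dart Out) d"
  by (rule orbit_cong0[OF assms]) (use next_dart_Out in \<open>auto simp: perm_restrict_def\<close>)

lemma circle_self: "d \<in> Out \<Longrightarrow> d \<in> orbit next_dart d"
  using orbit_next_dart orbit_self[OF next_dart_permutes finite_Out] by simp

lemma circle_sub: "d \<in> Out \<Longrightarrow> orbit next_dart d \<subseteq> Out"
  using orbit_next_dart permutes_orbit_subset[OF next_dart_permutes] by simp

lemma circle_step:
  assumes "d \<in> Out" "y \<in> Out"
  shows "next_dart y \<in> orbit next_dart d \<longleftrightarrow> y \<in> orbit next_dart d"
  using orbit_step_iff[OF next_dart_permutes finite_Out, of y d] assms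
  by (simp add: orbit_next_dart perm_restrict_def)

text \<open>Opposite darts of a crossing have opposite directions, so from a suitable
  \<open>a\<close> on the counterclockwise pattern is out, out, in, in.\<close>

lemma vertex_base:
  assumes "d \<in> darts D"
  obtains a where "a \<in> darts D" "orbit r a = orbit r d" "a \<in> Out" "r a \<in> Out"
proof -
  consider "d \<in> Out" "r d \<in> Out" | "d \<in> Out" "r d \<notin> Out" | "d \<notin> Out" "r d \<in> Out"
    | "d \<notin> Out" "r d \<notin> Out" by blast
  then show ?thesis
  proof cases
    case 1
    then show ?thesis using assms by (intro that[of d]) auto
  next
    case 2
    then show ?thesis using assms by (intro that[of "r (r (r d))"]) auto
  next
    case 3
    then show ?thesis using assms by (intro that[of "r d"]) auto
  next
    case 4
    then show ?thesis using assms by (intro that[of "r (r d)"]) auto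
  qed
qed

text \<open>A Seifert circle uses an outgoing dart iff it uses the partner of that dart, so the
  darts of the circle at a crossing come in pairs.\<close>

lemma even_cycle_circle:
  assumes d0: "d0 \<in> Out"
  shows "even_cycle D {x \<in> darts D. x \<in> orbit next_dart d0 \<or> opp D x \<in> orbit next_dart d0}"
    (is "even_cycle D ?S")
  unfolding even_cycle_def
proof (intro conjI ballI)
  show "?S \<subseteq> darts D" by blast
  fix d assume d: "d \<in> darts D"
  show "opp D d \<in> ?S \<longleftrightarrow> d \<in> ?S" using d by auto
  have partner: "z \<in> ?S \<longleftrightarrow> partner z \<in> ?S" if z: "z \<in> Out" for z
  proof -
    have zd: "z \<in> darts D" using z Out_sub by blast
    have "opp D z \<notin> Out" using z zd by simp
    then have "z \<in> ?S \<longleftrightarrow> z \<in> orbit next_dart d0" using zd circle_sub[OF d0] by blast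
    also have "\<dots> \<longleftrightarrow> opp D (partner z) \<in> orbit next_dart d0"
      using circle_step[OF d0 partner_in(3)[OF z]] next_dart_partner[OF z] by simp
    also have "\<dots> \<longleftrightarrow> partner z \<in> ?S"
      using partner_in[OF z] circle_sub[OF d0] by blast
    finally show ?thesis .
  qed
  obtain a where a: "a \<in> darts D" "orbit r a = orbit r d" "a \<in> Out" "r a \<in> Out"
    by (rule vertex_base[OF d])
  have 1: "a \<in> ?S \<longleftrightarrow> r (r (r a)) \<in> ?S"
    using partner[OF a(3)] a(4) by (simp only: partner_def if_True)
  have 2: "r a \<in> ?S \<longleftrightarrow> r (r a) \<in> ?S"
    using partner[OF a(4)] a(1,3) by (simp only: partner_def Out_rr if_False simp_thms)
  have ne: "a \<noteq> r a" "a \<noteq> r (r a)" "a \<noteq> r (r (r a))"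
    using r_neq[OF a(1)] rr_neq[OF a(1)] rrr_neq[OF a(1)] by metis+
  have "?S \<inter> orbit r d = (if a \<in> ?S then {a, r (r (r a))} else {}) \<union> (if r a \<in> ?S then {r a, r (r a)} else {})"
    unfolding a(2)[symmetric] orbit_r[OF a(1)] using 1 2 by (simp add: Int_insert_right) blast
  then show "even (card (?S \<inter> orbit r d))"
    using ne by simp
qed

text \<open>The corner lies to the left of the outgoing dart \<open>d\<close> and to the right of
  the outgoing dart \<open>r d\<close>. In a disc with a single boundary circle, both darts would
  belong to that circle, which would then have one region on both of its sides. A colouring that
  separates the two sides rules this out.\<close>

lemma out_out_not_black:
  assumes d: "d \<in> darts D" "d \<in> Out" "r d \<in> Out"
  shows "\<not> seifert_disc D (smoothed_region D d) C"
proof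
  let ?R = "smoothed_region D d"
  assume disc: "seifert_disc D ?R C"
  have one: "C' = C" if "C' \<in> seifert_circles D" "meets_circle D ?R C'" for C'
    using disc that by (simp add: seifert_disc_def)
  have dR: "d \<in> ?R" using d by (simp add: smoothed_region_def)
  have "smoothed_adjacent D (opp D (r d)) d" using d by (simp add: smoothed_adjacent_def)
  then have "equivclp (smoothed_adjacent D) d (opp D (r d))"
    by (rule equivclp_sym[OF r_into_equivclp])
  then have rR: "opp D (r d) \<in> ?R" using d by (simp add: smoothed_region_def)
  have "orbit next_dart d = C"
  proof (rule one)
    show "orbit next_dart d \<in> seifert_circles D"
      unfolding seifert_circles_def by (rule imageI[OF d(2)])
    show "meets_circle D ?R (orbit next_dart d)"
      unfolding meets_circle_def by (rule bexI[where x = d]) (use dR circle_self[OF d(2)] in simp_all)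
  qed
  moreover have "orbit next_dart (r d) = C"
  proof (rule one)
    show "orbit next_dart (r d) \<in> seifert_circles D"
      unfolding seifert_circles_def by (rule imageI[OF d(3)])
    show "meets_circle D ?R (orbit next_dart (r d))"
      unfolding meets_circle_def by (rule bexI[where x = "r d"]) (use rR circle_self[OF d(3)] in simp_all)
  qed
  ultimately have rC: "r d \<in> orbit next_dart d" using circle_self[OF d(3)] by simp
  let ?S = "{x \<in> darts D. x \<in> orbit next_dart d \<or> opp D x \<in> orbit next_dart d}"
  obtain \<phi> where \<phi>: "separates D ?S \<phi>"
    using planar_D[unfolded planar_def, rule_format, OF even_cycle_circle[OF d(2)]] by (rule exE)
  \<comment> \<open>The colour to the left of the circle stays the same: a step either remains in
    one region of \<open>D\<close>, or crosses two darts of the circle, and then the two changes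
    cancel.\<close>
  have \<phi>_next: "\<phi> (next_dart y) = \<phi> y" if y: "y \<in> orbit next_dart d" for y
  proof -
    have yO: "y \<in> Out" using y circle_sub[OF d(2)] by blast
    then have yd: "y \<in> darts D" using Out_sub by blast
    show ?thesis
    proof (cases "r (opp D y) \<in> Out")
      case True
      then have n: "next_dart y = r (opp D y)" by (rule next_dart_left[OF yO])
      have "r (opp D y) \<in> orbit next_dart d"
        using circle_step[OF d(2) yO] y by (simp add: n)
      then have "r (opp D y) \<in> ?S" using yd by simp
      then have "\<phi> (r (opp D y)) \<noteq> \<phi> (opp D y)"
        using \<phi> yd by (simp add: separates_def)
      moreover have "\<phi> (opp D y) \<noteq> \<phi> y"
        using \<phi> yd y by (simp add: separates_def)
      ultimately show ?thesis unfolding n by blast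
    next
      case False
      then show ?thesis using next_dart_right[OF yO] separates_face[OF \<phi> yd] by simp
    qed
  qed
  have "\<phi> (r d) = \<phi> d" using rC
  proof induction
    case base
    show ?case by (rule \<phi>_next) (rule circle_self[OF d(2)])
  next
    case (step y)
    show ?case using \<phi>_next[OF step.hyps] step.IH by simp
  qed
  moreover have "r d \<in> ?S" using rC d(1) by simp
  then have "\<phi> (r d) \<noteq> \<phi> d" using \<phi> d(1) by (simp add: separates_def)
  ultimately show False by blast
qed

lemma smoothed_region_adjacent:
  assumes "smoothed_adjacent D x y"
  shows "smoothed_region D x = smoothed_region D y"
proof -
  have xy: "equivclp (smoothed_adjacent D) x y" using assms by (rule r_into_equivclp)
  then have "equivclp (smoothed_adjacent D) x z \<longleftrightarrow> equivclp (smoothed_adjacent D) y z" for z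
    using equivclp_sym equivclp_trans by metis
  then show ?thesis by (simp add: smoothed_region_def)
qed

lemma smoothed_region_face: "d \<in> darts D \<Longrightarrow> smoothed_region D (face_perm D d) = smoothed_region D d"
  by (rule smoothed_region_adjacent[symmetric]) (simp add: smoothed_adjacent_def)

lemma smoothed_region_opp_r: "d \<in> darts D \<Longrightarrow> smoothed_region D (opp D (r d)) = smoothed_region D d"
  using smoothed_region_face[of "opp D (r d)"] by simp

lemma smoothed_region_rr:
  "d \<in> darts D \<Longrightarrow> d \<in> Out \<longleftrightarrow> r d \<in> Out \<Longrightarrow> smoothed_region D (r (r d)) = smoothed_region D d"
  by (rule smoothed_region_adjacent[symmetric]) (simp add: smoothed_adjacent_def)

lemma black_imp:
  assumes "seifert_disc D (smoothed_region D d) C" "d \<in> darts D"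
  shows "d \<in> Out \<longleftrightarrow> r d \<notin> Out"
proof (rule ccontr)
  assume eq: "\<not> ?thesis"
  show False
  proof (cases "d \<in> Out")
    case True
    then show False using out_out_not_black[OF assms(2)] assms(1) eq by blast
  next
    case False
    then have "seifert_disc D (smoothed_region D (r (r d))) C"
      using smoothed_region_rr[OF assms(2)] assms(1) eq by simp
    then show False using out_out_not_black[of "r (r d)"] assms(2) False eq by simp
  qed
qed

text \<open>Past each crossing one side of the circle follows a region of \<open>D\<close>, and the
  other one runs through the gap opened by the smoothing. Hence a whole circle has just one smoothed
  region on its left and one on its right.\<close>

lemma circle_regions:
  assumes d: "d \<in> Out" and y: "y \<in> orbit next_dart d"
  shows "smoothed_region D y = smoothed_region D d
    \<and> smoothed_region D (opp D y) = smoothed_region D (opp D d)"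
proof -
  have step: "smoothed_region D (next_dart y) = smoothed_region D y
      \<and> smoothed_region D (opp D (next_dart y)) = smoothed_region D (opp D y)"
    if "y \<in> Out" for y
  proof -
    let ?x = "opp D y"
    have y: "y \<in> darts D" using that Out_sub by blast
    have x: "?x \<in> darts D" "?x \<notin> Out" using y that by simp_all
    have f: "face_perm D y = r (r (r ?x))" using face_eq[OF y] .
    show ?thesis
    proof (cases "r ?x \<in> Out")
      case True
      note n = next_dart_left[OF that True]
      have "face_perm D y \<notin> Out" using True x(1) by (simp add: f)
      then have "smoothed_region D (r (r (face_perm D y))) = smoothed_region D (face_perm D y)"
        using y x by (intro smoothed_region_rr) simp_all
      then have "smoothed_region D (r ?x) = smoothed_region D y"
        using smoothed_region_face[OF y] by simp
      then show ?thesis using smoothed_region_opp_r[OF x(1)] by (simp add: n)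
    next
      case False
      note n = next_dart_right[OF that False]
      have "smoothed_region D (opp D (r (r (r ?x)))) = smoothed_region D (r (r ?x))"
        using x(1) by (intro smoothed_region_opp_r) simp
      also have "\<dots> = smoothed_region D ?x"
        using x False by (intro smoothed_region_rr) simp_all
      finally show ?thesis using smoothed_region_face[OF y] by (simp add: n f)
    qed
  qed
  have "y \<in> Out \<and> smoothed_region D y = smoothed_region D d
    \<and> smoothed_region D (opp D y) = smoothed_region D (opp D d)"
    using y by induction (use step d next_dart_Out in simp_all)
  then show ?thesis by blast
qed

lemma circle_disc:
  assumes d: "d \<in> Out"
  obtains R where "seifert_disc D R (orbit next_dart d)"
    "R = smoothed_region D d \<or> R = smoothed_region D (opp D d)"
proof -
  have "orbit next_dart d \<in> seifert_circles D" using d by (simp add: seifert_circles_def)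
  then obtain R where R: "seifert_disc D R (orbit next_dart d)"
    using special by (auto simp: special_def)
  then obtain d0 where R0: "R = smoothed_region D d0" by (auto simp: seifert_disc_def)
  have reg: "R = smoothed_region D z" if "z \<in> R" for z
  proof -
    have "equivclp (smoothed_adjacent D) d0 z" using that by (simp add: R0 smoothed_region_def)
    then have "equivclp (smoothed_adjacent D) d0 x \<longleftrightarrow> equivclp (smoothed_adjacent D) z x" for x
      using equivclp_sym equivclp_trans by metis
    then show ?thesis by (simp add: R0 smoothed_region_def)
  qed
  obtain y where y: "y \<in> orbit next_dart d" "y \<in> R \<or> opp D y \<in> R"
    using R by (auto simp: seifert_disc_def meets_circle_def)
  then have "R = smoothed_region D d \<or> R = smoothed_region D (opp D d)"
    using reg circle_regions[OF d y(1)] by metis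
  then show ?thesis using R by (rule that[rotated])
qed

text \<open>Speciality puts a disc on one side of every circle. If \<open>d\<close> lies between an
  outgoing and an incoming dart, the corner on the other side of its outgoing dart lies between two
  outgoing darts; that side is no disc, so the side of \<open>d\<close> is.\<close>

lemma black_iff:
  assumes d: "d \<in> darts D"
  shows "d \<in> black_corners D \<longleftrightarrow> (d \<in> Out \<longleftrightarrow> r d \<notin> Out)"
proof
  assume "d \<in> black_corners D"
  then show "d \<in> Out \<longleftrightarrow> r d \<notin> Out" using black_imp d by (auto simp: black_corners_def)
next
  assume alt: "d \<in> Out \<longleftrightarrow> r d \<notin> Out"
  show "d \<in> black_corners D"
  proof (cases "d \<in> Out")
    case True
    obtain R where R: "seifert_disc D R (orbit next_dart d)"
      "R = smoothed_region D d \<or> R = smoothed_region D (opp D d)"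
      by (rule circle_disc[OF True])
    \<comment> \<open>This is the corner to the right of \<open>d\<close>, on the other side of the
      circle.\<close>
    let ?c = "r (r (r d))"
    have c: "?c \<in> darts D" "?c \<in> Out" "r ?c \<in> Out" using d alt True by simp_all
    have "smoothed_region D (opp D d) = smoothed_region D ?c"
      using smoothed_region_opp_r[OF c(1)] d by simp
    then have "R \<noteq> smoothed_region D (opp D d)"
      using out_out_not_black[OF c] R(1) by metis
    then show ?thesis using R d by (auto simp: black_corners_def)
  next
    case False
    then have rd: "r d \<in> Out" "r d \<in> darts D" using alt d by simp_all
    obtain R where R: "seifert_disc D R (orbit next_dart (r d))"
      "R = smoothed_region D (r d) \<or> R = smoothed_region D (opp D (r d))"
      by (rule circle_disc[OF rd(1)])
    have "R \<noteq> smoothed_region D (r d)"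
      using out_out_not_black[OF rd(2,1)] R(1) d False by auto
    then have "R = smoothed_region D d" using R(2) smoothed_region_opp_r[OF d] by simp
    then show ?thesis using R d by (auto simp: black_corners_def)
  qed
qed

abbreviation "K \<equiv> black_corners D"

lemma K_sub: "K \<subseteq> darts D"
  by (auto simp: black_corners_def)

lemma K_r: "d \<in> darts D \<Longrightarrow> r d \<in> K \<longleftrightarrow> d \<notin> K"
  by (simp add: black_iff) blast

lemma K_face: "d \<in> darts D \<Longrightarrow> face_perm D d \<in> K \<longleftrightarrow> d \<in> K"
  using smoothed_region_face by (simp add: black_corners_def)

lemma K_opp: "d \<in> darts D \<Longrightarrow> opp D d \<in> K \<longleftrightarrow> d \<notin> K"
  using K_r[of "face_perm D d"] K_face[of d] by simp

text \<open>The directions at a black corner differ, so the boundary of a black region is coherently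
  oriented. This makes the rotation direction a property of the vertex of the black graph.\<close>

lemma Out_face:
  assumes "d \<in> K"
  shows "face_perm D d \<in> Out \<longleftrightarrow> d \<in> Out"
proof -
  have d: "d \<in> darts D" using assms K_sub by blast
  then have "face_perm D d \<in> K" using K_face assms by simp
  then show ?thesis using d black_iff[of "face_perm D d"] by simp
qed

section \<open>Connectedness, planarity and bipartiteness of the black graph\<close>

abbreviation "B \<equiv> black_graph D"

lemma darts_B: "darts B = K"
  by (simp add: black_graph_def)

lemma opp_B: "d \<in> K \<Longrightarrow> opp B d = r (r d)"
  by (simp add: black_graph_def perm_restrict_def)

lemma rot_B: "d \<in> K \<Longrightarrow> rot B d = face_perm D d"
  by (simp add: black_graph_def perm_restrict_def)

lemma K_rr: "d \<in> K \<Longrightarrow> r (r d) \<in> K"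
  using K_sub K_r[of d] K_r[of "r d"] by auto

lemma dart_map_B: "dart_map B"
proof
  have fin: "finite K" by (rule finite_subset[OF K_sub finite_darts])
  show "finite (darts B)" using fin by (simp add: darts_B)
  have perm: "perm_restrict g K permutes K" if "inj_on g K" "g ` K \<subseteq> K" for g
  proof (rule bij_imp_permutes)
    have "g ` K = K" using that fin by (intro endo_inj_surj)
    then have "bij_betw g K K" using that by (simp add: bij_betw_def)
    then show "bij_betw (perm_restrict g K) K K"
      by (rule bij_betw_cong[THEN iffD1, rotated]) (simp add: perm_restrict_def)
  qed (simp add: perm_restrict_def)
  show "opp B permutes darts B"
    unfolding darts_B using K_rr
    by (simp add: black_graph_def) (intro perm; auto simp: inj_on_def)
  have "inj (face_perm D)" using permutes_inj[OF face_permutes] .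
  then have "inj_on (face_perm D) K" using inj_on_subset by blast
  then show "rot B permutes darts B"
    unfolding darts_B using K_face K_sub
    by (simp add: black_graph_def) (intro perm; auto)
  fix d assume "d \<in> darts B"
  then have d: "d \<in> K" "d \<in> darts D" using K_sub by (auto simp: darts_B)
  show "opp B d \<noteq> d" using d rr_neq by (simp add: opp_B)
  show "opp B (opp B d) = d" using d K_rr by (simp add: opp_B)
qed

lemma linked_B: "linked B"
  unfolding linked_def
proof (intro allI impI ballI)
  fix f :: "nat \<Rightarrow> bool" and x y
  assume f: "\<forall>d\<in>darts B. f (opp B d) = f d \<and> f (rot B d) = f d"
    and x: "x \<in> darts B" and y: "y \<in> darts B"
  have f_rr: "f (r (r d)) = f d" and f_face: "f (face_perm D d) = f d" if "d \<in> K" for d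
    using f[rule_format, of d] that by (simp_all add: darts_B opp_B rot_B)
  \<comment> \<open>A white corner takes the value of the next corner counterclockwise at its
    crossing, which is black.\<close>
  define g where "g d = f (if d \<in> K then d else r d)" for d
  have opp_f: "f (r (opp D d)) = f d" if "d \<in> K" for d
    using f_rr[of "face_perm D d"] f_face[OF that] that K_face K_sub by auto
  have "g (opp D d) = g d \<and> g (r d) = g d" if d: "d \<in> darts D" for d
  proof
    show "g (opp D d) = g d"
    proof (cases "d \<in> K")
      case True
      then show ?thesis using K_opp[OF d] opp_f by (simp add: g_def)
    next
      case False
      then show ?thesis using K_opp[OF d] opp_f[of "opp D d"] by (simp add: g_def)
    qed
    show "g (r d) = g d"
      using K_r[OF d] f_rr[of d] by (simp add: g_def)
  qed
  from linkedD[OF linked_D this, of x y] show "f x = f y"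
    using x y K_sub by (auto simp: darts_B g_def)
qed

lemma planar_B: "planar B"
  unfolding planar_def
proof (intro allI impI)
  interpret B: dart_map B by (rule dart_map_B)
  fix S assume S: "even_cycle B S"
  have SK: "S \<subseteq> K" using S by (simp add: even_cycle_def darts_B)
  have S_rr: "r (r d) \<in> S \<longleftrightarrow> d \<in> S" if "d \<in> K" for d
    using S that by (simp add: even_cycle_def darts_B opp_B)
  have "even (card (S \<inter> orbit (rot B) x))" for x
  proof (cases "x \<in> K")
    case True
    then show ?thesis using S by (simp add: even_cycle_def darts_B)
  next
    case False
    then have "rot B x = x" using B.rot_permutes by (simp add: darts_B permutes_not_in)
    then have "orbit (rot B) x = {x}" by (simp add: orbit_eq_singleton_iff)
    then have "S \<inter> orbit (rot B) x = {}" using False SK by auto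
    then show ?thesis by simp
  qed
  moreover have "finite S" using SK K_sub finite_darts by (meson finite_subset)
  ultimately obtain \<kappa> where "\<forall>y. \<kappa> (rot B y) \<noteq> (\<kappa> y :: bool) \<longleftrightarrow> rot B y \<in> S"
    using orbit_parity_function[OF B.rot_permutes B.finite_darts] by metis
  then have \<kappa>: "\<kappa> (face_perm D d) \<noteq> \<kappa> d \<longleftrightarrow> face_perm D d \<in> S" if "d \<in> K" for d
    using rot_B[OF that] by metis
  have \<kappa>_r: "\<kappa> d \<noteq> \<kappa> (opp D (r d)) \<longleftrightarrow> d \<in> S" if "d \<in> K" for d
  proof -
    have d: "d \<in> darts D" using that K_sub by blast
    have "opp D (r d) \<in> K" using K_opp[of "r d"] K_r[OF d] that d by simp
    from \<kappa>[OF this] show ?thesis by simp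
  qed
  \<comment> \<open>The cycle \<open>S\<close> of the black graph is pushed off the black vertices, to those edges of \<open>D\<close>
    on the boundary of black regions that satisfy \<open>\<kappa>\<close>.\<close>
  define S' where "S' = {x \<in> darts D. \<kappa> (if x \<in> K then x else opp D x)}"
  have "even_cycle D S'"
    unfolding even_cycle_def
  proof (intro conjI ballI)
    show "S' \<subseteq> darts D" by (auto simp: S'_def)
    fix d assume d: "d \<in> darts D"
    show "opp D d \<in> S' \<longleftrightarrow> d \<in> S'" using d K_opp[OF d] by (simp add: S'_def)
    obtain b where b: "b \<in> K" "orbit r b = orbit r d"
    proof (cases "d \<in> K")
      case True
      then show ?thesis by (rule that) simp
    next
      case False
      then have "r d \<in> K" using K_r[OF d] by simp
      then show ?thesis by (rule that) simp
    qed
    have bd: "b \<in> darts D" using b(1) K_sub by blast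
    have 1: "b \<in> S' \<longleftrightarrow> \<kappa> b" "r b \<in> S' \<longleftrightarrow> \<kappa> (opp D (r b))" "r (r b) \<in> S' \<longleftrightarrow> \<kappa> (r (r b))"
      "r (r (r b)) \<in> S' \<longleftrightarrow> \<kappa> (opp D (r (r (r b))))"
      using b(1) bd K_r[of b] K_r[of "r b"] K_r[of "r (r b)"] by (simp_all add: S'_def)
    have 2: "(b \<in> S') \<noteq> (r b \<in> S') \<longleftrightarrow> (r (r b) \<in> S') \<noteq> (r (r (r b)) \<in> S')"
      unfolding 1 using \<kappa>_r[OF b(1)] \<kappa>_r[OF K_rr[OF b(1)]] S_rr[OF b(1)] by blast
    have ne: "b \<noteq> r b" "b \<noteq> r (r b)" "b \<noteq> r (r (r b))"
      using r_neq[OF bd] rr_neq[OF bd] rrr_neq[OF bd] by metis+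
    show "even (card (S' \<inter> orbit r d))"
      unfolding b(2)[symmetric] orbit_r[OF bd] using 2 ne
      by (cases "b \<in> S'"; cases "r b \<in> S'"; cases "r (r b) \<in> S'"; cases "r (r (r b)) \<in> S'")
        simp_all
  qed
  then obtain \<phi> where \<phi>: "separates D S' \<phi>" using planar_D by (auto simp: planar_def)
  \<comment> \<open>The corner \<open>d\<close> of the black graph sits at the edge of
    \<open>D\<close> that joins the crossings of \<open>d\<close> and \<open>face_perm D d\<close>.
    Its region is the white one beyond that edge, whence the colour of
    \<open>opp D d\<close>.\<close>
  have "separates B S (\<lambda>d. \<phi> (opp D d))"
    unfolding separates_def darts_B
  proof (intro ballI conjI)
    fix d assume dK: "d \<in> K"
    then have d: "d \<in> darts D" using K_sub by blast
    have opp: "\<phi> (opp D d) \<noteq> \<phi> d \<longleftrightarrow> \<kappa> d"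
      using \<phi> d dK by (simp add: separates_def S'_def)
    have "\<phi> (face_perm D (opp D (r (r d)))) = \<phi> (opp D (r (r d)))"
      by (rule separates_face[OF \<phi>]) (use d in simp)
    then have "\<phi> (opp D (r (r d))) = \<phi> (r d)" by simp
    moreover have "\<phi> (r d) \<noteq> \<phi> d \<longleftrightarrow> \<kappa> (opp D (r d))"
      using \<phi> d dK K_r[OF d] by (simp add: separates_def S'_def)
    ultimately show "\<phi> (opp D (opp B d)) \<noteq> \<phi> (opp D d) \<longleftrightarrow> d \<in> S"
      using opp \<kappa>_r[OF dK] unfolding opp_B[OF dK] by blast
    have fK: "face_perm D d \<in> K" using K_face[OF d] dK by simp
    have "\<phi> (opp D (face_perm D d)) \<noteq> \<phi> (face_perm D d) \<longleftrightarrow> \<kappa> (face_perm D d)"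
      using \<phi> d fK by (simp add: separates_def S'_def)
    then show "\<phi> (opp D (rot B d)) \<noteq> \<phi> (opp D d) \<longleftrightarrow> rot B d \<in> S"
      using opp \<kappa>[OF dK] separates_face[OF \<phi> d] unfolding rot_B[OF dK] by blast
  qed
  then show "\<exists>\<phi>. separates B S \<phi>" by (rule exI[of _ "\<lambda>d. \<phi> (opp D d)"])
qed

lemma spherical_B: "spherical B"
proof -
  have "(opp B d \<in> ccw B \<longleftrightarrow> d \<notin> ccw B) \<and> (rot B d \<in> ccw B \<longleftrightarrow> d \<in> ccw B)" if "d \<in> darts B" for d
  proof -
    have d: "d \<in> K" "d \<in> darts D" using that K_sub by (auto simp: darts_B)
    have "ccw B = Out \<inter> K" by (simp add: black_graph_def)
    then show ?thesis
      using d K_rr[OF d(1)] Out_face[OF d(1)] K_face[OF d(2)] by (simp add: opp_B rot_B)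
  qed
  then show ?thesis
    using dart_map_B linked_B planar_B by (auto simp: spherical_def black_graph_def)
qed

end

lemma spherical_black_graph:
  assumes "link_diagram D" "special D"
  shows "spherical (black_graph D)"
proof -
  interpret special_diagram D
    using assms planar_connected_sphere_map(1)[of D]
    by (simp add: special_diagram_def special_diagram_axioms_def link_diagram_def)
  show ?thesis by (rule spherical_B)
qed

section \<open>Regions of a single theta-graph\<close>

lemma orbit_enumeration:
  assumes f: "f permutes X" "finite X" and N: "card (orbit f x) = N"
  shows "bij_betw (\<lambda>i. (f ^^ i) x) {..<N} (orbit f x)" "(f ^^ N) x = x"
proof -
  let ?P = "\<lambda>k. 0 < k \<and> (f ^^ k) x = x"
  define p where "p = (LEAST k. ?P k)"
  obtain k where "0 < k" "x = (f ^^ k) x"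
    using orbit_self[OF f, of x] unfolding orbit_altdef by blast
  then have "?P k" by simp
  then have p: "?P p" unfolding p_def by (rule LeastI)
  have min: "\<not> ?P k" if "k < p" for k
    using not_less_Least[of k ?P] that unfolding p_def by blast
  have neq: "(f ^^ i) x \<noteq> (f ^^ j) x" if ij: "i < j" "j < p" for i j
  proof
    assume eq: "(f ^^ i) x = (f ^^ j) x"
    have "(f ^^ j) x = (f ^^ i) ((f ^^ (j - i)) x)"
      using ij(1) by (metis comp_apply funpow_add le_add_diff_inverse less_imp_le)
    then have "(f ^^ (j - i)) x = x"
      using eq permutes_inj[OF f(1)] by (metis inj_fn injD)
    moreover have "0 < j - i" "j - i < p" using ij by linarith+
    ultimately show False using min[of "j - i"] by blast
  qed
  have inj: "inj_on (\<lambda>i. (f ^^ i) x) {..<p}"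
  proof (rule inj_onI)
    fix i j assume "i \<in> {..<p}" "j \<in> {..<p}" and eq: "(f ^^ i) x = (f ^^ j) x"
    then show "i = j" using neq[of i j] neq[of j i] by (metis lessThan_iff nat_neq_iff)
  qed
  have orb: "orbit f x = (\<lambda>i. (f ^^ i) x) ` {..<p}"
    using orbit_altdef_bounded[of p f x] p by auto
  then have "p = N" using N card_image[OF inj] by simp
  then show "bij_betw (\<lambda>i. (f ^^ i) x) {..<N} (orbit f x)" "(f ^^ N) x = x"
    using inj orb p by (simp_all add: bij_betw_def)
qed

lemma separates_iff:
  assumes "separates M S \<phi>" "d \<in> darts M"
  shows "\<phi> (opp M d) = \<phi> d \<longleftrightarrow> d \<notin> S" "\<phi> (rot M d) = \<phi> d \<longleftrightarrow> rot M d \<notin> S"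
  using assms unfolding separates_def by blast+

lemma equivclp_invariant:
  assumes "equivclp R x y" "\<And>x y. R x y \<Longrightarrow> f x = f y"
  shows "f x = f y"
  using assms(1)
proof (induction rule: equivclp_induct)
  case (step y z)
  from step(2) have "f y = f z" using assms(2)[of y z] assms(2)[of z y] by (elim disjE) simp_all
  with step(3) show ?case by simp
qed simp

text \<open>The names \<open>u\<close> and \<open>v\<close> are chosen such that the rotation at
  \<open>u\<close> is counterclockwise. Seen from \<open>u\<close>, the positive side of every edge
  is then its left side.\<close>

locale single_theta = dart_map G for G :: weighted_map +
  fixes T :: "nat set set" and u v :: "nat set"
  assumes G: "spherical G" and T: "theta_graphs G = {T}"
    and T_uv: "T = joining_edges G u v" and uv: "u \<noteq> v"
    and card_T: "card T \<ge> 2"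
    and ccw_u: "d \<in> darts G \<Longrightarrow> dart_vertex G d = u \<Longrightarrow> d \<in> ccw G"
begin

lemma linked_G: "linked G" and planar_G: "planar G"
  using G by (auto simp: spherical_def)

lemma ccw_opp: "d \<in> darts G \<Longrightarrow> opp G d \<in> ccw G \<longleftrightarrow> d \<notin> ccw G"
  using G by (simp add: spherical_def)

text \<open>The darts at \<open>u\<close> represent the edges of the theta-graph, one each because
  \<open>u\<close> and \<open>v\<close> differ. They will also represent the regions:
  \<open>t\<close> stands for the sector to its left.\<close>

definition P where "P = {d \<in> darts G. dart_vertex G d = u \<and> dart_vertex G (opp G d) = v}"

definition Q where "Q = P \<union> opp G ` P"

lemma T_P: "T = dart_edge G ` P"
  by (simp add: T_uv joining_edges_def P_def)

lemma P_darts: "t \<in> P \<Longrightarrow> t \<in> darts G"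
  and P_u: "t \<in> P \<Longrightarrow> orbit (rot G) t = u"
  and P_v: "t \<in> P \<Longrightarrow> orbit (rot G) (opp G t) = v"
  by (auto simp: P_def dart_vertex_def)

lemma Union_T: "\<Union>T = Q"
  unfolding T_P Q_def dart_edge_def by blast

lemma Q_darts: "Q \<subseteq> darts G"
  using P_darts by (auto simp: Q_def)

lemma opp_P: "t \<in> P \<Longrightarrow> opp G t \<notin> P"
  using P_u P_v uv by metis

lemma Q_opp: "opp G d \<in> Q \<longleftrightarrow> d \<in> Q"
proof -
  have "x \<in> opp G ` P \<longleftrightarrow> opp G x \<in> P" for x
  proof
    assume "opp G x \<in> P"
    then have "opp G (opp G x) \<in> opp G ` P" by (rule imageI)
    then show "x \<in> opp G ` P" by simp
  qed auto
  then show ?thesis by (simp add: Q_def disj_commute)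
qed

lemma inj_dart_edge: "inj_on (dart_edge G) P"
proof (rule inj_onI)
  fix s t assume st: "s \<in> P" "t \<in> P" "dart_edge G s = dart_edge G t"
  then have "s = t \<or> s = opp G t" by (auto simp: dart_edge_def)
  then show "s = t" using opp_P st by blast
qed

lemma card_P: "card P = card T"
  unfolding T_P using card_image[OF inj_dart_edge] by simp

lemma theta_edges_eq: "theta_edges G = T"
  by (simp add: theta_edges_def T)

lemma dart_edge_in_T: "dart_edge G d \<in> T \<longleftrightarrow> d \<in> Q"
proof
  assume "dart_edge G d \<in> T"
  then show "d \<in> Q" unfolding Union_T[symmetric] by (auto simp: dart_edge_def)
next
  assume "d \<in> Q"
  then consider "d \<in> P" | t where "t \<in> P" "d = opp G t" by (auto simp: Q_def)
  then show "dart_edge G d \<in> T"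
  proof cases
    case 2
    then have "dart_edge G d = dart_edge G t" by (auto simp: dart_edge_def)
    then show ?thesis using 2 by (simp add: T_P)
  qed (simp add: T_P)
qed

lemma P_nonempty: "P \<noteq> {}"
  using card_T card_P by auto

lemma Q_u: "x \<in> Q \<Longrightarrow> orbit (rot G) x = u \<Longrightarrow> x \<in> P"
  unfolding Q_def using P_v uv by blast

lemma Q_v: "x \<in> Q \<Longrightarrow> orbit (rot G) x = v \<Longrightarrow> opp G x \<in> P"
  unfolding Q_def using P_u uv by auto

abbreviation "ret \<equiv> first_return (rot G) Q"

lemma ret_steps:
  assumes "y \<in> Q" "y \<in> orbit (rot G) x"
  obtains k where "ret x = rot G ((rot G ^^ k) x)" "ret x \<in> Q"
    "\<forall>j. 0 < j \<longrightarrow> j \<le> k \<longrightarrow> (rot G ^^ j) x \<notin> Q"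
proof -
  obtain k where k: "0 < k" "ret x = (rot G ^^ k) x" "(rot G ^^ k) x \<in> Q"
    "\<forall>j. 0 < j \<longrightarrow> j < k \<longrightarrow> (rot G ^^ j) x \<notin> Q"
    by (rule first_returnE[OF rot_permutes finite_darts assms])
  show ?thesis
  proof (rule that[of "k - 1"])
    show "ret x = rot G ((rot G ^^ (k - 1)) x)" using k(1,2) by (cases k) simp_all
    show "ret x \<in> Q" using k(2,3) by simp
    show "\<forall>j. 0 < j \<longrightarrow> j \<le> k - 1 \<longrightarrow> (rot G ^^ j) x \<notin> Q"
    proof (intro allI impI)
      fix j assume "0 < j" "j \<le> k - 1"
      then show "(rot G ^^ j) x \<notin> Q" using k(4)[rule_format, of j] k(1) by linarith
    qed
  qed
qed

lemma ret_in:
  assumes "y \<in> Q" "y \<in> orbit (rot G) x"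
  shows "ret x \<in> Q" "orbit (rot G) (ret x) = orbit (rot G) x"
proof -
  obtain k where k: "ret x = rot G ((rot G ^^ k) x)" "ret x \<in> Q"
    "\<forall>j. 0 < j \<longrightarrow> j \<le> k \<longrightarrow> (rot G ^^ j) x \<notin> Q"
    by (rule ret_steps[OF assms])
  show "ret x \<in> Q" by fact
  have "(rot G ^^ k) x \<in> orbit (rot G) x" by (rule funpow_in_orbit) simp
  then have "ret x \<in> orbit (rot G) x" unfolding k(1) by simp
  then show "orbit (rot G) (ret x) = orbit (rot G) x" by (rule rot_orbit_eq)
qed

lemma ret_u:
  assumes "orbit (rot G) x = u"
  shows "ret x \<in> P"
proof -
  obtain t where t: "t \<in> P" using P_nonempty by blast
  then have "t \<in> Q" "t \<in> orbit (rot G) x"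
    using rot_orbit_self[of t] P_u[OF t] assms by (auto simp: Q_def)
  from ret_in[OF this] show ?thesis using Q_u assms by simp
qed

lemma ret_v:
  assumes "orbit (rot G) x = v"
  shows "opp G (ret x) \<in> P"
proof -
  obtain t where t: "t \<in> P" using P_nonempty by blast
  then have "opp G t \<in> Q" "opp G t \<in> orbit (rot G) x"
    using rot_orbit_self[of "opp G t"] P_v[OF t] assms by (auto simp: Q_def)
  from ret_in[OF this] show ?thesis using Q_v assms by simp
qed

lemma ret_face: "d \<in> Q \<Longrightarrow> ret (face_perm G d) = opp G d"
  using first_return_1[of "rot G" "face_perm G d" Q] Q_opp[of d] by simp

text \<open>The cyclic order of the theta-edges, around \<open>u\<close> on \<open>P\<close> and
  around \<open>v\<close> on the opposite darts.\<close>

definition g where "g = perm_restrict ret Q"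

lemma g_permutes: "g permutes Q"
  unfolding g_def by (rule first_return_permutes[OF rot_permutes finite_darts Q_darts])

lemma finite_Q: "finite Q"
  by (rule finite_subset[OF Q_darts finite_darts])

lemma g_inj: "g x = g y \<longleftrightarrow> x = y"
  using permutes_inj[OF g_permutes] by (auto dest: injD)

lemma orbit_g:
  assumes t: "t \<in> P"
  shows "orbit g t = P"
proof -
  have "t \<in> Q" using t by (simp add: Q_def)
  then have "orbit g t = u \<inter> Q"
    unfolding g_def using orbit_first_return[OF rot_permutes finite_darts Q_darts] P_u[OF t] by simp
  also have "\<dots> = P"
  proof
    show "u \<inter> Q \<subseteq> P"
    proof
      fix x assume x: "x \<in> u \<inter> Q"
      then have "x \<in> orbit (rot G) t" using P_u[OF t] by simp
      then have "orbit (rot G) x = u" using rot_orbit_eq[of x t] P_u[OF t] by simp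
      then show "x \<in> P" using Q_u x by blast
    qed
    show "P \<subseteq> u \<inter> Q"
    proof
      fix x assume "x \<in> P"
      then show "x \<in> u \<inter> Q" using P_u[of x] rot_orbit_self[of x] by (simp add: Q_def)
    qed
  qed
  finally show ?thesis .
qed

lemma g_P: "t \<in> P \<Longrightarrow> g t \<in> P"
  using orbit_g orbit.base[of g t] by simp

lemma g_ret: "t \<in> P \<Longrightarrow> g t = ret t"
  by (simp add: g_def perm_restrict_def Q_def)

lemma g_surj:
  assumes "q \<in> P"
  obtains t where "t \<in> P" "g t = q"
proof -
  have "q \<in> g ` orbit g q"
    using bij_betw_orbit[OF g_permutes finite_Q, of q] orbit_self[OF g_permutes finite_Q, of q]
    by (simp add: bij_betw_def)
  then show ?thesis using that orbit_g[OF assms] by auto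
qed

lemma g_neq:
  assumes "t \<in> P"
  shows "g t \<noteq> t"
proof
  assume "g t = t"
  then have "P = {t}" using orbit_g[OF assms] orbit_eq_singleton_iff[of g t] by simp
  then show False using card_T card_P by simp
qed

section \<open>Sectors between consecutive theta-edges as regions\<close>

abbreviation "E \<equiv> equivclp (theta_adjacent G)"

lemma E_sym: "E x y \<Longrightarrow> E y x"
  by (rule equivclp_sym)

lemma E_trans: "E x y \<Longrightarrow> E y z \<Longrightarrow> E x z"
  by (rule equivclp_trans)

lemma E_face: "d \<in> darts G \<Longrightarrow> E d (face_perm G d)"
  by (rule r_into_equivclp) (simp add: theta_adjacent_def)

lemma E_sector:
  assumes "d \<in> darts G" "d' \<in> orbit (rot G) d"
    "Q \<inter> orbit (rot G) d \<noteq> {} \<Longrightarrow> ret d = ret d'"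
  shows "E d d'"
  by (rule r_into_equivclp)
    (use assms in \<open>auto simp: theta_adjacent_def T Union_T dart_vertex_def\<close>)

lemma E_u:
  assumes x: "x \<in> darts G" "orbit (rot G) x = u" and t: "t \<in> P" "g t = ret x"
  shows "E x t"
proof (rule E_sector[OF x(1)])
  show "t \<in> orbit (rot G) x" using P_u[OF t(1)] x(2) rot_orbit_self[of t] by simp
  show "ret x = ret t" using g_ret[OF t(1)] t(2) by simp
qed

text \<open>The region to the left of \<open>opp G (g t)\<close> reaches \<open>u\<close> at the
  corner just before \<open>g t\<close>, which lies in the sector after \<open>t\<close>. So
  \<open>t\<close> and \<open>g t\<close> border the same region, \<open>t\<close> with its left and
  \<open>g t\<close> with its right side.\<close>

lemma E_opp:
  assumes t: "t \<in> P"
  shows "E t (opp G (g t))"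
proof -
  let ?q = "g t"
  have q: "?q \<in> P" using g_P[OF t] .
  then have oq: "opp G ?q \<in> Q" "opp G ?q \<in> darts G" using P_darts by (auto simp: Q_def)
  let ?x = "face_perm G (opp G ?q)"
  have x: "?x \<in> darts G" "rot G ?x = ?q" using oq by simp_all
  have "orbit (rot G) ?x = u" using orbit_rot_step[of ?x] P_u[OF q] unfolding x(2) by simp
  moreover have "g t = ret ?x" using ret_face[OF oq(1)] by simp
  ultimately have "E ?x t" using E_u x(1) t by blast
  then show ?thesis using E_face[OF oq(2)] E_sym E_trans by blast
qed

text \<open>From \<open>u\<close> one turns back to the preceding theta-dart; from \<open>v\<close>
  one follows the boundary of a region to \<open>u\<close>. Everywhere else turning and crossing are
  free, as no theta-edge is met, so connectedness yields the claim for all corners.\<close>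

lemma E_P:
  assumes "d \<in> darts G"
  shows "\<exists>t\<in>P. E d t"
proof -
  have at_u: "\<exists>t\<in>P. E x t" if x: "x \<in> darts G" "orbit (rot G) x = u" for x
  proof -
    obtain t where t: "t \<in> P" "g t = ret x" by (rule g_surj[OF ret_u[OF x(2)]])
    from E_u[OF x t] show ?thesis using t(1) by blast
  qed
  have at_v: "\<exists>t\<in>P. E x t" if x: "x \<in> darts G" "orbit (rot G) x = v" for x
  proof -
    let ?t = "opp G (ret x)"
    have t: "?t \<in> P" by (rule ret_v[OF x(2)])
    then have td: "?t \<in> darts G" "?t \<in> Q" unfolding Q_def by (rule P_darts, rule UnI1)
    have "E x (face_perm G ?t)"
    proof (rule E_sector[OF x(1)])
      have "rot G (face_perm G ?t) = ret x" by simp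
      moreover have "ret x \<in> orbit (rot G) x"
        using P_v[OF t] x(2) rot_orbit_self[of "ret x"] by simp
      ultimately show "face_perm G ?t \<in> orbit (rot G) x"
        using rot_orbit_step[of "face_perm G ?t" x] by simp
      show "ret x = ret (face_perm G ?t)" using ret_face[OF td(2)] by simp
    qed
    moreover have "E (face_perm G ?t) ?t" by (rule E_sym[OF E_face[OF td(1)]])
    ultimately have "E x ?t" by (rule E_trans)
    then show ?thesis using t by blast
  qed
  define f where "f x \<longleftrightarrow> (\<exists>t\<in>P. E x t)" for x
  have f_uv: "f x" if "x \<in> darts G" "orbit (rot G) x = u \<or> orbit (rot G) x = v" for x
    using at_u at_v that unfolding f_def by blast
  have f_E: "f x = f y" if "E x y" for x y
  proof -
    have "E x t \<longleftrightarrow> E y t" for t using that E_sym E_trans by blast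
    then show ?thesis unfolding f_def by simp
  qed
  have "f (opp G x) = f x \<and> f (rot G x) = f x" if x: "x \<in> darts G" for x
  proof
    show "f (opp G x) = f x"
    proof (cases "x \<in> Q")
      case True
      then have "orbit (rot G) x = u \<or> orbit (rot G) x = v"
        "orbit (rot G) (opp G x) = u \<or> orbit (rot G) (opp G x) = v"
        unfolding Q_def using P_u P_v by auto
      then show ?thesis using f_uv x by simp
    next
      case False
      have "E x (opp G x)"
        by (rule r_into_equivclp)
          (use x False dart_edge_in_T[of x] in \<open>simp add: theta_adjacent_def theta_edges_eq\<close>)
      then show ?thesis using f_E by simp
    qed
    show "f (rot G x) = f x"
    proof (cases "orbit (rot G) x = u \<or> orbit (rot G) x = v")
      case True
      then show ?thesis using f_uv x by simp
    next
      case False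
      have "E x (rot G x)"
      proof (rule E_sector[OF x])
        assume "Q \<inter> orbit (rot G) x \<noteq> {}"
        then obtain q where q: "q \<in> Q" "q \<in> orbit (rot G) x" by blast
        then have "orbit (rot G) q = orbit (rot G) x" by (intro rot_orbit_eq)
        moreover have "orbit (rot G) q = u \<or> orbit (rot G) q = v"
          using q(1) unfolding Q_def using P_u P_v by auto
        ultimately show "ret x = ret (rot G x)" using False by simp
      qed simp
      then show ?thesis using f_E by simp
    qed
  qed
  note inv = this
  obtain t where t: "t \<in> P" using P_nonempty by blast
  have "f t" using f_uv P_darts[OF t] P_u[OF t] by simp
  moreover have "f d = f t" by (rule linkedD[OF linked_G inv assms P_darts[OF t]])
  ultimately show ?thesis unfolding f_def by simp
qed

text \<open>Up to the next theta-dart the colour around a vertex cannot change. The corner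
  \<open>face_perm G (opp G (ret x))\<close> is the last one before that dart, so the colour depends
  on the sector only.\<close>

lemma separates_ret:
  assumes \<phi>: "separates G S \<phi>" and S: "S \<subseteq> Q" and x: "x \<in> darts G"
    and y: "y \<in> Q" "y \<in> orbit (rot G) x"
  shows "\<phi> (face_perm G (opp G (ret x))) = \<phi> x" "\<phi> (ret x) \<noteq> \<phi> x \<longleftrightarrow> ret x \<in> S"
proof -
  obtain k where k: "ret x = rot G ((rot G ^^ k) x)" "ret x \<in> Q"
    "\<forall>j. 0 < j \<longrightarrow> j \<le> k \<longrightarrow> (rot G ^^ j) x \<notin> Q"
    by (rule ret_steps[OF y])
  have d: "(rot G ^^ j) x \<in> darts G" for j by (induction j) (use x in auto)
  have "\<phi> ((rot G ^^ j) x) = \<phi> x" if "j \<le> k" for j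
    using that
  proof (induction j)
    case (Suc j)
    then have "(rot G ^^ Suc j) x \<notin> S" using k(3)[rule_format, of "Suc j"] S by blast
    then show ?case using separates_iff(2)[OF \<phi> d[of j]] Suc by simp
  qed simp
  then have pre: "\<phi> ((rot G ^^ k) x) = \<phi> x" by simp
  then show "\<phi> (face_perm G (opp G (ret x))) = \<phi> x" by (simp add: k(1))
  show "\<phi> (ret x) \<noteq> \<phi> x \<longleftrightarrow> ret x \<in> S"
    using separates_iff(2)[OF \<phi> d[of k]] pre unfolding k(1) by simp
qed

text \<open>This provides the invariants that tell regions apart: cycles made of theta-edges have
  colourings that are constant on the regions of the theta-graph.\<close>

lemma separates_E:
  assumes \<phi>: "separates G S \<phi>" and S: "S \<subseteq> Q" and E: "E x y"
  shows "\<phi> x = \<phi> y"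
  using E
proof (rule equivclp_invariant)
  fix x y assume adj: "theta_adjacent G x y"
  then have x: "x \<in> darts G" by (simp add: theta_adjacent_def)
  consider "y = face_perm G x" | "dart_edge G x \<notin> T" "y = opp G x"
    | "y \<in> orbit (rot G) x" "Q \<inter> orbit (rot G) x \<noteq> {} \<longrightarrow> ret x = ret y"
    using adj by (auto simp: theta_adjacent_def theta_edges_eq T Union_T dart_vertex_def)
  then show "\<phi> x = \<phi> y"
  proof cases
    case 1
    then show ?thesis using separates_face[OF \<phi> x] by simp
  next
    case 2
    then have "x \<notin> S" using dart_edge_in_T[of x] S by blast
    then show ?thesis using separates_iff(1)[OF \<phi> x] 2 by simp
  next
    case 3
    have yd: "y \<in> darts G" using 3(1) rot_orbit_subset[OF x] by blast
    have yx: "orbit (rot G) y = orbit (rot G) x" using 3(1) by (rule rot_orbit_eq)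
    show ?thesis
    proof (cases "Q \<inter> orbit (rot G) x = {}")
      case False
      then obtain q where q: "q \<in> Q" "q \<in> orbit (rot G) x" by blast
      have "\<phi> (face_perm G (opp G (ret x))) = \<phi> x"
        by (rule separates_ret(1)[OF \<phi> S x q])
      moreover have "\<phi> (face_perm G (opp G (ret y))) = \<phi> y"
        by (rule separates_ret(1)[OF \<phi> S yd q(1)]) (use q yx in simp)
      ultimately show ?thesis using 3(2) False by simp
    next
      case True
      have "\<phi> z = \<phi> x \<and> z \<in> darts G" if "z \<in> orbit (rot G) x" for z
        using that
      proof induction
        case base
        have "rot G x \<notin> S" using True S rot_orbit_step[of x x] by auto
        then show ?case using separates_iff(2)[OF \<phi> x] x by simp
      next
        case (step z)
        have "rot G z \<notin> S" using True S step(1) rot_orbit_step[of z x] by auto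
        then show ?case using separates_iff(2)[OF \<phi>, of z] step(2) by simp
      qed
      from this[OF 3(1)] show ?thesis by simp
    qed
  qed
qed

lemma even_cycle_pair:
  assumes "a \<in> P" "b \<in> P" "a \<noteq> b"
  shows "even_cycle G {a, opp G a, b, opp G b}" (is "even_cycle G ?S")
  unfolding even_cycle_def
proof (intro conjI ballI)
  note ad = P_darts[OF assms(1)] and bd = P_darts[OF assms(2)]
  show "?S \<subseteq> darts G" using ad bd by simp
  fix d assume d: "d \<in> darts G"
  show "opp G d \<in> ?S \<longleftrightarrow> d \<in> ?S" by (auto simp: opp_inj)
  have "a \<in> orbit (rot G) d \<longleftrightarrow> orbit (rot G) d = u" "b \<in> orbit (rot G) d \<longleftrightarrow> orbit (rot G) d = u"
    "opp G a \<in> orbit (rot G) d \<longleftrightarrow> orbit (rot G) d = v"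
    "opp G b \<in> orbit (rot G) d \<longleftrightarrow> orbit (rot G) d = v"
    unfolding mem_rot_orbit_iff P_u[OF assms(1)] P_u[OF assms(2)] P_v[OF assms(1)] P_v[OF assms(2)]
    by (rule refl)+
  moreover have "opp G a \<noteq> opp G b" using assms(3) by simp
  ultimately show "even (card (?S \<inter> orbit (rot G) d))"
    using assms(3) uv
    by (cases "orbit (rot G) d = u"; cases "orbit (rot G) d = v") (simp_all add: Int_insert_left)
qed

text \<open>The edges of \<open>g s\<close> and \<open>g t\<close> form a closed curve. Around
  \<open>u\<close> its colouring jumps exactly at these two darts, just like the arc
  \<open>I\<close> between them, so the colouring and \<open>I\<close> agree up to a constant. Hence
  the colours of \<open>g s\<close> and \<open>g t\<close> differ, and one step before both jumps so
  do those of \<open>s\<close> and \<open>t\<close>.\<close>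

lemma E_P_eq:
  assumes st: "s \<in> P" "t \<in> P" and E: "E s t"
  shows "s = t"
proof (rule ccontr)
  assume ne: "s \<noteq> t"
  let ?S = "{g s, opp G (g s), g t, opp G (g t)}"
  have gst: "g s \<in> P" "g t \<in> P" "g s \<noteq> g t" using g_P st ne g_inj by auto
  obtain \<phi> where \<phi>: "separates G ?S \<phi>"
    using planar_G[unfolded planar_def, rule_format, OF even_cycle_pair[OF gst]] by (rule exE)
  have SQ: "?S \<subseteq> Q" using gst by (auto simp: Q_def)
  have S_P: "g x \<in> ?S \<longleftrightarrow> g x = g s \<or> g x = g t" if "x \<in> P" for x
    using opp_P[OF gst(1)] opp_P[OF gst(2)] g_P[OF that] by auto
  have \<phi>_g: "\<phi> (g x) \<noteq> \<phi> x \<longleftrightarrow> g x = g s \<or> g x = g t" if "x \<in> P" for x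
  proof -
    have "x \<in> Q" using that by (simp add: Q_def)
    from separates_ret(2)[OF \<phi> SQ P_darts[OF that] this rot_orbit_self]
    have "\<phi> (g x) \<noteq> \<phi> x \<longleftrightarrow> g x \<in> ?S" by (simp only: g_ret[OF that])
    then show ?thesis using S_P[OF that] by blast
  qed
  have "g t \<in> orbit g (g s)" using orbit_g[OF gst(1)] gst(2) by simp
  then obtain I where I: "g s \<in> I" "g t \<notin> I" "\<forall>y. (g y \<in> I) \<noteq> (y \<in> I) \<longleftrightarrow> g y = g s \<or> g y = g t"
    by (rule orbit_segment[OF g_permutes _ gst(3)])
  have "(\<phi> x \<noteq> (x \<in> I)) = (\<phi> s \<noteq> (s \<in> I))" if "x \<in> orbit g s" for x
    using that
  proof induction
    case base
    show ?case using \<phi>_g[OF st(1)] I(3)[rule_format, of s] by blast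
  next
    case (step y)
    then have "y \<in> P" using orbit_g[OF st(1)] by simp
    then show ?case using \<phi>_g[of y] I(3)[rule_format, of y] step(2) by blast
  qed
  note const = this
  have "\<phi> (g s) \<noteq> \<phi> (g t)"
    using const[of "g s"] const[of "g t"] orbit_g[OF st(1)] gst I(1,2) by blast
  then have "\<phi> s \<noteq> \<phi> t" using \<phi>_g[OF st(1)] \<phi>_g[OF st(2)] by blast
  then show False using separates_E[OF \<phi> SQ E] by blast
qed

definition region where "region t = {d \<in> darts G. E t d}"

lemma theta_regions_eq: "theta_regions G = region ` P"
proof -
  have "region d \<in> region ` P" if d: "d \<in> darts G" for d
  proof -
    obtain t where t: "t \<in> P" "E d t" using E_P[OF d] by blast
    have "E d z \<longleftrightarrow> E t z" for z using t(2) E_sym E_trans by blast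
    then have "region d = region t" by (simp add: region_def)
    then show ?thesis using t(1) by blast
  qed
  then show ?thesis using P_darts by (auto simp: theta_regions_def region_def[abs_def])
qed

lemma inj_region: "inj_on region P"
proof (rule inj_onI)
  fix s t assume st: "s \<in> P" "t \<in> P" "region s = region t"
  have "t \<in> region t" using P_darts[OF st(2)] by (simp add: region_def)
  then have "t \<in> region s" unfolding st(3) .
  then have "E s t" by (simp add: region_def)
  then show "s = t" by (rule E_P_eq[OF st(1,2)])
qed

text \<open>As the rotation at \<open>u\<close> is counterclockwise, the positive side of an edge is
  the corner of its dart \<open>q\<close> at \<open>u\<close>, and the negative side is the corner
  \<open>opp G q\<close> at \<open>v\<close>. By \<open>E_opp\<close> the latter belongs to the
  predecessor of \<open>q\<close>.\<close>

lemma side_conditions: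
  assumes t: "t \<in> P" and q: "q \<in> P"
  shows "on_positive_side G (region t) (dart_edge G q) \<longleftrightarrow> q = t"
    and "on_negative_side G (region t) (dart_edge G q) \<longleftrightarrow> q = g t"
proof -
  note qd = P_darts[OF q]
  have ccw: "q \<in> ccw G" "opp G q \<notin> ccw G"
    using ccw_u[OF qd] q ccw_opp[OF qd] by (auto simp: P_def)
  have "on_positive_side G (region t) (dart_edge G q) \<longleftrightarrow> E t q"
    using ccw qd by (auto simp: on_positive_side_def dart_edge_def region_def)
  also have "\<dots> \<longleftrightarrow> q = t" using E_P_eq[OF t q] by auto
  finally show "on_positive_side G (region t) (dart_edge G q) \<longleftrightarrow> q = t" .
  obtain s where s: "s \<in> P" "g s = q" by (rule g_surj[OF q])
  have "on_negative_side G (region t) (dart_edge G q) \<longleftrightarrow> E t (opp G q)"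
    using ccw qd by (auto simp: on_negative_side_def dart_edge_def region_def)
  also have "\<dots> \<longleftrightarrow> E t s"
    using E_opp[OF s(1)] E_sym E_trans unfolding s(2) by blast
  also have "\<dots> \<longleftrightarrow> t = s" using E_P_eq[OF t s(1)] by auto
  also have "\<dots> \<longleftrightarrow> q = g t" using g_inj s(2) by metis
  finally show "on_negative_side G (region t) (dart_edge G q) \<longleftrightarrow> q = g t" .
qed

text \<open>With at least two edges, \<open>g t\<close> differs from \<open>t\<close>, so no region
  lies on both sides of the same edge and nothing is cancelled in the definitions of the signed
  boundaries.\<close>

lemma bd_region:
  assumes t: "t \<in> P"
  shows "bd_minus G (region t) = {dart_edge G t}" "bd_plus G (region t) = {dart_edge G (g t)}"
proof -
  have "e \<in> bd_minus G (region t) \<longleftrightarrow> e \<in> {dart_edge G t}" for e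
    unfolding bd_minus_def theta_edges_eq T_P using side_conditions[OF t] t g_neq[OF t] by auto
  then show "bd_minus G (region t) = {dart_edge G t}" by blast
  have "e \<in> bd_plus G (region t) \<longleftrightarrow> e \<in> {dart_edge G (g t)}" for e
    unfolding bd_plus_def theta_edges_eq T_P using side_conditions[OF t] g_P[OF t] g_neq[OF t] by auto
  then show "bd_plus G (region t) = {dart_edge G (g t)}" by blast
qed

lemma enumeration:
  assumes "card T = n + 1"
  shows "\<exists>e R. bij_betw e {..n} T \<and> bij_betw R {..n} (theta_regions G)
    \<and> (\<forall>i\<le>n. bd_minus G (R i) = {e i} \<and> bd_plus G (R i) = {e (if i = n then 0 else Suc i)})"
proof -
  obtain t where t: "t \<in> P" using P_nonempty by blast
  have card: "card (orbit g t) = Suc n" using orbit_g[OF t] card_P assms by simp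
  let ?t = "\<lambda>i. (g ^^ i) t"
  have bij: "bij_betw ?t {..n} P" and cyc: "?t (Suc n) = t"
    using orbit_enumeration[OF g_permutes finite_Q card] orbit_g[OF t]
    by (simp_all add: lessThan_Suc_atMost)
  have tP: "?t i \<in> P" for i by (induction i) (use t g_P in auto)
  have "bij_betw (dart_edge G \<circ> ?t) {..n} T"
    using inj_dart_edge by (intro bij_betw_trans[OF bij]) (simp add: bij_betw_def T_P)
  moreover have "bij_betw (region \<circ> ?t) {..n} (theta_regions G)"
    using inj_region by (intro bij_betw_trans[OF bij]) (simp add: bij_betw_def theta_regions_eq)
  moreover have "bd_minus G ((region \<circ> ?t) i) = {(dart_edge G \<circ> ?t) i}
      \<and> bd_plus G ((region \<circ> ?t) i) = {(dart_edge G \<circ> ?t) (if i = n then 0 else Suc i)}"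
    if "i \<le> n" for i
    using bd_region[OF tP[of i]] cyc by auto
  ultimately show ?thesis by blast
qed

end

lemma single_theta_cycle:
  assumes G: "spherical G" and T: "theta_graphs G = {T}" and card: "card T = n + 1"
  obtains e R where "bij_betw e {..n} T" "bij_betw R {..n} (theta_regions G)" "1 \<le> n"
    "\<forall>i\<le>n. bd_minus G (R i) = {e i} \<and> bd_plus G (R i) = {e (if i = n then 0 else Suc i)}"
proof -
  interpret dart_map G using G by (simp add: spherical_def)
  have "T \<in> theta_graphs G" using T by simp
  then obtain u v where uv: "T = joining_edges G u v" "u \<noteq> v" and card2: "card T \<ge> 2"
    unfolding theta_graphs_def by blast
  have ccw: "opp G x \<in> ccw G \<longleftrightarrow> x \<notin> ccw G" "rot G x \<in> ccw G \<longleftrightarrow> x \<in> ccw G"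
    if "x \<in> darts G" for x using G that by (auto simp: spherical_def)
  have ccw_orbit: "y \<in> ccw G \<longleftrightarrow> x \<in> ccw G" if "y \<in> orbit (rot G) x" "x \<in> darts G" for x y
  proof -
    have "(y \<in> ccw G \<longleftrightarrow> x \<in> ccw G) \<and> y \<in> darts G" using that(1)
      by induction (use that(2) ccw(2) in \<open>simp_all\<close>)
    then show ?thesis ..
  qed
  have swap: "joining_edges G a b \<subseteq> joining_edges G b a" for a b
  proof
    fix e assume "e \<in> joining_edges G a b"
    then obtain d where d: "d \<in> darts G" "dart_vertex G d = a" "dart_vertex G (opp G d) = b"
      "e = dart_edge G d" by (auto simp: joining_edges_def)
    then have "e = dart_edge G (opp G d)" by (auto simp: dart_edge_def)
    then show "e \<in> joining_edges G b a" using d unfolding joining_edges_def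
      by (intro image_eqI[of _ _ "opp G d"]) auto
  qed
  have "\<exists>u v. T = joining_edges G u v \<and> u \<noteq> v \<and> (\<forall>d\<in>darts G. dart_vertex G d = u \<longrightarrow> d \<in> ccw G)"
  proof -
    have "T \<noteq> {}" using card2 by auto
    then obtain d where d: "d \<in> darts G" "dart_vertex G d = u" "dart_vertex G (opp G d) = v"
      unfolding uv(1) joining_edges_def by blast
    have same: "x \<in> ccw G \<longleftrightarrow> y \<in> ccw G"
      if "x \<in> darts G" "y \<in> darts G" "dart_vertex G x = dart_vertex G y" for x y
      using ccw_orbit[of x y] that rot_orbit_self[of x] by (simp add: dart_vertex_def)
    show ?thesis
    proof (cases "d \<in> ccw G")
      case True
      then have "\<forall>x\<in>darts G. dart_vertex G x = u \<longrightarrow> x \<in> ccw G" using same d by metis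
      then show ?thesis using uv by blast
    next
      case False
      then have "opp G d \<in> ccw G" using ccw(1)[OF d(1)] by simp
      then have "\<forall>x\<in>darts G. dart_vertex G x = v \<longrightarrow> x \<in> ccw G"
        using same d opp_in_darts by metis
      moreover have "T = joining_edges G v u" using swap uv(1) by blast
      ultimately show ?thesis using uv(2) by metis
    qed
  qed
  then obtain u v where uv: "T = joining_edges G u v" "u \<noteq> v"
    "\<And>d. d \<in> darts G \<Longrightarrow> dart_vertex G d = u \<Longrightarrow> d \<in> ccw G" by blast
  interpret single_theta G T u v
    by unfold_locales (use G T uv card2 in auto)
  show ?thesis using enumeration[OF card] card card2 that by auto
qed

section \<open>The Kuhn triangulation of a dilated simplex\<close>

text \<open>A composition \<open>w\<^sub>0 + \<dots> + w\<^sub>n = m\<close> is encoded by its tail sums \<open>s\<^sub>k = w\<^sub>k + \<dots> + w\<^sub>n\<close>.\<close>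

definition tail_sums :: "nat \<Rightarrow> nat \<Rightarrow> (nat \<Rightarrow> int) set" where
  "tail_sums m n = {s. s 0 = int m \<and> (\<forall>k>n. s k = 0) \<and> antimono s}"

definition steps_up :: "(nat \<Rightarrow> int) \<Rightarrow> (nat \<Rightarrow> int) \<Rightarrow> bool" where
  "steps_up s t \<longleftrightarrow> (\<forall>k. s k \<le> t k \<and> t k \<le> s k + 1)"

text \<open>The Kuhn (or Freudenthal) triangulation, described as a clique complex. Although
  \<open>steps_up\<close> is not transitive, a clique is linearly ordered by it, with
  \<open>height\<close> giving the order.\<close>

definition kuhn_complex :: "nat \<Rightarrow> nat \<Rightarrow> (nat \<Rightarrow> int) set set" where
  "kuhn_complex m n =
     {U. U \<noteq> {} \<and> U \<subseteq> tail_sums m n \<and> (\<forall>s\<in>U. \<forall>t\<in>U. steps_up s t \<or> steps_up t s)}"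

lemma tail_sumsD:
  assumes "s \<in> tail_sums m n"
  shows "s 0 = int m" "n < k \<Longrightarrow> s k = 0" "i \<le> j \<Longrightarrow> s j \<le> s i" "0 \<le> s k" "s k \<le> int m"
proof -
  show 1: "s 0 = int m" and 2: "n < k \<Longrightarrow> s k = 0" for k
    using assms by (simp_all add: tail_sums_def)
  show 3: "i \<le> j \<Longrightarrow> s j \<le> s i" for i j
    using assms by (simp add: tail_sums_def antimono_def)
  show "s k \<le> int m" using 3[of 0 k] 1 by simp
  show "0 \<le> s k" using 3[of k "Suc (n + k)"] 2[of "Suc (n + k)"] by simp
qed

lemma finite_tail_sums: "finite (tail_sums m n)"
proof (rule finite_imageD)
  show "finite ((\<lambda>s. restrict s {..n}) ` tail_sums m n)"
  proof (rule finite_subset)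
    show "(\<lambda>s. restrict s {..n}) ` tail_sums m n \<subseteq> {..n} \<rightarrow>\<^sub>E {0..int m}"
      using tail_sumsD(4,5) by (intro image_subsetI restrict_PiE_iff[THEN iffD2]) simp
  qed (simp add: finite_PiE)
  show "inj_on (\<lambda>s. restrict s {..n}) (tail_sums m n)"
  proof (rule inj_onI)
    fix s t assume st: "s \<in> tail_sums m n" "t \<in> tail_sums m n"
      and eq: "restrict s {..n} = restrict t {..n}"
    show "s = t"
    proof
      fix k
      show "s k = t k"
      proof (cases "k \<le> n")
        case True
        then show ?thesis using fun_cong[OF eq, of k] by simp
      next
        case False
        then show ?thesis
          using tail_sumsD(2)[OF st(1), of k] tail_sumsD(2)[OF st(2), of k] by simp
      qed
    qed
  qed
qed

text \<open>A strictly monotone rank for \<open>steps_up\<close>. It decides the direction between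
  comparable elements, and its variation by at most \<open>n\<close> bounds the dimension of a
  simplex.\<close>

definition height :: "nat \<Rightarrow> (nat \<Rightarrow> int) \<Rightarrow> int" where
  "height n s = (\<Sum>k=1..n. s k)"

lemma steps_up_height:
  assumes "s \<in> tail_sums m n" "t \<in> tail_sums m n" "steps_up s t"
  shows "height n s \<le> height n t" "height n t \<le> height n s + int n"
    and "height n t \<le> height n s \<Longrightarrow> s = t"
proof -
  show le: "height n s \<le> height n t"
    unfolding height_def using assms(3) by (intro sum_mono) (simp add: steps_up_def)
  have "height n t \<le> (\<Sum>k=1..n. s k + 1)"
    unfolding height_def using assms(3) by (intro sum_mono) (simp add: steps_up_def)
  then show "height n t \<le> height n s + int n" by (simp add: height_def sum.distrib)
  assume "height n t \<le> height n s"
  then have eq: "(\<Sum>k=1..n. s k) = (\<Sum>k=1..n. t k)" using le by (simp add: height_def)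
  have mid: "s k = t k" if "k \<in> {1..n}" for k
    by (rule sum_mono_inv[OF eq _ that]) (use assms(3) in \<open>simp_all add: steps_up_def\<close>)
  show "s = t"
  proof
    fix k
    consider "k = 0" | "k \<in> {1..n}" | "n < k" by fastforce
    then show "s k = t k"
      by cases (use mid tail_sumsD(1,2)[OF assms(1)] tail_sumsD(1,2)[OF assms(2)] in simp_all)
  qed
qed

lemma comparable_by_height:
  assumes "s \<in> tail_sums m n" "t \<in> tail_sums m n" "steps_up s t \<or> steps_up t s"
    "height n s \<le> height n t"
  shows "steps_up s t"
  using assms(3)
proof
  assume "steps_up t s"
  from steps_up_height(3)[OF assms(2,1) this assms(4)] show ?thesis by (simp add: steps_up_def)
qed

lemma simplicial_isoI:
  assumes "inj_on f (\<Union>K)" "(\<lambda>\<sigma>. f ` \<sigma>) ` K = K'"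
  shows "simplicial_iso K K'"
proof -
  have "f ` \<Union>K = \<Union>K'" using assms(2) by blast
  then have "bij_betw f (\<Union>K) (\<Union>K')" using assms(1) by (simp add: bij_betw_def)
  then show ?thesis using assms(2) by (auto simp: simplicial_iso_def)
qed

lemma simplicial_iso_trans:
  assumes "simplicial_iso K K'" "simplicial_iso K' K''"
  shows "simplicial_iso K K''"
proof -
  obtain f g where f: "bij_betw f (\<Union>K) (\<Union>K')" "(\<lambda>\<sigma>. f ` \<sigma>) ` K = K'"
    and g: "bij_betw g (\<Union>K') (\<Union>K'')" "(\<lambda>\<sigma>. g ` \<sigma>) ` K' = K''"
    using assms by (auto simp: simplicial_iso_def)
  have "(\<lambda>\<sigma>. (g \<circ> f) ` \<sigma>) ` K = K''"
    unfolding f(2)[symmetric] g(2)[symmetric] by (simp add: image_image)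
  moreover have "bij_betw (g \<circ> f) (\<Union>K) (\<Union>K'')" by (rule bij_betw_trans[OF f(1) g(1)])
  ultimately show ?thesis unfolding simplicial_iso_def by blast
qed

section \<open>The complex of a single theta-graph\<close>

lemma region_moves_append:
  "region_moves G (xs @ ys) w = Option.bind (region_moves G xs w) (region_moves G ys)"
proof (induction xs arbitrary: w)
  case (Cons r xs)
  then show ?case by (cases "region_move G r w") simp_all
qed simp

text \<open>All that is kept of the topology: edges and regions are numbered cyclically, and
  \<open>R i\<close> moves a unit of weight from \<open>e i\<close> to its successor.\<close>

locale theta_cycle =
  fixes G :: weighted_map and T :: "nat set set" and n m :: nat
    and e :: "nat \<Rightarrow> nat set" and R :: "nat \<Rightarrow> nat set"
  assumes T: "theta_graphs G = {T}" and m: "theta_weight G T = m" and n: "1 \<le> n"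
    and e: "bij_betw e {..n} T" and R: "bij_betw R {..n} (theta_regions G)"
    and bd: "i \<le> n \<Longrightarrow> bd_minus G (R i) = {e i}"
      "i \<le> n \<Longrightarrow> bd_plus G (R i) = {e (if i = n then 0 else Suc i)}"
begin

abbreviation "V \<equiv> K_vertices G"

definition tails :: "(nat set \<Rightarrow> int) \<Rightarrow> nat \<Rightarrow> int" where
  "tails w k = (\<Sum>i\<in>{k..n}. w (e i))"

lemma V_iff: "w \<in> V \<longleftrightarrow> w \<in> T \<rightarrow>\<^sub>E {0..} \<and> tails w 0 = int m"
proof -
  have "theta_edges G = T" by (simp add: theta_edges_def T)
  moreover have "(\<Sum>x\<in>T. w x) = tails w 0"
    using sum.reindex_bij_betw[OF e, of w] by (simp add: tails_def atLeast0AtMost)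
  ultimately show ?thesis by (simp add: K_vertices_def T m)
qed

lemma tails_step: "k \<le> n \<Longrightarrow> tails w k = w (e k) + tails w (Suc k)"
  by (simp add: tails_def sum.atLeast_Suc_atMost)

lemma e_inj: "i \<le> n \<Longrightarrow> j \<le> n \<Longrightarrow> e i = e j \<longleftrightarrow> i = j"
  using e by (auto simp: bij_betw_def inj_on_def)

lemma e_T: "i \<le> n \<Longrightarrow> e i \<in> T"
  using e by (auto simp: bij_betw_def)

lemma V_nonneg: "w \<in> V \<Longrightarrow> i \<le> n \<Longrightarrow> 0 \<le> w (e i)"
  using e_T[of i] by (auto simp: V_iff PiE_iff)

lemma tails_in:
  assumes w: "w \<in> V"
  shows "tails w \<in> tail_sums m n"
proof -
  have "tails w (Suc k) \<le> tails w k" for k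
  proof (cases "k \<le> n")
    case True
    then show ?thesis using tails_step[OF True, of w] V_nonneg[OF w True] by simp
  qed (simp add: tails_def)
  then have "antimono (tails w)" by (intro antimono_iff_le_Suc[THEN iffD2]) simp
  then show ?thesis using w by (simp add: tail_sums_def V_iff tails_def)
qed

lemma tails_inj: "inj_on tails V"
proof (rule inj_onI)
  fix w w' assume w: "w \<in> V" "w' \<in> V" and eq: "tails w = tails w'"
  show "w = w'"
  proof (rule PiE_ext)
    show "w \<in> T \<rightarrow>\<^sub>E {0..}" "w' \<in> T \<rightarrow>\<^sub>E {0..}" using w by (simp_all add: V_iff)
    fix x assume "x \<in> T"
    then obtain i where i: "i \<le> n" "x = e i" using e by (auto simp: bij_betw_def)
    then show "w x = w' x" using tails_step[OF i(1), of w] tails_step[OF i(1), of w'] eq by simp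
  qed
qed

lemma tails_surj:
  assumes s: "s \<in> tail_sums m n"
  obtains w where "w \<in> V" "tails w = s"
proof -
  define w where "w = (\<lambda>x\<in>T. s (inv_into {..n} e x) - s (Suc (inv_into {..n} e x)))"
  have we: "w (e i) = s i - s (Suc i)" if "i \<le> n" for i
    using that e_T[OF that] e bij_betw_inv_into_left[OF e, of i] by (simp add: w_def)
  have "tails w k = s k" for k
  proof (cases "k \<le> n")
    case True
    then have "tails w k = (\<Sum>i\<in>{k..n}. s i - s (Suc i))"
      unfolding tails_def using we by (intro sum.cong) auto
    also have "\<dots> = s k - s (Suc n)"
      using True sum_Suc_diff[of k n "\<lambda>i. - s i"] by (simp add: sum_negf[symmetric])
    finally show ?thesis using tail_sumsD(2)[OF s] by simp
  next
    case False
    then show ?thesis using tail_sumsD(2)[OF s] by (simp add: tails_def)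
  qed
  then have "tails w = s" by blast
  moreover have "w \<in> T \<rightarrow>\<^sub>E {0..}"
    using tail_sumsD(3)[OF s] by (simp add: w_def)
  ultimately show ?thesis using tail_sumsD(1)[OF s] by (intro that[of w]) (simp_all add: V_iff)
qed

lemma region_move_eq:
  assumes "i \<le> n" "0 < w (e i)"
  shows "region_move G (R i) w = Some (\<lambda>x. if x = e (if i = n then 0 else Suc i) then w x + 1
    else if x = e i then w x - 1 else w x)"
  unfolding region_move_def bd[OF assms(1)] singleton_iff using assms(2) by simp

text \<open>The first indicator belongs to the edge that gains a unit, the second to the edge that
  loses one. For \<open>i < n\<close> they differ only at \<open>k = Suc i\<close>, which rises; for
  \<open>i = n\<close> they agree at 0 and all other tail sums fall.\<close>

lemma region_move_tails:
  assumes i: "i \<le> n" and move: "region_move G (R i) w = Some w'" and k: "k \<le> n"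
  shows "tails w' k = tails w k + (if k \<le> (if i = n then 0 else Suc i) then 1 else 0)
    - (if k \<le> i then 1 else 0)"
proof -
  let ?i = "if i = n then 0 else Suc i"
  have i': "?i \<le> n" "?i \<noteq> i" using i n by auto
  have "0 < w (e i)" using move bd[OF i] by (auto simp: region_move_def split: if_splits)
  then have w': "w' = (\<lambda>x. if x = e ?i then w x + 1 else if x = e i then w x - 1 else w x)"
    using region_move_eq[OF i] move by simp
  have "w' (e j) = w (e j) + (if j = ?i then 1 else 0) - (if j = i then 1 else 0)"
    if "j \<le> n" for j
    unfolding w' using e_inj[OF that i] e_inj[OF that i'(1)] i'(2) by (simp del: if_split_asm)
  then have "tails w' k = (\<Sum>j\<in>{k..n}. w (e j) + (if j = ?i then 1 else 0) - (if j = i then 1 else 0))"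
    unfolding tails_def by (intro sum.cong) simp_all
  also have "\<dots> = tails w k + (\<Sum>j\<in>{k..n}. if j = ?i then 1 else 0) - (\<Sum>j\<in>{k..n}. if j = i then 1 else 0)"
    by (simp only: sum.distrib sum_subtractf tails_def)
  also have "(\<Sum>j\<in>{k..n}. if j = i then 1 else 0) = (if k \<le> i then 1 else (0::int))"
    using i by simp
  also have "(\<Sum>j\<in>{k..n}. if j = ?i then 1 else 0) = (if k \<le> ?i then 1 else (0::int))"
    using i'(1) by (simp del: if_split)
  finally show ?thesis .
qed

lemma region_move_V:
  assumes w: "w \<in> V" and i: "i \<le> n" and pos: "0 < w (e i)"
  obtains w' where "region_move G (R i) w = Some w'" "w' \<in> V"
proof -
  let ?i = "if i = n then 0 else Suc i"
  let ?w = "\<lambda>x. if x = e ?i then w x + 1 else if x = e i then w x - 1 else w x"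
  have move: "region_move G (R i) w = Some ?w" by (rule region_move_eq[where w = w, OF i pos])
  have eT: "e i \<in> T" "e ?i \<in> T" using e_T i n by auto
  have "?w \<in> T \<rightarrow>\<^sub>E {0..}"
  proof (rule PiE_I)
    fix x assume x: "x \<in> T"
    then have "0 \<le> w x" using w by (auto simp: V_iff PiE_iff)
    then show "?w x \<in> {0..}" using pos by auto
  next
    fix x assume x: "x \<notin> T"
    then have "x \<noteq> e i" "x \<noteq> e ?i" using eT by blast+
    moreover have "w x = undefined" using w x by (auto simp: V_iff PiE_iff extensional_def)
    ultimately show "?w x = undefined" by simp
  qed
  moreover have "tails ?w 0 = int m"
    using region_move_tails[OF i move, of 0] w by (simp add: V_iff)
  ultimately have "?w \<in> V" by (simp add: V_iff)
  then show ?thesis by (rule that[OF move])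
qed

text \<open>For \<open>k\<close> from 1 to \<open>n\<close>, the region whose move raises the
  \<open>k\<close>-th tail sum; \<open>R n\<close>, which lowers them all, is the only other
  one.\<close>

abbreviation Rp :: "nat \<Rightarrow> nat set" where "Rp k \<equiv> R (k - 1)"

lemma steps_up_support:
  assumes "w \<in> V" "w' \<in> V"
  shows "{k. tails w k < tails w' k} \<subseteq> {1..n}"
proof
  fix k assume k: "k \<in> {k. tails w k < tails w' k}"
  have "k \<noteq> 0"
    using k tail_sumsD(1)[OF tails_in[OF assms(1)]] tail_sumsD(1)[OF tails_in[OF assms(2)]] by (cases k) auto
  moreover have "\<not> n < k"
    using k tail_sumsD(2)[OF tails_in[OF assms(1)], of k] tail_sumsD(2)[OF tails_in[OF assms(2)], of k] by auto
  ultimately show "k \<in> {1..n}" by simp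
qed

text \<open>The smallest lagging index \<open>k\<close> goes first. The tail sum at
  \<open>k - 1\<close> has its final value already, which is at least the final value at
  \<open>k\<close> and so exceeds the current one; hence \<open>e (k - 1)\<close> carries the weight
  that the move requires.\<close>

lemma path_up:
  assumes "w \<in> V" "w' \<in> V" "steps_up (tails w) (tails w')"
  shows "\<exists>ks. distinct ks \<and> set ks = {k. tails w k < tails w' k}
    \<and> region_moves G (map Rp ks) w = Some w'"
  using assms(1,3)
proof (induction "card {k. tails w k < tails w' k}" arbitrary: w rule: less_induct)
  case less
  let ?D = "{k. tails w k < tails w' k}"
  note w = less.prems(1) and up = less.prems(2)
  have up1: "tails w k \<le> tails w' k" "tails w' k \<le> tails w k + 1" for k
    using up by (simp_all add: steps_up_def)
  have D: "?D \<subseteq> {1..n}" by (rule steps_up_support[OF w assms(2)])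
  show ?case
  proof (cases "?D = {}")
    case True
    have "tails w k = tails w' k" for k
    proof -
      have "\<not> tails w k < tails w' k" using True by blast
      then show ?thesis using up1(1)[of k] by linarith
    qed
    then have "tails w = tails w'" by blast
    then have "w = w'" using tails_inj w assms(2) by (simp add: inj_on_def)
    then show ?thesis using True by (intro exI[of _ "[]"]) simp
  next
    case False
    define k where "k = Min ?D"
    have finD: "finite ?D" by (rule finite_subset[OF D]) simp
    have kD: "k \<in> ?D" unfolding k_def by (rule Min_in[OF finD False])
    then have k: "1 \<le> k" "k \<le> n" using D by auto
    let ?i = "k - 1"
    have i: "?i \<le> n" "?i \<noteq> n" "Suc ?i = k" using k by auto
    have "?i \<notin> ?D" using Min_le[OF finD, of ?i] k(1) unfolding k_def[symmetric] by auto
    then have "tails w ?i = tails w' ?i" using up1(1)[of ?i] by simp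
    also have "\<dots> \<ge> tails w' k"
      using tail_sumsD(3)[OF tails_in[OF assms(2)], of ?i k] by simp
    finally have "tails w k < tails w ?i" using kD by simp
    then have pos: "0 < w (e ?i)" using tails_step[OF i(1), of w] i(3) by simp
    obtain w1 where w1: "region_move G (R ?i) w = Some w1" "w1 \<in> V"
      by (rule region_move_V[OF w i(1) pos])
    have t1: "tails w1 j = tails w j + (if j = k then 1 else 0)" for j
    proof (cases "j \<le> n")
      case True
      then show ?thesis using region_move_tails[OF i(1) w1(1) True] i by auto
    next
      case False
      then show ?thesis using k(2) by (simp add: tails_def)
    qed
    have D1: "{j. tails w1 j < tails w' j} = ?D - {k}"
      using up1(2)[of k] by (auto simp: t1)
    have "card (?D - {k}) < card ?D" using finD kD by (intro psubset_card_mono) auto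
    moreover have "steps_up (tails w1) (tails w')"
      unfolding steps_up_def
    proof
      fix j
      show "tails w1 j \<le> tails w' j \<and> tails w' j \<le> tails w1 j + 1"
        using up1[of j] kD up1(2)[of k] by (auto simp: t1)
    qed
    ultimately obtain ks where ks: "distinct ks" "set ks = ?D - {k}"
      "region_moves G (map Rp ks) w1 = Some w'"
      using less.hyps[of w1] w1(2) unfolding D1 by blast
    have "region_moves G (map Rp (k # ks)) w = Some w'" using ks(3) w1(1) by simp
    moreover have "distinct (k # ks)" "set (k # ks) = ?D" using ks(1,2) kD by auto
    ultimately show ?thesis by blast
  qed
qed

text \<open>Elements are added in order of height, joined to the previous top by
  \<open>path_up\<close>. No index is raised twice, since the top exceeds \<open>u0\<close> by at
  most 1 in each entry.\<close>

lemma chain_path: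
  assumes "finite U" "U \<noteq> {}" "U \<subseteq> V"
    "\<And>u u'. u \<in> U \<Longrightarrow> u' \<in> U \<Longrightarrow> steps_up (tails u) (tails u') \<or> steps_up (tails u') (tails u)"
  shows "\<exists>u0\<in>U. \<exists>u1\<in>U. \<exists>ks. (\<forall>u\<in>U. steps_up (tails u0) (tails u))
    \<and> distinct ks \<and> set ks = {k. tails u0 k < tails u1 k}
    \<and> region_moves G (map Rp ks) u0 = Some u1
    \<and> (\<forall>u\<in>U. \<exists>j\<le>length ks. region_moves G (map Rp (take j ks)) u0 = Some u)"
  using assms
proof (induction U rule: finite_ranking_induct[where f = "\<lambda>u. height n (tails u)"])
  case empty
  then show ?case by simp
next
  case (insert x U)
  have xV: "x \<in> V" using insert.prems(2) by simp
  show ?case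
  proof (cases "U = {}")
    case True
    show ?thesis
      by (intro bexI[of _ x] exI[of _ "[]"]) (simp_all add: True steps_up_def)
  next
    case False
    have "\<exists>u0\<in>U. \<exists>u1\<in>U. \<exists>ks. (\<forall>u\<in>U. steps_up (tails u0) (tails u))
      \<and> distinct ks \<and> set ks = {k. tails u0 k < tails u1 k}
      \<and> region_moves G (map Rp ks) u0 = Some u1
      \<and> (\<forall>u\<in>U. \<exists>j\<le>length ks. region_moves G (map Rp (take j ks)) u0 = Some u)"
    proof (rule insert.IH[OF False])
      show "U \<subseteq> V" using insert.prems(2) by simp
      show "steps_up (tails u) (tails u') \<or> steps_up (tails u') (tails u)" if "u \<in> U" "u' \<in> U" for u u'
        by (rule insert.prems(3)) (use that in simp_all)
    qed
    then obtain u0 u1 ks where u0: "u0 \<in> U" "\<forall>u\<in>U. steps_up (tails u0) (tails u)" and u1: "u1 \<in> U"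
      and ks: "distinct ks" "set ks = {k. tails u0 k < tails u1 k}"
        "region_moves G (map Rp ks) u0 = Some u1"
        "\<forall>u\<in>U. \<exists>j\<le>length ks. region_moves G (map Rp (take j ks)) u0 = Some u" by blast
    have up: "steps_up (tails u) (tails x)" if "u \<in> U" for u
    proof (rule comparable_by_height)
      show "tails u \<in> tail_sums m n" "tails x \<in> tail_sums m n"
        using that insert.prems(2) by (auto intro: tails_in)
      show "steps_up (tails u) (tails x) \<or> steps_up (tails x) (tails u)"
        by (rule insert.prems(3)) (use that in simp_all)
      show "height n (tails u) \<le> height n (tails x)" using that insert.hyps(2) by blast
    qed
    obtain ks' where ks': "distinct ks'" "set ks' = {k. tails u1 k < tails x k}"
      "region_moves G (map Rp ks') u1 = Some x"
      using path_up[OF _ xV up[OF u1]] u1 insert.prems(2) by blast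
    have le: "tails u0 k \<le> tails u1 k" "tails u1 k \<le> tails x k" "tails x k \<le> tails u0 k + 1" for k
      using u0 u1 up by (auto simp: steps_up_def)
    have full: "region_moves G (map Rp (ks @ ks')) u0 = Some x"
      using ks(3) ks'(3) by (simp add: region_moves_append)
    have "set ks \<inter> set ks' = {}"
    proof -
      have "\<not> (tails u0 k < tails u1 k \<and> tails u1 k < tails x k)" for k
        using le(3)[of k] by linarith
      then show ?thesis unfolding ks(2) ks'(2) by blast
    qed
    then have dist: "distinct (ks @ ks')" using ks(1) ks'(1) by simp
    have set: "set (ks @ ks') = {k. tails u0 k < tails x k}"
    proof -
      have "tails u0 k < tails u1 k \<or> tails u1 k < tails x k \<longleftrightarrow> tails u0 k < tails x k" for k
        using le[of k] by linarith
      then show ?thesis unfolding set_append ks(2) ks'(2) by blast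
    qed
    have prefix: "\<exists>j\<le>length (ks @ ks'). region_moves G (map Rp (take j (ks @ ks'))) u0 = Some u"
      if u: "u \<in> insert x U" for u
    proof (cases "u = x")
      case True
      then show ?thesis using full by (intro exI[of _ "length (ks @ ks')"]) simp
    next
      case False
      then have "u \<in> U" using u by simp
      then obtain j where "j \<le> length ks" "region_moves G (map Rp (take j ks)) u0 = Some u"
        using ks(4) by blast
      then show ?thesis by (intro exI[of _ j]) simp
    qed
    have "\<forall>u\<in>insert x U. steps_up (tails u0) (tails u)" using u0 up by blast
    note props = conjI[OF this conjI[OF dist conjI[OF set conjI[OF full]]]]
    have "\<forall>u\<in>insert x U. \<exists>j\<le>length (ks @ ks'). region_moves G (map Rp (take j (ks @ ks'))) u0 = Some u"
      using prefix by (rule ballI)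
    from props[OF this] show ?thesis
      using u0(1) by (intro bexI[where x = u0] bexI[where x = x] exI[where x = "ks @ ks'"]) simp_all
  qed
qed

lemma K_span_of_chain:
  assumes fin: "finite U" and U: "U \<noteq> {}" "U \<subseteq> V"
    and chain: "\<And>u u'. u \<in> U \<Longrightarrow> u' \<in> U \<Longrightarrow> steps_up (tails u) (tails u') \<or> steps_up (tails u') (tails u)"
    and pos: "0 < m"
  shows "K_span G U"
proof -
  obtain u0 u1 ks1 where u0: "u0 \<in> U" "\<forall>u\<in>U. steps_up (tails u0) (tails u)" and u1: "u1 \<in> U"
    and ks1: "distinct ks1" "set ks1 = {k. tails u0 k < tails u1 k}"
      "region_moves G (map Rp ks1) u0 = Some u1"
      "\<forall>u\<in>U. \<exists>j\<le>length ks1. region_moves G (map Rp (take j ks1)) u0 = Some u"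
    using chain_path[OF fin U chain] by blast
  have V0: "u0 \<in> V" and V1: "u1 \<in> V" using u0(1) u1 U(2) by auto
  note s0 = tail_sumsD[OF tails_in[OF V0]] and s1 = tail_sumsD[OF tails_in[OF V1]]
  have up01: "tails u0 k \<le> tails u1 k" "tails u1 k \<le> tails u0 k + 1" for k
    using u0(2) u1 by (auto simp: steps_up_def)
  \<comment> \<open>From \<open>u1\<close> raise every tail sum that still lags behind \<open>u0 + 1\<close> and can be raised; then the
    move from \<open>e n\<close> to \<open>e 0\<close> lowers all tail sums, and what remains leads back up to \<open>u0\<close>.\<close>
  define t where "t k = (if n < k then 0 else min (tails u0 k + 1) (int m))" for k
  have "t \<in> tail_sums m n"
    unfolding tail_sums_def
  proof (intro CollectI conjI allI impI)
    show "antimono t"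
    proof (rule antimonoI)
      fix i j :: nat assume "i \<le> j"
      then show "t j \<le> t i" using s0(3)[OF \<open>i \<le> j\<close>] s0(4)[of i] by (auto simp: t_def)
    qed
  qed (use s0(1) in \<open>simp_all add: t_def\<close>)
  then obtain wt where wt: "wt \<in> V" "tails wt = t" by (rule tails_surj)
  have up1t: "tails u1 k \<le> t k" "t k \<le> tails u0 k + 1" for k
    using up01[of k] s1(2)[of k] s1(5)[of k] s0(4)[of k] by (auto simp: t_def)
  have "steps_up (tails u1) (tails wt)"
    unfolding steps_up_def wt(2)
  proof
    show "tails u1 k \<le> t k \<and> t k \<le> tails u1 k + 1" for k
      using up1t[of k] up01(1)[of k] by linarith
  qed
  then obtain ks2 where ks2: "distinct ks2" "set ks2 = {k. tails u1 k < t k}"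
      "region_moves G (map Rp ks2) u1 = Some wt"
    using path_up[OF V1 wt(1)] unfolding wt(2) by blast
  \<comment> \<open>Here \<open>m > 0\<close> matters: the last tail sum is now at least 1, so
    \<open>e n\<close> is not empty and \<open>R n\<close> can be applied.\<close>
  have "0 < t n" using s0(4)[of n] pos by (simp add: t_def)
  moreover have "t (Suc n) = 0" by (simp add: t_def)
  ultimately have "0 < wt (e n)" using tails_step[of n wt] unfolding wt(2) by simp
  then obtain w' where w': "region_move G (R n) wt = Some w'" "w' \<in> V"
    by (rule region_move_V[OF wt(1) order_refl])
  have t': "tails w' k = t k - (if 1 \<le> k \<and> k \<le> n then 1 else 0)" for k
  proof (cases "k \<le> n")
    case True
    then show ?thesis using region_move_tails[OF order_refl w'(1) True] wt(2) by auto
  next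
    case False
    then show ?thesis by (simp add: tails_def t_def)
  qed
  have t_ge: "tails u0 k \<le> t k" for k using up01[of k] up1t[of k] by simp
  have out: "tails u0 k = t k" if "\<not> (1 \<le> k \<and> k \<le> n)" for k
    using that s0(1) s0(2)[of k] by (cases "k = 0") (auto simp: t_def)
  have "steps_up (tails w') (tails u0)"
    unfolding steps_up_def
  proof
    fix k
    show "tails w' k \<le> tails u0 k \<and> tails u0 k \<le> tails w' k + 1"
      using t'[of k] t_ge[of k] up1t(2)[of k] out[of k] by (cases "1 \<le> k \<and> k \<le> n") auto
  qed
  then obtain ks3 where ks3: "distinct ks3" "set ks3 = {k. tails w' k < tails u0 k}"
      "region_moves G (map Rp ks3) w' = Some u0"
    using path_up[OF w'(2) V0] by blast
  \<comment> \<open>What lags behind \<open>u0\<close> after the move \<open>R n\<close> are exactly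
    the indices that the cap \<open>m\<close> kept from rising. With \<open>ks1\<close> and
    \<open>ks2\<close> they make up \<open>{1..n}\<close>, each index once.\<close>
  have set3: "set ks3 = {k \<in> {1..n}. tails u0 k = t k}"
  proof -
    have "tails w' k < tails u0 k \<longleftrightarrow> k \<in> {1..n} \<and> tails u0 k = t k" for k
      using t'[of k] t_ge[of k] out[of k] by auto
    then show ?thesis unfolding ks3(2) by blast
  qed
  define rs where "rs = map Rp ks1 @ map Rp ks2 @ R n # map Rp ks3"
  have full: "region_moves G rs u0 = Some u0"
    using ks1(3) ks2(3) w'(1) ks3(3) by (simp add: rs_def region_moves_append)
  let ?ks = "ks1 @ ks2 @ ks3"
  have 12: "set ks1 \<union> set ks2 = {k. tails u0 k < t k}" "set ks1 \<inter> set ks2 = {}"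
  proof -
    have "tails u0 k < tails u1 k \<or> tails u1 k < t k \<longleftrightarrow> tails u0 k < t k"
      "\<not> (tails u0 k < tails u1 k \<and> tails u1 k < t k)" for k
      using up01[of k] up1t[of k] by linarith+
    then show "set ks1 \<union> set ks2 = {k. tails u0 k < t k}" "set ks1 \<inter> set ks2 = {}"
      unfolding ks1(2) ks2(2) by blast+
  qed
  have "{k. tails u0 k < t k} \<subseteq> {1..n}"
    using steps_up_support[OF V0 wt(1)] wt(2) by simp
  then have set_ks: "set ?ks = {1..n}"
  proof -
    assume sub: "{k. tails u0 k < t k} \<subseteq> {1..n}"
    have "set ?ks = {k. tails u0 k < t k} \<union> {k \<in> {1..n}. tails u0 k = t k}"
      unfolding set_append 12(1)[symmetric] set3 by (rule Un_assoc[symmetric])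
    also have "\<dots> = {1..n}"
    proof
      show "{1..n} \<subseteq> {k. tails u0 k < t k} \<union> {k \<in> {1..n}. tails u0 k = t k}"
      proof
        fix k assume "k \<in> {1..n}"
        then show "k \<in> {k. tails u0 k < t k} \<union> {k \<in> {1..n}. tails u0 k = t k}"
          using t_ge[of k] by (cases "tails u0 k = t k") simp_all
      qed
    qed (use sub in blast)
    finally show ?thesis .
  qed
  have "(set ks1 \<union> set ks2) \<inter> set ks3 = {}"
    unfolding 12(1) set3 by auto
  then have dist_ks: "distinct ?ks"
    unfolding distinct_append set_append using ks1(1) ks2(1) ks3(1) 12(2) by blast
  have injR: "inj_on R {..n}" and imR: "R ` {..n} = theta_regions G"
    using R by (auto simp: bij_betw_def)
  have pred_image: "(\<lambda>k. k - 1) ` {1..n} = {..<n}"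
  proof
    show "{..<n} \<subseteq> (\<lambda>k. k - 1) ` {1..n}"
    proof
      fix i assume "i \<in> {..<n}"
      then show "i \<in> (\<lambda>k. k - 1) ` {1..n}" by (intro image_eqI[of _ _ "Suc i"]) auto
    qed
  qed auto
  have injRp: "inj_on Rp {1..n}"
  proof (rule inj_onI)
    fix a b assume ab: "a \<in> {1..n}" "b \<in> {1..n}" "Rp a = Rp b"
    then have "a - 1 = b - 1" by (intro inj_onD[OF injR]) auto
    then show "a = b" using ab(1,2) by auto
  qed
  have imRp: "Rp ` {1..n} = R ` {..<n}"
    unfolding pred_image[symmetric] image_image ..
  have dist: "distinct (map Rp ?ks)" using dist_ks injRp set_ks by (simp only: distinct_map)
  have set: "set (map Rp ?ks) = R ` {..<n}" using imRp set_ks by (simp only: set_map)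
  have notin: "R n \<notin> set (map Rp ?ks)"
    unfolding set
  proof
    assume "R n \<in> R ` {..<n}"
    then obtain i where i: "i < n" "R n = R i" by blast
    have "n = i" by (rule inj_onD[OF injR i(2)]) (use i(1) in simp_all)
    then show False using i(1) by simp
  qed
  have "distinct (xs @ ys @ y # zs) \<and> set (xs @ ys @ y # zs) = insert y (set (xs @ ys @ zs))"
    if "distinct (xs @ ys @ zs)" "y \<notin> set (xs @ ys @ zs)" for xs ys zs and y :: "nat set"
    using that by auto
  from this[OF dist[unfolded map_append] notin[unfolded map_append]]
  have "distinct rs" "set rs = R ` insert n {..<n}"
    unfolding map_append[symmetric] set image_insert rs_def by (rule conjunct1, rule conjunct2)
  moreover have "insert n {..<n} = {..n}" by auto
  ultimately have rs: "distinct rs" "set rs = theta_regions G" using imR by simp_all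
  have "region_moves G (take j rs) u0 \<noteq> None" for j
  proof
    assume "region_moves G (take j rs) u0 = None"
    then have "region_moves G (take j rs @ drop j rs) u0 = None" by (simp only: region_moves_append bind.bind_lzero)
    then show False using full by simp
  qed
  moreover have "\<exists>j\<in>{1..length rs}. region_moves G (take j rs) u0 = Some u" if u: "u \<in> U" for u
  proof -
    obtain j where j: "j \<le> length ks1" "region_moves G (map Rp (take j ks1)) u0 = Some u"
      using ks1(4) u by blast
    show ?thesis
    \<comment> \<open>\<open>K_span\<close> counts positions from 1, so the starting point itself
      has to be found at the end of the closed walk.\<close>
    proof (cases "j = 0")
      case True
      then have "u = u0" using j(2) by simp
      then show ?thesis using full by (intro bexI[of _ "length rs"]) (simp_all add: rs_def)
    next
      case False
      have "take j rs = map Rp (take j ks1)" using j(1) by (simp add: rs_def take_map)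
      then show ?thesis using j False by (intro bexI[of _ j]) (simp_all add: rs_def)
    qed
  qed
  ultimately show ?thesis unfolding K_span_def using rs u0(1) by blast
qed

lemma region_moves_tails:
  assumes "region_moves G rs w = Some w'" "distinct rs" "set rs \<subseteq> R ` {..n}" "1 \<le> k" "k \<le> n"
  shows "tails w' k = tails w k + (if Rp k \<in> set rs then 1 else 0) - (if R n \<in> set rs then 1 else 0)"
  using assms(1-3)
proof (induction rs arbitrary: w)
  case Nil
  then show ?case by simp
next
  case (Cons r rs)
  obtain i where i: "i \<le> n" "r = R i" using Cons.prems(3) by auto
  obtain w1 where w1: "region_move G r w = Some w1" "region_moves G rs w1 = Some w'"
    using Cons.prems(1) by (cases "region_move G r w") auto
  have R_eq: "R a = R b \<longleftrightarrow> a = b" if "a \<le> n" "b \<le> n" for a b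
    using R that by (auto simp: bij_betw_def inj_on_def)
  have "tails w' k = tails w1 k + (if Rp k \<in> set rs then 1 else 0) - (if R n \<in> set rs then 1 else 0)"
    using Cons w1(2) by simp
  moreover have "tails w1 k = tails w k + (if Rp k = r then 1 else 0) - (if R n = r then 1 else 0)"
  proof -
    have "k - 1 \<le> n" using assms(5) by simp
    then have "R (k - 1) = R i \<longleftrightarrow> k - 1 = i" by (rule R_eq[OF _ i(1)])
    also have "\<dots> \<longleftrightarrow> k = Suc i" using assms(4) by auto
    finally have 1: "Rp k = r \<longleftrightarrow> k = Suc i" unfolding i(2) .
    have 2: "R n = r \<longleftrightarrow> n = i" unfolding i(2) by (rule R_eq[OF order_refl i(1)])
    have "tails w1 k = tails w k + (if k \<le> (if i = n then 0 else Suc i) then 1 else 0)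
      - (if k \<le> i then 1 else 0)"
      by (rule region_move_tails[OF i(1) w1(1)[unfolded i(2)] assms(5)])
    then show ?thesis
      unfolding 1 2 using assms(4,5) by (auto split: if_splits)
  qed
  moreover have "r \<notin> set rs" using Cons.prems(2) by simp
  ultimately show ?case by auto
qed

text \<open>Between two positions of the walk each region occurs at most once. Without
  \<open>R n\<close> the tail sums move by 0 or 1; with \<open>R n\<close> all are lowered once more
  and move by 0 or -1.\<close>

lemma chain_of_K_span:
  assumes U: "U \<subseteq> V" and span: "K_span G U" and u: "u \<in> U" "u' \<in> U"
  shows "steps_up (tails u) (tails u') \<or> steps_up (tails u') (tails u)"
proof -
  obtain u0 rs where rs: "distinct rs" "set rs = theta_regions G"
    and occ: "\<forall>u\<in>U. \<exists>j\<in>{1..length rs}. region_moves G (take j rs) u0 = Some u"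
    using span unfolding K_span_def by blast
  have *: "steps_up (tails a) (tails b) \<or> steps_up (tails b) (tails a)"
    if ab: "a \<in> V" "b \<in> V" "i \<le> j" and a: "region_moves G (take i rs) u0 = Some a"
      and b: "region_moves G (take j rs) u0 = Some b" for a b i j
  proof -
    let ?mid = "drop i (take j rs)"
    have "take j rs = take i rs @ ?mid"
      using ab(3) by (metis append_take_drop_id min.absorb1 take_take)
    then have mid: "region_moves G ?mid a = Some b"
      using a b by (metis bind.bind_lunit region_moves_append)
    have dist: "distinct ?mid" using rs(1) by simp
    have "set ?mid \<subseteq> set rs" by (meson order_trans set_drop_subset set_take_subset)
    also have "set rs = R ` {..n}" using rs(2) R by (simp add: bij_betw_def)
    finally have sub: "set ?mid \<subseteq> R ` {..n}" .
    note t = region_moves_tails[OF mid dist sub]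
    have out: "tails a k = tails b k" if "\<not> (1 \<le> k \<and> k \<le> n)" for k
      using that tail_sumsD(1,2)[OF tails_in[OF ab(1)]] tail_sumsD(1,2)[OF tails_in[OF ab(2)]]
      by (cases "k = 0") auto
    show ?thesis
    proof (cases "R n \<in> set ?mid")
      case True
      have "tails b k \<le> tails a k \<and> tails a k \<le> tails b k + 1" for k
        using t[of k] out[of k] True by (cases "1 \<le> k \<and> k \<le> n") auto
      then show ?thesis by (simp add: steps_up_def)
    next
      case False
      have "tails a k \<le> tails b k \<and> tails b k \<le> tails a k + 1" for k
        using t[of k] out[of k] False by (cases "1 \<le> k \<and> k \<le> n") auto
      then show ?thesis by (simp add: steps_up_def)
    qed
  qed
  obtain i where i: "region_moves G (take i rs) u0 = Some u" using occ u(1) by blast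
  obtain j where j: "region_moves G (take j rs) u0 = Some u'" using occ u(2) by blast
  have uV: "u \<in> V" "u' \<in> V" using U u by auto
  show ?thesis
  proof (cases "i \<le> j")
    case True
    then show ?thesis by (rule *[OF uV _ i j])
  next
    case False
    then have "j \<le> i" by simp
    from *[OF uV(2,1) this j i] show ?thesis by blast
  qed
qed

lemma tails_mem_kuhn_complex:
  assumes "U \<in> K_complex G"
  shows "tails ` U \<in> kuhn_complex m n"
proof -
  have U: "U \<noteq> {}" "U \<subseteq> V" "(\<exists>u. U = {u}) \<or> K_span G U"
    using assms by (auto simp: K_complex_def)
  have "steps_up (tails u) (tails u') \<or> steps_up (tails u') (tails u)" if "u \<in> U" "u' \<in> U" for u u'
    using U(3)
  proof
    assume "\<exists>u. U = {u}"
    then have "u = u'" using that by blast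
    then show ?thesis by (simp add: steps_up_def)
  next
    assume "K_span G U"
    then show ?thesis using chain_of_K_span[OF U(2)] that by blast
  qed
  note pair = this
  show ?thesis
    unfolding kuhn_complex_def
  proof (intro CollectI conjI ballI)
    show "tails ` U \<noteq> {}" using U(1) by simp
    show "tails ` U \<subseteq> tail_sums m n" using U(2) tails_in by (intro image_subsetI) auto
    fix s t assume "s \<in> tails ` U" "t \<in> tails ` U"
    then show "steps_up s t \<or> steps_up t s" using pair by (elim imageE) simp
  qed
qed

lemma mem_K_complex:
  assumes U: "U \<subseteq> V" and kuhn: "tails ` U \<in> kuhn_complex m n"
  shows "U \<in> K_complex G"
proof (cases "\<exists>u. U = {u}")
  case True
  then show ?thesis using U by (auto simp: K_complex_def)
next
  case False
  have ne: "U \<noteq> {}" using kuhn by (auto simp: kuhn_complex_def)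
  have sub: "tails ` U \<subseteq> tail_sums m n" using kuhn by (simp add: kuhn_complex_def)
  have "finite (tails ` U)" by (rule finite_subset[OF sub finite_tail_sums])
  then have fin: "finite U" using inj_on_subset[OF tails_inj U] by (rule finite_imageD)
  \<comment> \<open>For \<open>m = 0\<close> there is one vertex only and no move is ever defined;
    its simplex is among the singletons that \<open>K_complex\<close> contains anyway.\<close>
  have "0 < m"
  proof (rule ccontr)
    assume "\<not> 0 < m"
    then have zero: "s = (\<lambda>_. 0)" if "s \<in> tail_sums m n" for s
      using tail_sumsD(4,5)[OF that] by (intro ext) (simp add: order_antisym)
    have "u = u'" if u: "u \<in> U" "u' \<in> U" for u u'
    proof (rule inj_onD[OF tails_inj])
      have "tails u \<in> tail_sums m n" "tails u' \<in> tail_sums m n"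
        using sub u by auto
      then show "tails u = tails u'" using zero by metis
    qed (use U u in auto)
    then show False using False ne by blast
  qed
  then have "K_span G U"
    by (rule K_span_of_chain[OF fin ne U, rotated]) (use kuhn in \<open>simp add: kuhn_complex_def\<close>)
  then show ?thesis using U ne by (simp add: K_complex_def)
qed

lemma K_complex_iso_kuhn: "simplicial_iso (K_complex G) (kuhn_complex m n)"
proof (rule simplicial_isoI)
  have "\<Union>(K_complex G) \<subseteq> V" by (auto simp: K_complex_def)
  then show "inj_on tails (\<Union>(K_complex G))" by (rule inj_on_subset[OF tails_inj])
  show "(\<lambda>\<sigma>. tails ` \<sigma>) ` K_complex G = kuhn_complex m n"
  proof
    show "(\<lambda>\<sigma>. tails ` \<sigma>) ` K_complex G \<subseteq> kuhn_complex m n"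
      using tails_mem_kuhn_complex by blast
    show "kuhn_complex m n \<subseteq> (\<lambda>\<sigma>. tails ` \<sigma>) ` K_complex G"
    proof
      fix W assume W: "W \<in> kuhn_complex m n"
      let ?U = "{w \<in> V. tails w \<in> W}"
      have "W \<subseteq> tails ` ?U"
      proof
        fix s assume s: "s \<in> W"
        then have "s \<in> tail_sums m n" using W by (auto simp: kuhn_complex_def)
        then obtain w where "w \<in> V" "tails w = s" by (rule tails_surj)
        then show "s \<in> tails ` ?U" using s by blast
      qed
      then have WU: "W = tails ` ?U" by blast
      have "?U \<in> K_complex G" by (rule mem_K_complex) (use W WU in auto)
      then show "W \<in> (\<lambda>\<sigma>. tails ` \<sigma>) ` K_complex G" using WU by blast
    qed
  qed
qed

end

section \<open>The edgewise subdivision\<close>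

text \<open>The point with barycentric coordinates \<open>w_k / m\<close>, where the weights are
  recovered as differences of tail sums. For \<open>m = 0\<close> division by zero yields the
  origin, in agreement with \<open>column_point\<close>.\<close>

definition simplex_point :: "nat \<Rightarrow> nat \<Rightarrow> (nat \<Rightarrow> 'v::real_vector) \<Rightarrow> (nat \<Rightarrow> int) \<Rightarrow> 'v" where
  "simplex_point m n v s = (1 / real m) *\<^sub>R (\<Sum>k\<le>n. of_int (s k - s (Suc k)) *\<^sub>R v k)"

definition column_tails :: "nat \<Rightarrow> (nat \<Rightarrow> nat) \<Rightarrow> nat \<Rightarrow> int" where
  "column_tails m x k = int (card {i \<in> {1..m}. k \<le> x i})"

lemma column_tails_in:
  assumes "\<And>i. i \<in> {1..m} \<Longrightarrow> x i \<le> n"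
  shows "column_tails m x \<in> tail_sums m n"
proof -
  have "column_tails m x k = 0" if "n < k" for k
  proof -
    have "{i \<in> {1..m}. k \<le> x i} = {}" using assms that by fastforce
    then show ?thesis by (simp only: column_tails_def card.empty)
  qed
  moreover have "antimono (column_tails m x)"
    by (rule antimonoI) (auto simp: column_tails_def intro!: card_mono)
  moreover have "column_tails m x 0 = int m"
  proof -
    have "{i \<in> {1..m}. 0 \<le> x i} = {1..m}" by auto
    then show ?thesis by (simp only: column_tails_def card_atLeastAtMost diff_Suc_1)
  qed
  ultimately show ?thesis by (simp add: tail_sums_def)
qed

lemma column_point_eq:
  assumes "\<And>i. i \<in> {1..m} \<Longrightarrow> x i j \<le> n"
  shows "column_point m v x j = simplex_point m n v (column_tails m (\<lambda>i. x i j))"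
proof -
  have "(\<Sum>i=1..m. v (x i j)) = (\<Sum>k\<le>n. \<Sum>i\<in>{i \<in> {1..m}. x i j = k}. v (x i j))"
    by (rule sum.group[symmetric]) (use assms in auto)
  also have "\<dots> = (\<Sum>k\<le>n. of_int (column_tails m (\<lambda>i. x i j) k - column_tails m (\<lambda>i. x i j) (Suc k)) *\<^sub>R v k)"
  proof (rule sum.cong[OF refl])
    fix k
    have "{i \<in> {1..m}. k \<le> x i j} = {i \<in> {1..m}. x i j = k} \<union> {i \<in> {1..m}. Suc k \<le> x i j}"
      by auto
    then have "card {i \<in> {1..m}. k \<le> x i j} = card {i \<in> {1..m}. x i j = k} + card {i \<in> {1..m}. Suc k \<le> x i j}"
      by (simp only:) (rule card_Un_disjoint, auto)
    then have "column_tails m (\<lambda>i. x i j) k - column_tails m (\<lambda>i. x i j) (Suc k) = int (card {i \<in> {1..m}. x i j = k})"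
      by (simp add: column_tails_def)
    moreover have "(\<Sum>i\<in>{i \<in> {1..m}. x i j = k}. v (x i j)) = real (card {i \<in> {1..m}. x i j = k}) *\<^sub>R v k"
      by (simp add: sum_constant_scaleR)
    ultimately show "(\<Sum>i\<in>{i \<in> {1..m}. x i j = k}. v (x i j))
      = of_int (column_tails m (\<lambda>i. x i j) k - column_tails m (\<lambda>i. x i j) (Suc k)) *\<^sub>R v k" by simp
  qed
  finally show ?thesis by (simp add: column_point_def simplex_point_def)
qed

text \<open>Affine independence determines the barycentric coordinates, hence the differences of
  consecutive tail sums, and the common start \<open>s 0 = m\<close> then determines the tail
  sums.\<close>

lemma simplex_point_inj:
  assumes v: "simplex_vertices n v"
  shows "inj_on (simplex_point m n v) (tail_sums m n)"
proof (rule inj_onI)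
  fix s t assume s: "s \<in> tail_sums m n" and t: "t \<in> tail_sums m n"
    and eq: "simplex_point m n v s = simplex_point m n v t"
  show "s = t"
  proof (cases "m = 0")
    case True
    have "s k = t k" for k
      using tail_sumsD(4,5)[OF s, of k] tail_sumsD(4,5)[OF t, of k] True by linarith
    then show ?thesis by blast
  next
    case False
    define c where "c k = real_of_int (s k - s (Suc k)) - real_of_int (t k - t (Suc k))" for k
    have inj: "inj_on v {..n}" and aff: "\<not> affine_dependent (v ` {..n})"
      using v by (simp_all add: simplex_vertices_def atLeast0AtMost)
    let ?c = "\<lambda>y. c (inv_into {..n} v y)"
    have c: "?c (v k) = c k" if "k \<in> {..n}" for k
      by (simp only: inv_into_f_f[OF inj that])
    have telescope: "(\<Sum>k\<le>n. s k - s (Suc k)) = s 0 - s (Suc n)" for s :: "nat \<Rightarrow> int"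
      by (rule sum_telescope)
    have "(\<Sum>k\<le>n. c k) = real_of_int (\<Sum>k\<le>n. s k - s (Suc k)) - real_of_int (\<Sum>k\<le>n. t k - t (Suc k))"
      by (simp add: c_def sum_subtractf)
    also have "\<dots> = 0"
      unfolding telescope using tail_sumsD(1,2)[OF s] tail_sumsD(1,2)[OF t] by simp
    finally have sum0: "(\<Sum>y\<in>v ` {..n}. ?c y) = 0"
      using c by (subst sum.reindex[OF inj]) simp
    have "(\<Sum>k\<le>n. of_int (s k - s (Suc k)) *\<^sub>R v k) = (\<Sum>k\<le>n. of_int (t k - t (Suc k)) *\<^sub>R v k)"
      using eq False by (simp add: simplex_point_def)
    then have "(\<Sum>k\<le>n. c k *\<^sub>R v k) = 0"
      by (simp only: c_def scaleR_diff_left sum_subtractf) simp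
    then have sumv0: "(\<Sum>y\<in>v ` {..n}. ?c y *\<^sub>R y) = 0"
      using c by (subst sum.reindex[OF inj]) simp
    have "?c y = 0" if "y \<in> v ` {..n}" for y
      using aff sum0 sumv0 that by (subst (asm) affine_dependent_explicit_finite) blast+
    then have c0: "c k = 0" if "k \<le> n" for k using c[of k] that by fastforce
    have diff: "s k - s (Suc k) = t k - t (Suc k)" for k
    proof (cases "k \<le> n")
      case True
      then show ?thesis using c0[of k] unfolding c_def by linarith
    next
      case False
      then show ?thesis using tail_sumsD(2)[OF s] tail_sumsD(2)[OF t] by simp
    qed
    show ?thesis
    proof
      fix k
      show "s k = t k"
      proof (induction k)
        case 0
        then show ?case using tail_sumsD(1)[OF s] tail_sumsD(1)[OF t] by simp
      next
        case (Suc k)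
        then show ?case using diff[of k] by simp
      qed
    qed
  qed
qed

lemma le_card_downward_closed:
  assumes "\<And>i j. i \<le> j \<Longrightarrow> Q j \<Longrightarrow> Q i" "1 \<le> k" "k \<le> n"
  shows "k \<le> card {i \<in> {1..n}. Q i} \<longleftrightarrow> Q k"
proof
  assume "Q k"
  then have "{1..k} \<subseteq> {i \<in> {1..n}. Q i}" using assms(1)[of _ k] assms(3) by auto
  then have "card {1..k} \<le> card {i \<in> {1..n}. Q i}" by (intro card_mono) auto
  then show "k \<le> card {i \<in> {1..n}. Q i}" by simp
next
  assume le: "k \<le> card {i \<in> {1..n}. Q i}"
  show "Q k"
  proof (rule ccontr)
    assume "\<not> Q k"
    then have "{i \<in> {1..n}. Q i} \<subseteq> {1..<k}" using assms(1)[of k] by (auto simp: not_le[symmetric])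
    then have "card {i \<in> {1..n}. Q i} \<le> card {1..<k}" by (intro card_mono) auto
    then show False using le assms(2) by simp
  qed
qed

text \<open>The \<open>i\<close>-th smallest entry of the column with tail sums \<open>s\<close>.\<close>

definition column_entry :: "nat \<Rightarrow> nat \<Rightarrow> (nat \<Rightarrow> int) \<Rightarrow> nat \<Rightarrow> nat" where
  "column_entry m n s i = card {k \<in> {1..n}. int m < s k + int i}"

lemma column_entry_le: "column_entry m n s i \<le> n"
proof -
  have "column_entry m n s i \<le> card {1..n}"
    unfolding column_entry_def by (rule card_mono) auto
  then show ?thesis by simp
qed

text \<open>The \<open>i\<close>-th smallest of \<open>m\<close> entries is at least
  \<open>k\<close> iff at least \<open>m - i + 1\<close> entries are. By monotonicity of the tail
  sums these \<open>k\<close> form an initial segment of \<open>{1..n}\<close>, so counting them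
  gives the entry.\<close>

lemma le_column_entry:
  assumes "s \<in> tail_sums m n" "1 \<le> k" "k \<le> n"
  shows "k \<le> column_entry m n s i \<longleftrightarrow> int m < s k + int i"
  unfolding column_entry_def
proof (rule le_card_downward_closed[OF _ assms(2,3)])
  fix a b :: nat assume "a \<le> b" "int m < s b + int i"
  then show "int m < s a + int i" using tail_sumsD(3)[OF assms(1), of a b] by linarith
qed

lemma column_tails_column_entry:
  assumes s: "s \<in> tail_sums m n"
  shows "column_tails m (column_entry m n s) = s"
proof
  fix k
  note in_ts = column_tails_in[of m "column_entry m n s" n, OF column_entry_le]
  consider "k = 0" | "1 \<le> k" "k \<le> n" | "n < k" by linarith
  then show "column_tails m (column_entry m n s) k = s k"
  proof cases
    case 1
    then show ?thesis using tail_sumsD(1)[OF s] tail_sumsD(1)[OF in_ts] by simp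
  next
    case 2
    have sk: "0 \<le> s k" "s k \<le> int m" using tail_sumsD(4,5)[OF s] by auto
    define c where "c = nat (s k)"
    have c: "s k = int c" "c \<le> m" using sk by (simp_all add: c_def)
    have "{i \<in> {1..m}. k \<le> column_entry m n s i} = {Suc (m - c)..m}"
    proof (rule set_eqI)
      fix i
      have "i \<in> {1..m} \<and> int m < int c + int i \<longleftrightarrow> Suc (m - c) \<le> i \<and> i \<le> m"
        using c(2) by auto
      then show "i \<in> {i \<in> {1..m}. k \<le> column_entry m n s i} \<longleftrightarrow> i \<in> {Suc (m - c)..m}"
        by (simp only: mem_Collect_eq le_column_entry[OF s 2] c(1) atLeastAtMost_iff)
    qed
    then have "card {i \<in> {1..m}. k \<le> column_entry m n s i} = c"
      using c(2) by simp
    then show ?thesis using c(1) by (simp only: column_tails_def)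
  next
    case 3
    then show ?thesis using tail_sumsD(2)[OF s] tail_sumsD(2)[OF in_ts] by simp
  qed
qed

text \<open>The hypotheses say that two columns interleave, as the row-by-row order of a colour
  scheme demands. Moving down one row takes the rows of \<open>y\<close> with entry at least
  \<open>k\<close> to such rows of \<open>x\<close>, and only the last row can be left over.\<close>

lemma column_tails_mono:
  assumes "\<And>i. i \<in> {1..m} \<Longrightarrow> x i \<le> y i" "\<And>i. i \<in> {1..m} \<Longrightarrow> Suc i \<in> {1..m} \<Longrightarrow> y i \<le> x (Suc i)"
  shows "steps_up (column_tails m x) (column_tails m y)"
  unfolding steps_up_def
proof (intro allI conjI)
  fix k
  let ?X = "{i \<in> {1..m}. k \<le> x i}" and ?Y = "{i \<in> {1..m}. k \<le> y i}"
  have "?X \<subseteq> ?Y" using assms(1) order_trans by blast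
  then have "card ?X \<le> card ?Y" by (intro card_mono) auto
  then show "column_tails m x k \<le> column_tails m y k" by (simp add: column_tails_def)
  have "Suc ` ?Y \<subseteq> insert (Suc m) ?X"
  proof
    fix j assume "j \<in> Suc ` ?Y"
    then obtain i where i: "i \<in> {1..m}" "k \<le> y i" "j = Suc i" by blast
    show "j \<in> insert (Suc m) ?X"
    proof (cases "i = m")
      case False
      then have "Suc i \<in> {1..m}" using i(1) by auto
      then show ?thesis using assms(2)[OF i(1)] i(2,3) by auto
    qed (simp add: i(3))
  qed
  then have "card (Suc ` ?Y) \<le> card (insert (Suc m) ?X)" by (intro card_mono) auto
  also have "\<dots> \<le> Suc (card ?X)" by (rule card_insert_le_m1) auto
  finally have "card ?Y \<le> Suc (card ?X)" by (simp add: card_image)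
  then show "column_tails m y k \<le> column_tails m x k + 1" by (simp add: column_tails_def)
qed

lemma Esd_subset:
  assumes "colour_scheme m n l x"
  shows "(\<lambda>j. column_tails m (\<lambda>i. x i j)) ` {0..l} \<in> kuhn_complex m n"
    and "column_point m v x ` {0..l}
      = simplex_point m n v ` (\<lambda>j. column_tails m (\<lambda>i. x i j)) ` {0..l}"
proof -
  have le_n: "x i j \<le> n" if "i \<in> {1..m}" "j \<in> {0..l}" for i j
    using assms that unfolding colour_scheme_def by (metis atLeastAtMost_iff)
  have mono: "x i j \<le> x i' j'"
    if "i \<in> {1..m}" "i' \<in> {1..m}" "j \<in> {0..l}" "j' \<in> {0..l}" "i < i' \<or> i = i' \<and> j \<le> j'" for i i' j j'
    using assms that unfolding colour_scheme_def by blast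
  have up: "steps_up (column_tails m (\<lambda>i. x i j)) (column_tails m (\<lambda>i. x i j'))"
    if "j \<in> {0..l}" "j' \<in> {0..l}" "j \<le> j'" for j j'
    by (rule column_tails_mono) (use that in \<open>auto intro!: mono\<close>)
  have "steps_up s t \<or> steps_up t s"
    if st: "s \<in> (\<lambda>j. column_tails m (\<lambda>i. x i j)) ` {0..l}" "t \<in> (\<lambda>j. column_tails m (\<lambda>i. x i j)) ` {0..l}" for s t
  proof -
    obtain j j' where j: "j \<in> {0..l}" "s = column_tails m (\<lambda>i. x i j)"
      and j': "j' \<in> {0..l}" "t = column_tails m (\<lambda>i. x i j')" using st by blast
    show ?thesis unfolding j(2) j'(2) using up[OF j(1) j'(1)] up[OF j'(1) j(1)] by linarith
  qed
  moreover have "(\<lambda>j. column_tails m (\<lambda>i. x i j)) ` {0..l} \<subseteq> tail_sums m n"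
    by (intro image_subsetI column_tails_in) (rule le_n)
  ultimately show "(\<lambda>j. column_tails m (\<lambda>i. x i j)) ` {0..l} \<in> kuhn_complex m n"
    by (simp add: kuhn_complex_def)
  have "column_point m v x j = simplex_point m n v (column_tails m (\<lambda>i. x i j))" if "j \<in> {0..l}" for j
    by (rule column_point_eq) (rule le_n[OF _ that])
  then show "column_point m v x ` {0..l} = simplex_point m n v ` (\<lambda>j. column_tails m (\<lambda>i. x i j)) ` {0..l}"
    unfolding image_image by (rule image_cong[OF refl])
qed

text \<open>The height is injective on a simplex, so it sorts the vertices. It increases by at least
  1 at each step and by at most \<open>n\<close> in total, whence \<open>l\<close> is at most
  \<open>n\<close>.\<close>

lemma kuhn_enumeration:
  assumes U: "U \<in> kuhn_complex m n"
  obtains l s where "l \<le> n" "U = s ` {0..l}" "\<And>j. j \<le> l \<Longrightarrow> s j \<in> tail_sums m n"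
    "\<And>j j'. j \<le> j' \<Longrightarrow> j' \<le> l \<Longrightarrow> steps_up (s j) (s j')" "inj_on s {0..l}"
proof -
  have cmp: "steps_up s t \<or> steps_up t s" if "s \<in> U" "t \<in> U" for s t
    using U that by (auto simp: kuhn_complex_def)
  have ne: "U \<noteq> {}" and sub: "U \<subseteq> tail_sums m n" using U by (auto simp: kuhn_complex_def)
  let ?h = "height n"
  have up: "steps_up s t" if "s \<in> U" "t \<in> U" "?h s \<le> ?h t" for s t
    by (rule comparable_by_height[OF _ _ cmp[OF that(1,2)] that(3)]) (use that sub in auto)
  have inj: "inj_on ?h U"
  proof (rule inj_onI)
    fix s t assume st: "s \<in> U" "t \<in> U" "?h s = ?h t"
    then have "s \<in> tail_sums m n" "t \<in> tail_sums m n" using sub by auto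
    then show "s = t" using steps_up_height(3)[OF _ _ up[OF st(1,2)]] st(3) by simp
  qed
  have fin: "finite U" by (rule finite_subset[OF sub finite_tail_sums])
  define h where "h s = nat (?h s)" for s
  have pos: "0 \<le> ?h s" if "s \<in> U" for s
    unfolding height_def using that sub tail_sumsD(4) by (intro sum_nonneg) blast
  have h: "int (h s) = ?h s" if "s \<in> U" for s using pos[OF that] by (simp add: h_def)
  have injh: "inj_on h U" using inj h by (metis inj_on_def)
  obtain g where g: "bij_betw g {..<card (h ` U)} (h ` U)" "strict_mono_on {..<card (h ` U)} g"
    by (rule ex_bij_betw_strict_mono_card[of "h ` U"]) (use fin in auto)
  define l where "l = card U - 1"
  have cU: "card (h ` U) = Suc l"
    using card_image[OF injh] fin ne by (simp add: l_def card_gt_0_iff)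
  define s where "s j = inv_into U h (g j)" for j
  have gj: "g j \<in> h ` U" if "j \<le> l" for j
    using g(1) that unfolding cU bij_betw_def by auto
  have sU: "s j \<in> U" "h (s j) = g j" if "j \<le> l" for j
    unfolding s_def using inv_into_into[OF gj[OF that]] f_inv_into_f[OF gj[OF that]] by simp_all
  have g_less: "g j < g j'" if "j < j'" "j' \<le> l" for j j'
    using g(2) that unfolding cU strict_mono_on_def by auto
  have up_s: "steps_up (s j) (s j')" if "j \<le> j'" "j' \<le> l" for j j'
  proof (rule up)
    show "s j \<in> U" "s j' \<in> U" using sU that by auto
    have "g j \<le> g j'" using g_less[of j j'] that by (cases "j = j'") auto
    then show "?h (s j) \<le> ?h (s j')" using h sU that by (metis le_trans of_nat_le_iff)
  qed
  have inj_s: "inj_on s {0..l}"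
  proof (rule inj_onI)
    fix j j' assume jj: "j \<in> {0..l}" "j' \<in> {0..l}" "s j = s j'"
    then have "g j = g j'" using sU(2)[of j] sU(2)[of j'] by simp
    then show "j = j'" using g_less[of j j'] g_less[of j' j] jj by (cases j j' rule: linorder_cases) auto
  qed
  have "s ` {0..l} \<subseteq> U" using sU(1) by auto
  moreover have "card (s ` {0..l}) = card U"
    using card_image[OF inj_s] fin ne by (simp add: l_def card_gt_0_iff)
  ultimately have Us: "U = s ` {0..l}" using card_subset_eq[OF fin] by blast
  have "l \<le> n"
  proof -
    have "g 0 + j \<le> g j" if "j \<le> l" for j
      using that
    proof (induction j)
      case (Suc j)
      then show ?case using g_less[of j "Suc j"] by simp
    qed simp
    from this[of l] have "int (g 0) + int l \<le> int (g l)" by simp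
    moreover have "int (g l) \<le> int (g 0) + int n"
    proof -
      have "?h (s l) \<le> ?h (s 0) + int n"
        by (rule steps_up_height(2)[OF _ _ up_s[of 0 l]]) (use sU(1)[of 0] sU(1)[of l] sub in auto)
      then show ?thesis using h[of "s 0"] h[of "s l"] sU[of 0] sU[of l] by simp
    qed
    ultimately show ?thesis by simp
  qed
  then show ?thesis using Us sU(1) sub up_s inj_s by (intro that[of l s]) auto
qed

lemma colour_scheme_of_chain:
  assumes l: "l \<le> n" and s: "\<And>j. j \<le> l \<Longrightarrow> s j \<in> tail_sums m n"
    and up: "\<And>j j'. j \<le> j' \<Longrightarrow> j' \<le> l \<Longrightarrow> steps_up (s j) (s j')" and inj: "inj_on s {0..l}"
  shows "colour_scheme m n l (\<lambda>i j. column_entry m n (s j) i)"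
  unfolding colour_scheme_def
proof (intro conjI ballI impI)
  show "l \<le> n" by fact
  show "column_entry m n (s j) i \<in> {0..n}" for i j using column_entry_le by simp
next
  have *: "\<exists>i\<in>{1..m}. column_entry m n (s j) i \<noteq> column_entry m n (s j') i"
    if j: "j \<le> l" "j' \<le> l" and k: "s j k < s j' k" for j j' k
  proof -
    have "k \<noteq> 0" using k tail_sumsD(1)[OF s[OF j(1)]] tail_sumsD(1)[OF s[OF j(2)]] by (cases k) auto
    moreover have "k \<le> n" using k tail_sumsD(2)[OF s[OF j(1)], of k] tail_sumsD(2)[OF s[OF j(2)], of k]
      by (cases "k \<le> n") auto
    ultimately have k': "1 \<le> k" "k \<le> n" by auto
    \<comment> \<open>In this row the entry of column \<open>j\<close> just fails to reach
      \<open>k\<close>, while the larger tail sum of column \<open>j'\<close> makes its entry reach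
      it.\<close>
    define i where "i = nat (int m - s j k)"
    have i: "int i = int m - s j k" using tail_sumsD(5)[OF s[OF j(1)], of k] by (simp add: i_def)
    have "i \<in> {1..m}"
      using i k tail_sumsD(5)[OF s[OF j(2)], of k] tail_sumsD(4)[OF s[OF j(1)], of k] by auto
    moreover have "k \<le> column_entry m n (s j') i" "\<not> k \<le> column_entry m n (s j) i"
      using le_column_entry[OF s[OF j(1)] k', of i] le_column_entry[OF s[OF j(2)] k', of i] i k by auto
    ultimately show ?thesis by force
  qed
  fix j j' assume j: "j \<in> {0..l}" "j' \<in> {0..l}" "j \<noteq> j'"
  then have "s j \<noteq> s j'" using inj by (auto simp: inj_on_def)
  then obtain k where "s j k \<noteq> s j' k" by blast
  then show "\<exists>i\<in>{1..m}. column_entry m n (s j) i \<noteq> column_entry m n (s j') i"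
    using *[of j j' k] *[of j' j k] j by (cases "s j k" "s j' k" rule: linorder_cases) force+
next
  fix i i' j j' assume ij: "i \<in> {1..m}" "i' \<in> {1..m}" "j \<in> {0..l}" "j' \<in> {0..l}"
    and less: "i < i' \<or> i = i' \<and> j \<le> j'"
  have le: "s j k \<le> s j' k" if "j \<le> j'" for k
    using up[OF that] ij by (simp add: steps_up_def)
  have le1: "s j k \<le> s j' k + 1" for k
  proof (cases "j \<le> j'")
    case True
    then show ?thesis using le[of k] by simp
  next
    case False
    then show ?thesis using up[of j' j] ij by (simp add: steps_up_def)
  qed
  \<comment> \<open>A later row gains at least 1, which makes up for a tail sum that is smaller by
    at most 1. In the same row \<open>j\<close> is at most \<open>j'\<close>, and nothing is
    lost.\<close>
  have "int m < s j' k + int i'" if "int m < s j k + int i" for k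
    using less that le[of k] le1[of k] by auto
  then show "column_entry m n (s j) i \<le> column_entry m n (s j') i'"
    unfolding column_entry_def by (intro card_mono) auto
qed

lemma kuhn_iso_Esd:
  assumes v: "simplex_vertices n v"
  shows "simplicial_iso (kuhn_complex m n) (Esd m n v)"
proof (rule simplicial_isoI)
  have "\<Union>(kuhn_complex m n) \<subseteq> tail_sums m n" by (auto simp: kuhn_complex_def)
  then show "inj_on (simplex_point m n v) (\<Union>(kuhn_complex m n))"
    by (rule inj_on_subset[OF simplex_point_inj[OF v]])
  show "(\<lambda>\<sigma>. simplex_point m n v ` \<sigma>) ` kuhn_complex m n = Esd m n v"
  proof
    show "Esd m n v \<subseteq> (\<lambda>\<sigma>. simplex_point m n v ` \<sigma>) ` kuhn_complex m n"
    proof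
      fix \<sigma> assume "\<sigma> \<in> Esd m n v"
      then obtain l x where x: "\<sigma> = column_point m v x ` {0..l}" "colour_scheme m n l x"
        by (auto simp: Esd_def)
      show "\<sigma> \<in> (\<lambda>\<sigma>. simplex_point m n v ` \<sigma>) ` kuhn_complex m n"
        unfolding x(1) Esd_subset(2)[OF x(2)] by (rule imageI[OF Esd_subset(1)[OF x(2)]])
    qed
    show "(\<lambda>\<sigma>. simplex_point m n v ` \<sigma>) ` kuhn_complex m n \<subseteq> Esd m n v"
    proof (rule image_subsetI)
      fix U assume "U \<in> kuhn_complex m n"
      then obtain l s where l: "l \<le> n" and U: "U = s ` {0..l}"
        and s: "\<And>j. j \<le> l \<Longrightarrow> s j \<in> tail_sums m n"
        and up: "\<And>j j'. j \<le> j' \<Longrightarrow> j' \<le> l \<Longrightarrow> steps_up (s j) (s j')" and inj: "inj_on s {0..l}"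
        by (rule kuhn_enumeration) blast
      let ?x = "\<lambda>i j. column_entry m n (s j) i"
      have x: "colour_scheme m n l ?x" by (rule colour_scheme_of_chain[OF l s up inj])
      have "column_tails m (\<lambda>i. ?x i j) = s j" if "j \<in> {0..l}" for j
        using column_tails_column_entry[OF s, of j] that by simp
      then have "U = (\<lambda>j. column_tails m (\<lambda>i. ?x i j)) ` {0..l}" unfolding U by simp
      then have "simplex_point m n v ` U = column_point m v ?x ` {0..l}"
        using Esd_subset(2)[OF x, of v] by simp
      then show "simplex_point m n v ` U \<in> Esd m n v" using x unfolding Esd_def by blast
    qed
  qed
qed

theorem proposition7p3:
  fixes L :: link and D :: link_diagram and G :: weighted_map
    and T :: "nat set set" and n m :: nat and v :: "nat \<Rightarrow> 'v::euclidean_space"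
  assumes "oriented_link L" and "non_split L" and "prime_link L"
    and "diagram_of D L" and "reduced_diagram D" and "special D" and "alternating D"
    and "GF D G"
    and "theta_graphs G = {T}" and "card T = n + 1" and "theta_weight G T = m"
    and "simplex_vertices n v"
  shows "simplicial_iso (K_complex G) (Esd m n v)"
proof -
  have "link_diagram D" using \<open>diagram_of D L\<close> by (simp add: diagram_of_def)
  then have "spherical (black_graph D)" using \<open>special D\<close> by (rule spherical_black_graph)
  then have "spherical G" using \<open>GF D G\<close> by (rule spherical_GF)
  then obtain e R where eR: "bij_betw e {..n} T" "bij_betw R {..n} (theta_regions G)" "1 \<le> n"
    and bd: "\<forall>i\<le>n. bd_minus G (R i) = {e i} \<and> bd_plus G (R i) = {e (if i = n then 0 else Suc i)}"
    using single_theta_cycle[OF _ \<open>theta_graphs G = {T}\<close> \<open>card T = n + 1\<close>] by blast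
  interpret theta_cycle G T n m e R
    by (unfold_locales; (fact | (simp only: bd[rule_format])))
  show ?thesis
    by (rule simplicial_iso_trans[OF K_complex_iso_kuhn kuhn_iso_Esd[OF \<open>simplex_vertices n v\<close>]])
qed

end
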